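(* Let $L$ and $B$ be as in the context, with $\rho\ge0$ and $r+\frac\rho2\ge1$, let $s_0=\frac r2+\frac\rho2$, $p>1$, and $c^2<c_1^2$. Let $m_1(c)=\inf\{\mathcal{I}_c(\psi):\psi\in H^{s_0},\ \mathcal{Q}(\psi)=1\}$, and let $\{\psi_n\}\subset H^{s_0}$ be a minimizing sequence, i.e. $\mathcal{Q}(\psi_n)=1$ for all $n$ and $\mathcal{I}_c(\psi_n)\to m_1(c)$. Then there exist a subsequence $\{\psi_{n_k}\}$ and real numbers $y_{n_k}$ such that $\psi_{n_k}(\cdot+y_{n_k})$ converges in $H^{s_0}$ to some $\psi\in H^{s_0}$, and $\psi$ is a minimizer for $m_1(c)$, i.e. $\mathcal{Q}(\psi)=1$ and $\mathcal{I}_c(\psi)=m_1(c)$.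
   Context: $L$ and $B$ are Fourier multiplier (pseudo-differential) operators on $\mathbb{R}$, $\widehat{Lu}(\xi)=l(\xi)\widehat u(\xi)$, $\widehat{Bu}(\xi)=b(\xi)\widehat u(\xi)$, with smooth real symbols of orders $\rho\in\mathbb{R}$ and $-r$ respectively, where $r\ge 0$; for every $k\ge0$, $\frac{d^k}{d\xi^k}l(\xi)=O(|\xi|^{\rho-k})$ and $\frac{d^k}{d\xi^k}b(\xi)=O(|\xi|^{-r-k})$ as $|\xi|\to\infty$; and there are positive constants $c_1,c_2,c_3,c_4$, chosen best possible, with $c_1^2(1+\xi^2)^{\rho/2}\le l(\xi)\le c_2^2(1+\xi^2)^{\rho/2}$ and $c_3^2(1+\xi^2)^{-r/2}\le b(\xi)\le c_4^2(1+\xi^2)^{-r/2}$ for all $\xi$. $L^{1/2}B^{-1/2}$, $B^{-1/2}$ denote the multipliers with symbols $l^{1/2}b^{-1/2}$, $b^{-1/2}$. $H^s$ is the $L^2$-Sobolev space of order $s$. For $\psi\in H^{s_0}$: $\mathcal{I}_c(\psi)=\frac12\int(L^{1/2}B^{-1/2}\psi)^2dx-\frac{c^2}{2}\int(B^{-1/2}\psi)^2dx$ and $\mathcal{Q}(\psi)=\int_{\mathbb{R}}|\psi|^{p+1}dx$. *)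

theory Defs
  imports "HOL-Analysis.Analysis"
begin

definition L2 :: "(real \<Rightarrow> 'a::{real_normed_vector,second_countable_topology}) \<Rightarrow> bool" where
  "L2 f \<longleftrightarrow> f \<in> borel_measurable lborel \<and> integrable lborel (\<lambda>x. (norm (f x))\<^sup>2)"

text \<open>Truncated Fourier integral over [-R,R] (well defined for L2 functions).\<close>
definition fourier_trunc :: "(real \<Rightarrow> complex) \<Rightarrow> real \<Rightarrow> real \<Rightarrow> complex" where
  "fourier_trunc u R \<xi> = (LINT x:{-R..R}|lborel. cis (- (x * \<xi>)) * u x)"

definition is_fourier :: "(real \<Rightarrow> complex) \<Rightarrow> (real \<Rightarrow> complex) \<Rightarrow> bool" where
  "is_fourier u v \<longleftrightarrow> L2 u \<and> L2 v \<and>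
     ((\<lambda>R. LINT \<xi>|lborel. (cmod (v \<xi> - fourier_trunc u R \<xi>))\<^sup>2) \<longlongrightarrow> 0) at_top"

text \<open>Fourier transform (determined up to a.e. equality).\<close>
definition fourier :: "(real \<Rightarrow> complex) \<Rightarrow> (real \<Rightarrow> complex)" where
  "fourier u = (SOME v. is_fourier u v)"

definition sobolev :: "real \<Rightarrow> (real \<Rightarrow> real) set" where
  "sobolev s = {u. L2 u \<and> (\<exists>v. is_fourier (\<lambda>x. complex_of_real (u x)) v \<and>
      integrable lborel (\<lambda>\<xi>. (1 + \<xi>\<^sup>2) powr s * (cmod (v \<xi>))\<^sup>2))}"

definition sobolev_norm :: "real \<Rightarrow> (real \<Rightarrow> real) \<Rightarrow> real" where
  "sobolev_norm s u = sqrt (LINT \<xi>|lborel.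
      (1 + \<xi>\<^sup>2) powr s * (cmod (fourier (\<lambda>x. complex_of_real (u x)) \<xi>))\<^sup>2)"

definition multiplier :: "(real \<Rightarrow> real) \<Rightarrow> (real \<Rightarrow> real) \<Rightarrow> (real \<Rightarrow> complex)" where
  "multiplier m u = (SOME w. \<exists>v. is_fourier (\<lambda>x. complex_of_real (u x)) v \<and>
      is_fourier w (\<lambda>\<xi>. complex_of_real (m \<xi>) * v \<xi>))"

definition I_func :: "(real \<Rightarrow> real) \<Rightarrow> (real \<Rightarrow> real) \<Rightarrow> real \<Rightarrow> (real \<Rightarrow> real) \<Rightarrow> real" where
  "I_func l b c \<psi> =
     1/2 * (LINT x|lborel. (cmod (multiplier (\<lambda>\<xi>. sqrt (l \<xi>) / sqrt (b \<xi>)) \<psi> x))\<^sup>2)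
     - c\<^sup>2 / 2 * (LINT x|lborel. (cmod (multiplier (\<lambda>\<xi>. 1 / sqrt (b \<xi>)) \<psi> x))\<^sup>2)"

definition Q_func :: "real \<Rightarrow> (real \<Rightarrow> real) \<Rightarrow> real" where
  "Q_func p \<psi> = (LINT x|lborel. \<bar>\<psi> x\<bar> powr (p + 1))"

definition smooth_fun :: "(real \<Rightarrow> real) \<Rightarrow> bool" where
  "smooth_fun f \<longleftrightarrow> (\<forall>k x. ((deriv ^^ k) f) differentiable (at x))"

definition symbol_order :: "real \<Rightarrow> (real \<Rightarrow> real) \<Rightarrow> bool" where
  "symbol_order \<rho> f \<longleftrightarrow> (\<forall>k::nat. \<exists>C M. \<forall>\<xi>. \<bar>\<xi>\<bar> \<ge> M \<longrightarrow>
      \<bar>(deriv ^^ k) f \<xi>\<bar> \<le> C * \<bar>\<xi>\<bar> powr (\<rho> - real k))"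

end

theory Submission
  imports Defs "HOL-Probability.Probability" "HOL-Complex_Analysis.Great_Picard"
begin

text \<open>
  By Plancherel's theorem the functional is a weighted square integral of the Fourier transform, with a weight comparable to
  \<open>(1 + \<xi>\<^sup>2)\<^sup>s\<close>, \<open>s = r/2 + \<rho>/2 \<ge> 1/2\<close>. In place of concentration compactness we use Lieb's method.
  Decompose \<open>u\<close> dyadically in frequency. If all low-frequency blocks of \<open>\<psi>\<^sub>n\<close> were uniformly small, then
  so would be the \<open>L\<^sup>p\<^sup>+\<^sup>1\<close> norm; hence after translations some fixed block stays away from zero at the
  origin, and a subsequence converges weakly and almost everywhere to some \<open>\<psi> \<noteq> 0\<close>. The quadratic form
  splits along the weak limit and \<open>Q\<close> splits by the Brezis--Lieb inequality. With \<open>a = Q \<psi>\<close> and the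
  scaling \<open>I u \<ge> m (Q u)\<^bsup>2/(p+1)\<^esup>\<close>, strict concavity of \<open>t\<^bsup>2/(p+1)\<^esup>\<close> forces \<open>a = 1\<close>, so that the remainder
  has vanishing energy, which dominates the Sobolev norm.
\<close>

subsection \<open>Square-integrable functions\<close>

text \<open>The hypotheses admit the endpoint \<open>s = 1/2\<close> (take
  \<open>\<rho> = 0\<close>, \<open>r = 1\<close>), where the Sobolev space is not contained in the
  bounded functions. This is why frequencies are cut dyadically: on each ring the growth of the
  supremum allowed by Cauchy-Schwarz exactly cancels the decay of the mass, so all blocks obey one
  common bound and only their sum needs an exponent above 2. Feeding a small number into this
  estimate for finitely many blocks turns \<open>Q = 1\<close> into a lower bound for one block at
  one point. Moved to the origin, that value is, up to the factor \<open>2 * pi\<close>, the pairing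
  of the transform with the indicator of a ring, a fixed square-integrable function, and therefore
  survives weak limits. The condition on \<open>c\<close> enters through coercivity: it keeps the
  symbol \<open>l - c\<^sup>2\<close> comparable to \<open>l\<close>. The transform is specified as
  a mean-square limit of truncated integrals; its existence, Plancherel's identity and inversion all
  rest on one Gaussian regularisation.\<close>

definition nsq :: "(real \<Rightarrow> 'a::real_normed_vector) \<Rightarrow> real" where
  "nsq f = (LINT x|lborel. (norm (f x))\<^sup>2)"

lemma nsq_nonneg [simp]: "0 \<le> nsq f"
  by (simp add: nsq_def)

lemma L2_integrable_sq: "L2 f \<Longrightarrow> integrable lborel (\<lambda>x. (norm (f x))\<^sup>2)"
  by (simp add: L2_def)

lemma L2_iff_nn_integral:
  fixes f :: "real \<Rightarrow> 'a::{real_normed_vector,second_countable_topology}"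
  shows "L2 f \<longleftrightarrow> f \<in> borel_measurable borel \<and> (\<integral>\<^sup>+x. ennreal ((norm (f x))\<^sup>2) \<partial>lborel) < \<infinity>"
proof -
  have "(\<lambda>x. (norm (f x))\<^sup>2) \<in> borel_measurable borel" if [measurable]: "f \<in> borel_measurable borel"
    by measurable
  then show ?thesis unfolding L2_def integrable_iff_bounded by (simp cong: conj_cong)
qed

lemma nsq_nn_integral: "L2 f \<Longrightarrow> (\<integral>\<^sup>+x. ennreal ((norm (f x))\<^sup>2) \<partial>lborel) = ennreal (nsq f)"
  unfolding nsq_def L2_def by (intro nn_integral_eq_integral) auto

text \<open>The hypothesis concerns the nonnegative integral because \<open>nsq\<close> is a Bochner
  integral, which is 0 by default for a non-integrable integrand: a bound on \<open>nsq f\<close>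
  alone would not give membership in \<open>L2\<close>.\<close>

lemma L2_bound:
  fixes f :: "real \<Rightarrow> 'a::{real_normed_vector,second_countable_topology}"
  assumes "f \<in> borel_measurable borel" "(\<integral>\<^sup>+x. ennreal ((norm (f x))\<^sup>2) \<partial>lborel) \<le> ennreal C" "0 \<le> C"
  shows "L2 f" "nsq f \<le> C"
proof -
  show "L2 f" using assms(1,2) by (simp add: L2_iff_nn_integral order_le_less_trans)
  from nsq_nn_integral[OF this] show "nsq f \<le> C" using assms by simp
qed

lemma L2_dominated:
  fixes f :: "real \<Rightarrow> 'a::{real_normed_vector,second_countable_topology}"
    and g :: "real \<Rightarrow> 'b::{real_normed_vector,second_countable_topology}"
  assumes g: "L2 g" and [measurable]: "f \<in> borel_measurable borel" and le: "\<And>x. norm (f x) \<le> C * norm (g x)"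
  shows "L2 f"
proof -
  have "integrable lborel (\<lambda>x. (norm (f x))\<^sup>2)"
  proof (rule Bochner_Integration.integrable_bound)
    show "integrable lborel (\<lambda>x. C\<^sup>2 * (norm (g x))\<^sup>2)" using g by (simp add: L2_def)
    have "(norm (f x))\<^sup>2 \<le> C\<^sup>2 * (norm (g x))\<^sup>2" for x
      using power_mono[OF le[of x] norm_ge_zero, of 2] by (simp add: power_mult_distrib)
    then show "AE x in lborel. norm ((norm (f x))\<^sup>2) \<le> norm (C\<^sup>2 * (norm (g x))\<^sup>2)"
      by simp
  qed simp
  then show ?thesis by (simp add: L2_def)
qed

lemma nsq_mono:
  fixes f :: "real \<Rightarrow> 'a::{real_normed_vector,second_countable_topology}"
    and g :: "real \<Rightarrow> 'b::{real_normed_vector,second_countable_topology}"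
  assumes "L2 g" "f \<in> borel_measurable borel" "\<And>x. norm (f x) \<le> norm (g x)"
  shows "nsq f \<le> nsq g"
proof -
  have "L2 f" using L2_dominated[of g f 1] assms by simp
  then show ?thesis unfolding nsq_def
    by (intro integral_mono L2_integrable_sq assms power_mono) auto
qed

lemma sum_sq_bound: "((a::real) + b)\<^sup>2 \<le> 2 * a\<^sup>2 + 2 * b\<^sup>2"
  by (smt (verit) sum_squares_bound power2_sum)

lemma L2_add:
  fixes f g :: "real \<Rightarrow> 'a::{real_normed_vector,second_countable_topology}"
  assumes f: "L2 f" and g: "L2 g"
  shows "L2 (\<lambda>x. f x + g x)"
proof -
  have [measurable]: "f \<in> borel_measurable borel" "g \<in> borel_measurable borel" using f g by (auto simp: L2_def)
  have "integrable lborel (\<lambda>x. (norm (f x + g x))\<^sup>2)"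
  proof (rule Bochner_Integration.integrable_bound)
    show "integrable lborel (\<lambda>x. 2 * (norm (f x))\<^sup>2 + 2 * (norm (g x))\<^sup>2)" using f g by (simp add: L2_def)
    have "(norm (f x + g x))\<^sup>2 \<le> 2 * (norm (f x))\<^sup>2 + 2 * (norm (g x))\<^sup>2" for x
      by (rule order_trans[OF power_mono[OF norm_triangle_ineq] sum_sq_bound]) simp
    then show "AE x in lborel. norm ((norm (f x + g x))\<^sup>2) \<le> norm (2 * (norm (f x))\<^sup>2 + 2 * (norm (g x))\<^sup>2)"
      by simp
  qed simp
  then show ?thesis by (simp add: L2_def)
qed

lemma L2_uminus: "L2 f \<Longrightarrow> L2 (\<lambda>x. - f x)"
  by (simp add: L2_def)

lemma L2_diff:
  fixes f g :: "real \<Rightarrow> 'a::{real_normed_vector,second_countable_topology}"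
  assumes "L2 f" "L2 g"
  shows "L2 (\<lambda>x. f x - g x)"
  using L2_add[OF assms(1) L2_uminus[OF assms(2)]] by simp

lemma L2_cmult:
  fixes f :: "real \<Rightarrow> 'a::{real_normed_algebra,second_countable_topology}"
  assumes f: "L2 f"
  shows "L2 (\<lambda>x. a * f x)"
proof (rule L2_dominated[OF f])
  have [measurable]: "f \<in> borel_measurable borel" using f by (simp add: L2_def)
  show "(\<lambda>x. a * f x) \<in> borel_measurable borel" by simp
qed (rule norm_mult_ineq)

lemma L2_of_real [simp]: "L2 (\<lambda>x. complex_of_real (f x)) \<longleftrightarrow> L2 f"
proof -
  have "f \<in> borel_measurable borel" if "(\<lambda>x. complex_of_real (f x)) \<in> borel_measurable borel"
    using measurable_compose[OF that borel_measurable_Re] by simp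
  moreover have "(\<lambda>x. complex_of_real (f x)) \<in> borel_measurable borel" if "f \<in> borel_measurable borel"
    using measurable_compose[OF that borel_measurable_of_real] .
  ultimately have "(\<lambda>x. complex_of_real (f x)) \<in> borel_measurable borel \<longleftrightarrow> f \<in> borel_measurable borel"
    by blast
  then show ?thesis by (simp add: L2_def)
qed

lemma L2_cnj [simp]: "L2 (\<lambda>x. cnj (f x)) \<longleftrightarrow> L2 f"
proof -
  have *: "(\<lambda>x. cnj (g x)) \<in> borel_measurable borel" if "g \<in> borel_measurable borel" for g :: "real \<Rightarrow> complex"
    using that by (intro borel_measurable_continuous_on[where f=cnj]) (auto intro: continuous_intros)
  have "(\<lambda>x. cnj (f x)) \<in> borel_measurable borel \<longleftrightarrow> f \<in> borel_measurable borel"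
    using *[of f] *[of "\<lambda>x. cnj (f x)"] by (metis complex_cnj_cnj ext)
  then show ?thesis by (simp add: L2_def)
qed

lemma L2_indicator:
  fixes f :: "real \<Rightarrow> 'a::{real_normed_vector,second_countable_topology}"
  assumes f: "L2 f" and [measurable]: "A \<in> sets borel"
  shows "L2 (\<lambda>x. indicator A x *\<^sub>R f x)"
proof -
  have [measurable]: "f \<in> borel_measurable borel" using f by (simp add: L2_def)
  show ?thesis by (rule L2_dominated[OF f, of _ 1]) (auto simp: indicator_def)
qed

lemma L2_mult_integrable:
  fixes f :: "real \<Rightarrow> 'a::{real_normed_field,second_countable_topology,banach}"
  assumes f: "L2 f" and g: "L2 g"
  shows "integrable lborel (\<lambda>x. f x * g x)"
proof -
  have [measurable]: "f \<in> borel_measurable borel" "g \<in> borel_measurable borel" using f g by (auto simp: L2_def)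
  show ?thesis
  proof (rule Bochner_Integration.integrable_bound)
    show "integrable lborel (\<lambda>x. (norm (f x))\<^sup>2 + (norm (g x))\<^sup>2)" using f g by (simp add: L2_def)
    have "norm (f x) * norm (g x) \<le> (norm (f x))\<^sup>2 + (norm (g x))\<^sup>2" for x
      using sum_squares_bound[of "norm (f x)" "norm (g x)"]
        mult_nonneg_nonneg[OF norm_ge_zero norm_ge_zero, of "f x" "g x"] by linarith
    then show "AE x in lborel. norm (f x * g x) \<le> norm ((norm (f x))\<^sup>2 + (norm (g x))\<^sup>2)"
      by (simp add: norm_mult)
  qed simp
qed

lemma L2_norm:
  fixes f :: "real \<Rightarrow> 'a::{real_normed_vector,second_countable_topology}"
  assumes "L2 f"
  shows "L2 (\<lambda>x. norm (f x))"
proof -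
  have [measurable]: "f \<in> borel_measurable borel" using assms by (simp add: L2_def)
  show ?thesis using assms by (simp add: L2_def)
qed

lemma L2_norm_mult_integrable:
  fixes f :: "real \<Rightarrow> 'a::{real_normed_vector,second_countable_topology}"
    and g :: "real \<Rightarrow> 'b::{real_normed_vector,second_countable_topology}"
  assumes f: "L2 f" and g: "L2 g"
  shows "integrable lborel (\<lambda>x. norm (f x) * norm (g x))"
  using L2_mult_integrable[OF L2_norm[OF f] L2_norm[OF g]] .

lemma Cauchy_Schwarz_nsq:
  fixes f :: "real \<Rightarrow> 'a::{real_normed_vector,second_countable_topology}"
    and g :: "real \<Rightarrow> 'b::{real_normed_vector,second_countable_topology}"
  assumes f: "L2 f" and g: "L2 g"
  shows "(LINT x|lborel. norm (f x) * norm (g x)) \<le> sqrt (nsq f) * sqrt (nsq g)"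
proof -
  let ?I = "LINT x|lborel. norm (f x) * norm (g x)"
  have "(\<integral>\<^sup>+x. ennreal (norm (f x)) * ennreal (norm (g x)) \<partial>lborel)\<^sup>2
     \<le> (\<integral>\<^sup>+x. (ennreal (norm (f x)))\<^sup>2 \<partial>lborel) * (\<integral>\<^sup>+x. (ennreal (norm (g x)))\<^sup>2 \<partial>lborel)"
    using f g by (intro Cauchy_Schwarz_nn_integral) (auto simp: L2_def)
  also have "(\<integral>\<^sup>+x. ennreal (norm (f x)) * ennreal (norm (g x)) \<partial>lborel) = ennreal ?I"
    using nn_integral_eq_integral[OF L2_norm_mult_integrable[OF f g]] by (simp add: ennreal_mult)
  finally have "(ennreal ?I)\<^sup>2 \<le> ennreal (nsq f) * ennreal (nsq g)"
    using nsq_nn_integral[OF f] nsq_nn_integral[OF g] by (simp add: ennreal_power)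
  then have "?I\<^sup>2 \<le> nsq f * nsq g"
    by (simp add: ennreal_power flip: ennreal_mult)
  then show ?thesis by (simp add: real_le_rsqrt flip: real_sqrt_mult)
qed

lemma Cauchy_Schwarz_integral:
  fixes f g :: "real \<Rightarrow> complex"
  assumes f: "L2 f" and g: "L2 g"
  shows "cmod (LINT x|lborel. f x * g x) \<le> sqrt (nsq f) * sqrt (nsq g)"
proof -
  have "cmod (LINT x|lborel. f x * g x) \<le> (LINT x|lborel. cmod (f x * g x))"
    by (rule integral_norm_bound)
  also have "\<dots> \<le> sqrt (nsq f) * sqrt (nsq g)"
    using Cauchy_Schwarz_nsq[OF f g] by (simp add: norm_mult)
  finally show ?thesis .
qed

lemma nsq_triangle:
  fixes f g :: "real \<Rightarrow> 'a::{real_normed_vector,second_countable_topology}"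
  assumes f: "L2 f" and g: "L2 g"
  shows "sqrt (nsq (\<lambda>x. f x + g x)) \<le> sqrt (nsq f) + sqrt (nsq g)"
proof -
  have "nsq (\<lambda>x. f x + g x) \<le> (LINT x|lborel. (norm (f x))\<^sup>2 + (norm (g x))\<^sup>2 + 2 * (norm (f x) * norm (g x)))"
    unfolding nsq_def
  proof (rule integral_mono)
    show "integrable lborel (\<lambda>x. (norm (f x + g x))\<^sup>2)" using L2_add[OF f g] by (rule L2_integrable_sq)
    show "integrable lborel (\<lambda>x. (norm (f x))\<^sup>2 + (norm (g x))\<^sup>2 + 2 * (norm (f x) * norm (g x)))"
      using L2_norm_mult_integrable[OF f g] f g by (simp add: L2_def)
    show "(norm (f x + g x))\<^sup>2 \<le> (norm (f x))\<^sup>2 + (norm (g x))\<^sup>2 + 2 * (norm (f x) * norm (g x))" for x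
      using power_mono[OF norm_triangle_ineq[of "f x" "g x"] norm_ge_zero, of 2] by (simp add: power2_sum)
  qed
  also have "\<dots> = nsq f + nsq g + 2 * (LINT x|lborel. norm (f x) * norm (g x))"
    using L2_norm_mult_integrable[OF f g] f g by (simp add: L2_def nsq_def)
  also have "\<dots> \<le> nsq f + nsq g + 2 * (sqrt (nsq f) * sqrt (nsq g))"
    using Cauchy_Schwarz_nsq[OF f g] by simp
  also have "\<dots> = (sqrt (nsq f) + sqrt (nsq g))\<^sup>2"
    by (simp add: power2_sum)
  finally show ?thesis by (intro real_le_lsqrt) (auto intro: add_nonneg_nonneg)
qed

lemma nsq_minus_commute: "nsq (\<lambda>x. f x - g x) = nsq (\<lambda>x. g x - f x)"
  by (simp add: nsq_def norm_minus_commute)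

lemma nsq_triangle_rev:
  fixes f g :: "real \<Rightarrow> 'a::{real_normed_vector,second_countable_topology}"
  assumes f: "L2 f" and g: "L2 g"
  shows "\<bar>sqrt (nsq f) - sqrt (nsq g)\<bar> \<le> sqrt (nsq (\<lambda>x. f x - g x))"
proof -
  have "sqrt (nsq f) \<le> sqrt (nsq (\<lambda>x. f x - g x)) + sqrt (nsq g)"
    using nsq_triangle[OF L2_diff[OF f g] g] by simp
  moreover have "sqrt (nsq g) \<le> sqrt (nsq (\<lambda>x. f x - g x)) + sqrt (nsq f)"
    using nsq_triangle[OF L2_diff[OF g f] f] unfolding nsq_minus_commute[of g f] by simp
  ultimately show ?thesis by linarith
qed

text \<open>The reverse triangle inequality for the square roots. The filter is arbitrary, since
  both sequences and a real cutoff radius tending to infinity occur.\<close>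

lemma nsq_tendsto:
  fixes f :: "'i \<Rightarrow> real \<Rightarrow> 'a::{real_normed_vector,second_countable_topology}"
  assumes f: "\<And>n. L2 (f n)" and g: "L2 g" and lim: "((\<lambda>n. nsq (\<lambda>x. f n x - g x)) \<longlongrightarrow> 0) F"
  shows "((\<lambda>n. nsq (f n)) \<longlongrightarrow> nsq g) F"
proof -
  have "((\<lambda>n. sqrt (nsq (\<lambda>x. f n x - g x))) \<longlongrightarrow> 0) F" using tendsto_real_sqrt[OF lim] by simp
  then have "((\<lambda>n. sqrt (nsq (f n)) - sqrt (nsq g)) \<longlongrightarrow> 0) F"
    by (rule Lim_null_comparison[rotated]) (use nsq_triangle_rev[OF f g] in \<open>auto intro!: always_eventually\<close>)
  then have "((\<lambda>n. sqrt (nsq (f n))) \<longlongrightarrow> sqrt (nsq g)) F" by (simp add: LIM_zero_iff)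
  then have "((\<lambda>n. (sqrt (nsq (f n)))\<^sup>2) \<longlongrightarrow> (sqrt (nsq g))\<^sup>2) F" by (rule tendsto_power)
  then show ?thesis by (simp only: real_sqrt_pow2[OF nsq_nonneg])
qed

lemma nsq_zero_AE:
  fixes f :: "real \<Rightarrow> 'a::{real_normed_vector,second_countable_topology}"
  assumes f: "L2 f" and "nsq f = 0"
  shows "AE x in lborel. f x = 0"
proof -
  have "AE x in lborel. (norm (f x))\<^sup>2 = 0"
    using integral_nonneg_eq_0_iff_AE[OF L2_integrable_sq[OF f]] assms(2) unfolding nsq_def by simp
  then show ?thesis by simp
qed

lemma nsq_cong_AE:
  fixes f g :: "real \<Rightarrow> 'a::{real_normed_vector,second_countable_topology}"
  assumes [measurable]: "f \<in> borel_measurable borel" "g \<in> borel_measurable borel"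
    and ae: "AE x in lborel. f x = g x"
  shows "nsq f = nsq g"
  unfolding nsq_def
proof (rule integral_cong_AE)
  show "AE x in lborel. (norm (f x))\<^sup>2 = (norm (g x))\<^sup>2" using ae by eventually_elim simp
qed measurable

lemma L2_cong_AE:
  fixes f g :: "real \<Rightarrow> 'a::{real_normed_vector,second_countable_topology}"
  assumes f: "L2 f" and [measurable]: "g \<in> borel_measurable borel" and ae: "AE x in lborel. f x = g x"
  shows "L2 g"
proof -
  have [measurable]: "f \<in> borel_measurable borel" using f by (simp add: L2_def)
  have "integrable lborel (\<lambda>x. (norm (g x))\<^sup>2) \<longleftrightarrow> integrable lborel (\<lambda>x. (norm (f x))\<^sup>2)"
    by (rule integrable_cong_AE) (use ae in auto)
  then show ?thesis using f by (simp add: L2_def)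
qed

lemma nsq_cmult:
  fixes f :: "real \<Rightarrow> 'a::real_normed_field"
  shows "nsq (\<lambda>x. a * f x) = (norm a)\<^sup>2 * nsq f"
  by (simp add: nsq_def norm_mult power_mult_distrib)

text \<open>Translations are the case \<open>a = 1\<close>, reflection at the origin the case
  \<open>a = -1\<close>.\<close>

lemma nsq_affine:
  fixes f :: "real \<Rightarrow> 'a::{real_normed_vector,second_countable_topology}"
  assumes "\<bar>a\<bar> = 1"
  shows "nsq (\<lambda>x. f (t + a * x)) = nsq f"
proof -
  have "a \<noteq> 0" using assms by auto
  then show ?thesis
    unfolding nsq_def using lborel_integral_real_affine[of a "\<lambda>x. (norm (f x))\<^sup>2" t] assms by simp
qed

lemma L2_affine:
  fixes f :: "real \<Rightarrow> 'a::{real_normed_vector,second_countable_topology}"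
  assumes f: "L2 f" and a: "a \<noteq> 0"
  shows "L2 (\<lambda>x. f (t + a * x))"
proof -
  have [measurable]: "f \<in> borel_measurable borel" using f by (simp add: L2_def)
  show ?thesis using lborel_integrable_real_affine[OF L2_integrable_sq[OF f] a, of t] by (simp add: L2_def)
qed

lemma nsq_dominated_convergence:
  fixes f :: "nat \<Rightarrow> real \<Rightarrow> 'a::{real_normed_vector,second_countable_topology}"
  assumes g: "L2 g" and f: "\<And>n. f n \<in> borel_measurable borel"
    and le: "\<And>n x. norm (f n x) \<le> norm (g x)"
    and lim: "\<And>x. (\<lambda>n. f n x) \<longlonglongrightarrow> 0"
  shows "(\<lambda>n. nsq (f n)) \<longlonglongrightarrow> 0"
proof -
  have "(\<lambda>n. LINT x|lborel. (norm (f n x))\<^sup>2) \<longlonglongrightarrow> (LINT x|(lborel::real measure). 0)"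
  proof (rule Bochner_Integration.integral_dominated_convergence[where w="\<lambda>x. (norm (g x))\<^sup>2"])
    have "(\<lambda>n. (norm (f n x))\<^sup>2) \<longlonglongrightarrow> 0" for x
      using tendsto_power[OF tendsto_norm[OF lim[of x]], of 2] by simp
    then show "AE x in lborel. (\<lambda>n. (norm (f n x))\<^sup>2) \<longlonglongrightarrow> 0" by simp
    have "(norm (f n x))\<^sup>2 \<le> (norm (g x))\<^sup>2" for n x
      using power_mono[OF le[of n x] norm_ge_zero, of 2] .
    then show "AE x in lborel. norm ((norm (f n x))\<^sup>2) \<le> (norm (g x))\<^sup>2" for n by simp
  qed (use f g in \<open>auto simp: L2_def\<close>)
  then show ?thesis by (simp add: nsq_def)
qed

section \<open>Mean convergence and convergence almost everywhere\<close>

lemma Cauchy_power_mean_convergent_subsequence: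
  fixes f :: "nat \<Rightarrow> 'a \<Rightarrow> 'b::{banach,second_countable_topology}" and p :: nat
  assumes p: "p \<ge> 1" and [measurable]: "\<And>n. f n \<in> borel_measurable M"
    and cauchy: "\<And>e::real. e > 0 \<Longrightarrow> \<exists>N. \<forall>m\<ge>N. \<forall>n\<ge>N. (\<integral>\<^sup>+x. ennreal ((norm (f m x - f n x))^p) \<partial>M) \<le> ennreal e"
  obtains k where "strict_mono (k::nat\<Rightarrow>nat)" "AE x in M. convergent (\<lambda>i. f (k i) x)"
proof -
  define d where "d m n = (\<integral>\<^sup>+x. ennreal ((norm (f m x - f n x))^p) \<partial>M)" for m n
  \<comment> \<open>Weighting step \<open>i\<close> by \<open>2^(i*p)\<close> leaves
    \<open>(1/2)^(i*p) \<le> (1/2)^i\<close> of the threshold, which is summable. Hence the weighted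
    steps tend to 0 almost everywhere, and the steps themselves are eventually at most
    \<open>(1/2)^i\<close>.\<close>
  have "\<exists>N. \<forall>m\<ge>N. \<forall>n\<ge>N. d m n \<le> ennreal ((1/4)^(i*p))" for i :: nat
    unfolding d_def by (rule cauchy) simp
  then obtain N where N: "\<And>i m n. m \<ge> N i \<Longrightarrow> n \<ge> N i \<Longrightarrow> d m n \<le> ennreal ((1/4)^(i*p))" by metis
  \<comment> \<open>The sum dominates every threshold with index up to \<open>i\<close>; the extra
    \<open>i\<close> makes \<open>k\<close> strictly increasing even if some \<open>N j\<close>
    vanish.\<close>
  define k where "k i = (\<Sum>j\<le>i. N j) + i" for i
  have k: "strict_mono k" by (auto simp: strict_mono_Suc_iff k_def)
  have kN: "k j \<ge> N i" if "i \<le> j" for i j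
    unfolding k_def using member_le_sum[of i "{..j}" N] that by auto
  have dk: "d (k (Suc i)) (k i) \<le> ennreal ((1/4)^(i*p))" for i
    by (intro N kN) auto
  have "(\<integral>\<^sup>+x. (\<Sum>i. ennreal ((2^i * norm (f (k (Suc i)) x - f (k i) x))^p)) \<partial>M)
      = (\<Sum>i. \<integral>\<^sup>+x. ennreal ((2^i * norm (f (k (Suc i)) x - f (k i) x))^p) \<partial>M)"
    by (rule nn_integral_suminf) simp
  also have "\<dots> = (\<Sum>i. ennreal (2^(i*p)) * d (k (Suc i)) (k i))"
    unfolding d_def
    by (intro suminf_cong) (simp add: power_mult_distrib ennreal_mult power_mult nn_integral_cmult)
  also have "\<dots> \<le> (\<Sum>i. ennreal ((1/2)^i))"
  proof (rule suminf_le)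
    fix i
    have "ennreal (2^(i*p)) * d (k (Suc i)) (k i) \<le> ennreal (2^(i*p)) * ennreal ((1/4)^(i*p))"
      by (intro mult_left_mono dk) simp
    also have "\<dots> = ennreal ((1/2)^(i*p))"
      by (simp add: power_mult_distrib[symmetric] flip: ennreal_mult)
    also have "\<dots> \<le> ennreal ((1/2)^i)"
      using p by (intro ennreal_leI power_decreasing) auto
    finally show "ennreal (2^(i*p)) * d (k (Suc i)) (k i) \<le> ennreal ((1/2)^i)" .
  qed auto
  also have "\<dots> = ennreal (\<Sum>i. (1/2)^i)"
    by (intro suminf_ennreal2) (auto intro: summable_geometric)
  also have "\<dots> < \<infinity>" by simp
  finally have fin: "(\<integral>\<^sup>+x. (\<Sum>i. ennreal ((2^i * norm (f (k (Suc i)) x - f (k i) x))^p)) \<partial>M) < \<infinity>" .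
  have "AE x in M. (\<Sum>i. ennreal ((2^i * norm (f (k (Suc i)) x - f (k i) x))^p)) \<noteq> \<infinity>"
    by (intro nn_integral_noteq_infinite) (use fin in auto)
  then have "AE x in M. convergent (\<lambda>i. f (k i) x)"
  proof eventually_elim
    case (elim x)
    have "summable (\<lambda>i. (2^i * norm (f (k (Suc i)) x - f (k i) x))^p)"
      using elim by (intro summable_suminf_not_top) auto
    then have "(\<lambda>i. (2^i * norm (f (k (Suc i)) x - f (k i) x))^p) \<longlonglongrightarrow> 0" by (rule summable_LIMSEQ_zero)
    then have "\<forall>\<^sub>F i in sequentially. (2^i * norm (f (k (Suc i)) x - f (k i) x))^p < 1"
      by (rule order_tendstoD) simp
    then have ev: "\<forall>\<^sub>F i in sequentially. norm (f (k (Suc i)) x - f (k i) x) \<le> (1/2)^i"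
    proof eventually_elim
      case (elim i)
      then have "2^i * norm (f (k (Suc i)) x - f (k i) x) < 1"
        using one_le_power[of "2^i * norm (f (k (Suc i)) x - f (k i) x)" p] by (meson leD leI)
      then show ?case by (simp add: power_divide field_simps)
    qed
    have "summable (\<lambda>i. f (k (Suc i)) x - f (k i) x)"
      by (rule summable_comparison_test_ev[OF ev]) (auto intro: summable_geometric)
    then show ?case 
      by (simp add: summable_iff_convergent sum_lessThan_telescope[of "\<lambda>i. f (k i) x"] convergent_diff_const_right_iff)
  qed
  with k that show thesis by blast
qed

text \<open>Fatou's lemma with one slot frozen. With \<open>g\<close> a member of a Cauchy sequence
  it turns closeness to later terms into closeness to the limit; with \<open>g = 0\<close> it bounds
  the limit itself.\<close>

lemma lim_power_mean_bound:
  fixes f :: "nat \<Rightarrow> 'a \<Rightarrow> 'b::{real_normed_vector,second_countable_topology}"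
  assumes [measurable]: "\<And>n. f n \<in> borel_measurable M" "g \<in> borel_measurable M"
    and lim: "AE x in M. (\<lambda>i. f i x) \<longlonglongrightarrow> h x"
    and ev: "\<forall>\<^sub>F i in sequentially. (\<integral>\<^sup>+x. ennreal ((norm (g x - f i x))^p) \<partial>M) \<le> C"
  shows "(\<integral>\<^sup>+x. ennreal ((norm (g x - h x))^p) \<partial>M) \<le> C"
proof -
  have "(\<integral>\<^sup>+x. ennreal ((norm (g x - h x))^p) \<partial>M) = (\<integral>\<^sup>+x. liminf (\<lambda>i. ennreal ((norm (g x - f i x))^p)) \<partial>M)"
  proof (rule nn_integral_cong_AE, use lim in eventually_elim)
    case (elim x)
    have "(\<lambda>i. ennreal ((norm (g x - f i x))^p)) \<longlonglongrightarrow> ennreal ((norm (g x - h x))^p)"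
      by (intro tendsto_intros tendsto_ennrealI elim)
    then show ?case by (intro lim_imp_Liminf[symmetric] trivial_limit_sequentially)
  qed
  also have "\<dots> \<le> liminf (\<lambda>i. \<integral>\<^sup>+x. ennreal ((norm (g x - f i x))^p) \<partial>M)"
    by (rule nn_integral_liminf) simp
  also have "\<dots> \<le> C"
    using Liminf_mono[OF ev] by (simp add: Liminf_const)
  finally show ?thesis .
qed

subsection \<open>Continuity of translations in the mean\<close>

lemma integrable_shift:
  fixes f :: "real \<Rightarrow> 'b::{banach,second_countable_topology}"
  assumes "integrable lborel f" shows "integrable lborel (\<lambda>x. f (x - t))"
  using lborel_integrable_real_affine[OF assms, of 1 "-t"] by (simp add: algebra_simps)

lemma integral_shift:
  fixes f :: "real \<Rightarrow> 'b::{banach,second_countable_topology}"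
  shows "(LINT x|lborel. f (x - t)) = (LINT x|lborel. f x)"
  using lborel_integral_real_affine[of 1 f "-t"] by (simp add: algebra_simps)

text \<open>A function and its translate have the same mean, so replacing \<open>f\<close> by
  \<open>g\<close> costs twice the approximation error, uniformly in the translation. The induction
  below approximates at two levels: indicators by those of open sets, and functions by simple
  functions.\<close>

lemma L1_translation_approx:
  fixes f :: "real \<Rightarrow> 'b::{banach,second_countable_topology}"
  assumes f: "integrable lborel f"
    and approx: "\<And>e. e > 0 \<Longrightarrow> \<exists>g. integrable lborel g \<and> (LINT x|lborel. norm (f x - g x)) \<le> e \<and>
      (\<lambda>n. LINT x|lborel. norm (g (x - t n) - g x)) \<longlonglongrightarrow> 0"
  shows "(\<lambda>n. LINT x|lborel. norm (f (x - t n) - f x)) \<longlonglongrightarrow> 0"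
proof (rule LIMSEQ_I)
  fix e :: real assume e: "e > 0"
  obtain g where g: "integrable lborel g" and fg: "(LINT x|lborel. norm (f x - g x)) \<le> e/4"
    and lim: "(\<lambda>n. LINT x|lborel. norm (g (x - t n) - g x)) \<longlonglongrightarrow> 0"
    using approx[of "e/4"] e by auto
  obtain N where N: "\<And>n. n \<ge> N \<Longrightarrow> \<bar>LINT x|lborel. norm (g (x - t n) - g x)\<bar> < e/4"
    using LIMSEQ_D[OF lim, of "e/4"] e by auto
  have "norm ((LINT x|lborel. norm (f (x - t n) - f x)) - 0) < e" if n: "n \<ge> N" for n
  proof -
    note int = integrable_norm[OF Bochner_Integration.integrable_diff[OF integrable_shift[OF g, of "t n"] g]]
      integrable_norm[OF Bochner_Integration.integrable_diff[OF f g]]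
      integrable_shift[OF integrable_norm[OF Bochner_Integration.integrable_diff[OF f g]], of "t n"]
    have "(LINT x|lborel. norm (f (x - t n) - f x)) \<le>
      (LINT x|lborel. (norm (g (x - t n) - g x) + norm (f (x - t n) - g (x - t n))) + norm (f x - g x))"
    proof (rule integral_mono)
      show "integrable lborel (\<lambda>x. norm (f (x - t n) - f x))"
        by (intro integrable_norm Bochner_Integration.integrable_diff integrable_shift f)
      show "integrable lborel (\<lambda>x. (norm (g (x - t n) - g x) + norm (f (x - t n) - g (x - t n))) + norm (f x - g x))"
        by (intro Bochner_Integration.integrable_add int)
      show "norm (f (x - t n) - f x) \<le> (norm (g (x - t n) - g x) + norm (f (x - t n) - g (x - t n))) + norm (f x - g x)" for x
        by norm
    qed
    also have "\<dots> = (LINT x|lborel. norm (g (x - t n) - g x)) + (LINT x|lborel. norm (f (x - t n) - g (x - t n)))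
       + (LINT x|lborel. norm (f x - g x))"
      using int by simp
    also have "(LINT x|lborel. norm (f (x - t n) - g (x - t n))) = (LINT x|lborel. norm (f x - g x))"
      by (rule integral_shift)
    finally show ?thesis using fg N[OF n] e by simp
  qed
  then show "\<exists>no. \<forall>n\<ge>no. norm ((LINT x|lborel. norm (f (x - t n) - f x)) - 0) < e" by blast
qed

text \<open>A point of an open set stays in it under small translations, so the overlap of
  \<open>U\<close> with its translate tends to all of \<open>U\<close>. The symmetric difference is
  determined by the overlap because both sets have the same measure.\<close>

lemma L1_translation_open:
  fixes U :: "real set" and c :: "'b::{banach,second_countable_topology}"
  assumes U: "open U" "emeasure lborel U < \<infinity>" and t: "t \<longlonglongrightarrow> (0::real)"
  shows "(\<lambda>n. LINT x|lborel. norm (indicator U (x - t n) *\<^sub>R c - indicator U x *\<^sub>R c)) \<longlonglongrightarrow> 0"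
proof -
  have [measurable]: "U \<in> sets borel" using U by simp
  have iU: "integrable lborel (indicator U :: real \<Rightarrow> real)" using U by simp
  have iUt: "integrable lborel (\<lambda>x. indicator U x * indicator U (x - t n) :: real)" for n
    by (rule Bochner_Integration.integrable_bound[OF iU]) (auto simp: indicator_def)
  have "(\<lambda>n. LINT x|lborel. indicator U x * indicator U (x - t n) :: real) \<longlonglongrightarrow> (LINT x|lborel. indicator U x)"
  proof (rule Bochner_Integration.integral_dominated_convergence[where w="indicator U"])
    have "(\<lambda>n. indicator U x * indicator U (x - t n) :: real) \<longlonglongrightarrow> indicator U x" for x
    proof (cases "x \<in> U")
      case True
      have "(\<lambda>n. x - t n) \<longlonglongrightarrow> x - 0" by (intro tendsto_intros t)
      then have "\<forall>\<^sub>F n in sequentially. x - t n \<in> U" using U(1) True by (simp add: topological_tendstoD)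
      then have "\<forall>\<^sub>F n in sequentially. indicator U x = (indicator U x * indicator U (x - t n) :: real)"
        by eventually_elim (simp add: True)
      then show ?thesis by (rule Lim_transform_eventually[OF tendsto_const])
    qed simp
    then show "AE x in lborel. (\<lambda>n. indicator U x * indicator U (x - t n) :: real) \<longlonglongrightarrow> indicator U x" by simp
  qed (auto simp: iU indicator_def)
  then have "(\<lambda>n. norm c * (2 * (LINT x|lborel. indicator U x) - 2 * (LINT x|lborel. indicator U x * indicator U (x - t n)))) \<longlonglongrightarrow>
     norm c * (2 * (LINT x|lborel. indicator U x) - 2 * (LINT x|lborel. indicator U x :: real))"
    by (intro tendsto_intros)
  moreover have "(LINT x|lborel. norm (indicator U (x - t n) *\<^sub>R c - indicator U x *\<^sub>R c)) =
    norm c * (2 * (LINT x|lborel. indicator U x) - 2 * (LINT x|lborel. indicator U x * indicator U (x - t n)))" for n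
  proof -
    have "(LINT x|lborel. norm (indicator U (x - t n) *\<^sub>R c - indicator U x *\<^sub>R c)) =
      (LINT x|lborel. norm c * ((indicator U (x - t n) + indicator U x) - 2 * (indicator U x * indicator U (x - t n))))"
      by (rule Bochner_Integration.integral_cong) (auto simp: indicator_def)
    also have "\<dots> = norm c * ((LINT x|lborel. indicator U (x - t n)) + (LINT x|lborel. indicator U x)
        - 2 * (LINT x|lborel. indicator U x * indicator U (x - t n)))"
      using integrable_shift[OF iU, of "t n"] iU iUt[of n] by simp
    also have "(LINT x|lborel. indicator U (x - t n)) = (LINT x|lborel. indicator U x :: real)" by (rule integral_shift)
    finally show ?thesis by simp
  qed
  ultimately show ?thesis by simp
qed

lemma L1_translation_continuous:
  fixes f :: "real \<Rightarrow> 'b::{banach,second_countable_topology}"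
  assumes f: "integrable lborel f" and t: "t \<longlonglongrightarrow> 0"
  shows "(\<lambda>n. LINT x|lborel. norm (f (x - t n) - f x)) \<longlonglongrightarrow> 0"
  using f
proof (induction rule: integrable_induct)
  case (base A c)
  have A[measurable]: "A \<in> sets borel" and finA: "emeasure lborel A < \<infinity>" using base by auto
  show ?case
  proof (rule L1_translation_approx)
    show "integrable lborel (\<lambda>x. indicat_real A x *\<^sub>R c)" using A finA by auto
    fix e :: real assume e: "e > 0"
    \<comment> \<open>The summand 1 keeps the denominator positive when
      \<open>c = 0\<close>.\<close>
    define e' where "e' = e / (norm c + 1)"
    have e': "e' > 0" using e by (simp add: e'_def add_nonneg_pos)
    obtain U where U: "open U" "A \<subseteq> U" "emeasure lborel (U - A) < ennreal e'"
      using outer_regular_lborel[OF A e'] by auto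
    have UA[measurable]: "U - A \<in> sets borel" using U(1) by auto
    have "emeasure lborel U \<le> emeasure lborel A + emeasure lborel (U - A)"
      using emeasure_subadditive[of A lborel "U - A"] U(2) UA by (simp add: Un_absorb1)
    also have "\<dots> < \<infinity>" using finA U(3) by (simp add: order_less_trans[OF U(3)])
    finally have finU: "emeasure lborel U < \<infinity>" .
    have mU: "measure lborel (U - A) \<le> e'"
      using U(3) e' by (metis emeasure_eq_ennreal_measure ennreal_leI ennreal_le_iff less_imp_le measure_nonneg order.strict_implies_not_eq top.not_eq_extremum order_less_trans ennreal_less_top)
    have "(LINT x|lborel. norm (indicator A x *\<^sub>R c - indicator U x *\<^sub>R c)) = (LINT x|lborel. indicator (U - A) x * norm c)"
      using U(2) by (intro Bochner_Integration.integral_cong) (auto simp: indicator_def)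
    also have "\<dots> = measure lborel (U - A) * norm c" by simp
    also have "\<dots> \<le> e' * norm c" using mU by (simp add: mult_right_mono)
    also have "\<dots> \<le> e' * (norm c + 1)" using e' by (intro mult_left_mono) auto
    also have "\<dots> = e" using norm_ge_zero[of c] by (simp add: e'_def del: norm_ge_zero)
    finally have "(LINT x|lborel. norm (indicator A x *\<^sub>R c - indicator U x *\<^sub>R c)) \<le> e" .
    moreover have "integrable lborel (\<lambda>x. indicat_real U x *\<^sub>R c)" using U(1) finU by auto
    ultimately show "\<exists>g. integrable lborel g \<and> (LINT x|lborel. norm (indicator A x *\<^sub>R c - g x)) \<le> e \<and>
      (\<lambda>n. LINT x|lborel. norm (g (x - t n) - g x)) \<longlonglongrightarrow> 0"
      using L1_translation_open[OF U(1) finU t, of c] by (intro exI[of _ "\<lambda>x. indicat_real U x *\<^sub>R c"]) auto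
  qed
next
  case (add f g)
  show ?case
  proof (rule Lim_null_comparison)
    show "(\<lambda>n. (LINT x|lborel. norm (f (x - t n) - f x)) + (LINT x|lborel. norm (g (x - t n) - g x))) \<longlonglongrightarrow> 0"
      using tendsto_add[OF add.IH] by simp
    have "norm (LINT x|lborel. norm ((f (x - t n) + g (x - t n)) - (f x + g x))) \<le>
      (LINT x|lborel. norm (f (x - t n) - f x)) + (LINT x|lborel. norm (g (x - t n) - g x))" for n
    proof -
      have i: "integrable lborel (\<lambda>x. norm (f (x - t n) - f x))" "integrable lborel (\<lambda>x. norm (g (x - t n) - g x))"
        using add.hyps by (auto intro!: integrable_norm Bochner_Integration.integrable_diff integrable_shift)
      have "(LINT x|lborel. norm ((f (x - t n) + g (x - t n)) - (f x + g x))) \<le>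
        (LINT x|lborel. norm (f (x - t n) - f x) + norm (g (x - t n) - g x))"
        using add.hyps i
        by (intro integral_mono)
          (auto intro!: integrable_norm Bochner_Integration.integrable_diff Bochner_Integration.integrable_add
             integrable_shift simp: norm_diff_triangle_ineq)
      then show ?thesis using i by simp
    qed
    then show "\<forall>\<^sub>F n in sequentially. norm (LINT x|lborel. norm ((f (x - t n) + g (x - t n)) - (f x + g x))) \<le>
      (LINT x|lborel. norm (f (x - t n) - f x)) + (LINT x|lborel. norm (g (x - t n) - g x))" by simp
  qed
next
  case (lim f s)
  show ?case
  proof (rule L1_translation_approx[OF lim.hyps(4)])
    fix e :: real assume e: "e > 0"
    \<comment> \<open>The approximants supplied by the induction satisfy
      \<open>norm (s i x) \<le> 2 * norm (f x)\<close>, hence the majorant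
      \<open>3 * norm (f x)\<close>.\<close>
    have "(\<lambda>i. LINT x|lborel. norm (f x - s i x)) \<longlonglongrightarrow> (LINT x|(lborel::real measure). 0)"
    proof (rule Bochner_Integration.integral_dominated_convergence[where w="\<lambda>x. 3 * norm (f x)"])
      have "(\<lambda>i. norm (f x - s i x)) \<longlonglongrightarrow> norm (f x - f x)" for x
        using lim.hyps(2)[of x] by (intro tendsto_intros) auto
      then show "AE x in lborel. (\<lambda>i. norm (f x - s i x)) \<longlonglongrightarrow> 0" by simp
      have "norm (f x - s i x) \<le> 3 * norm (f x)" for i x
        using lim.hyps(3)[of x i] norm_triangle_ineq4[of "f x" "s i x"] by simp
      then show "AE x in lborel. norm (norm (f x - s i x)) \<le> 3 * norm (f x)" for i by simp
    qed (use lim.hyps in auto)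
    then have "\<forall>\<^sub>F i in sequentially. (LINT x|lborel. norm (f x - s i x)) < e"
      by (rule order_tendstoD(2)) (simp add: e)
    then obtain i where "(LINT x|lborel. norm (f x - s i x)) < e"
      using eventually_happens trivial_limit_sequentially by blast
    then show "\<exists>g. integrable lborel g \<and> (LINT x|lborel. norm (f x - g x)) \<le> e \<and>
      (\<lambda>n. LINT x|lborel. norm (g (x - t n) - g x)) \<longlonglongrightarrow> 0"
      using lim.IH[of i] lim.hyps(1)[of i] by (intro exI[of _ "s i"]) auto
  qed
qed

subsection \<open>Plancherel's theorem\<close>

lemma borel_measurable_cnj [measurable]: "cnj \<in> borel_measurable borel"
  by (intro borel_measurable_continuous_onI continuous_intros)

definition fourier_L1 :: "(real \<Rightarrow> complex) \<Rightarrow> real \<Rightarrow> complex" where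
  "fourier_L1 g \<xi> = (LINT x|lborel. cis (- (x * \<xi>)) * g x)"

lemma borel_measurable_cis [measurable]: "cis \<in> borel_measurable borel"
  by (intro borel_measurable_continuous_onI continuous_intros)

lemma integrable_cis_mult:
  assumes g: "integrable lborel g" and [measurable]: "h \<in> borel_measurable borel"
  shows "integrable lborel (\<lambda>x. cis (h x) * g x)"
proof -
  have [measurable]: "g \<in> borel_measurable borel" using g by auto
  show ?thesis by (rule Bochner_Integration.integrable_bound[OF g]) (auto simp: norm_mult)
qed

lemma fourier_L1_bound:
  "cmod (fourier_L1 g \<xi>) \<le> (LINT x|lborel. cmod (g x))"
  unfolding fourier_L1_def
  using integral_norm_bound[of lborel "\<lambda>x. cis (- (x * \<xi>)) * g x"] by (simp add: norm_mult)

lemma fourier_L1_measurable [measurable]: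
  assumes [measurable]: "g \<in> borel_measurable borel"
  shows "fourier_L1 g \<in> borel_measurable borel"
  unfolding fourier_L1_def[abs_def] by measurable

lemma fourier_L1_diff:
  assumes "integrable lborel f" "integrable lborel g"
  shows "fourier_L1 (\<lambda>x. f x - g x) \<xi> = fourier_L1 f \<xi> - fourier_L1 g \<xi>"
  unfolding fourier_L1_def using assms
  by (simp add: right_diff_distrib integrable_cis_mult)

lemma integrable_tensor:
  fixes f g :: "real \<Rightarrow> complex"
  assumes f: "integrable lborel f" and g: "integrable lborel g"
  shows "integrable (lborel \<Otimes>\<^sub>M lborel) (\<lambda>z. f (fst z) * g (snd z))"
proof (rule lborel_pair.Fubini_integrable)
  have [measurable]: "f \<in> borel_measurable borel" "g \<in> borel_measurable borel" using f g by auto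
  show "(\<lambda>z. f (fst z) * g (snd z)) \<in> borel_measurable (lborel \<Otimes>\<^sub>M lborel)" by measurable
  show "integrable lborel (\<lambda>x. LINT y|lborel. cmod (f (fst (x, y)) * g (snd (x, y))))"
    using f by (simp add: norm_mult)
  show "AE x in lborel. integrable lborel (\<lambda>y. f (fst (x, y)) * g (snd (x, y)))" using g by simp
qed

text \<open>The kernel is general because two exchanges of integrals use it: one with the
  exponential, one with a bounded function evaluated at \<open>x - t\<close>.\<close>

lemma Fubini_bounded_kernel:
  fixes f g :: "real \<Rightarrow> complex" and K :: "real \<times> real \<Rightarrow> complex"
  assumes f: "integrable lborel f" and g: "integrable lborel g"
    and [measurable]: "K \<in> borel_measurable (lborel \<Otimes>\<^sub>M lborel)" and K: "\<And>z. cmod (K z) \<le> C"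
  shows "(LINT y|lborel. (LINT x|lborel. K (x, y) * f x * g y)) = (LINT x|lborel. (LINT y|lborel. K (x, y) * f x * g y))"
proof -
  have [measurable]: "f \<in> borel_measurable borel" "g \<in> borel_measurable borel" using f g by auto
  have "integrable (lborel \<Otimes>\<^sub>M lborel) (\<lambda>z. K z * f (fst z) * g (snd z))"
  proof (rule Bochner_Integration.integrable_bound)
    show "integrable (lborel \<Otimes>\<^sub>M lborel) (\<lambda>z. C * cmod (f (fst z) * g (snd z)))"
      by (intro integrable_mult_right integrable_norm integrable_tensor f g)
    show "(\<lambda>z. K z * f (fst z) * g (snd z)) \<in> borel_measurable (lborel \<Otimes>\<^sub>M lborel)" by measurable
    have "cmod (K z * f (fst z) * g (snd z)) \<le> C * cmod (f (fst z) * g (snd z))" for z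
      using mult_right_mono[OF K, of "cmod (f (fst z) * g (snd z))" z] by (simp add: norm_mult mult.assoc)
    then show "AE z in lborel \<Otimes>\<^sub>M lborel. norm (K z * f (fst z) * g (snd z)) \<le> norm (C * cmod (f (fst z) * g (snd z)))"
      by (intro always_eventually allI) (metis abs_ge_self order_trans real_norm_def)
  qed
  then have "integrable (lborel \<Otimes>\<^sub>M lborel) (\<lambda>(x, y). K (x, y) * f x * g y)"
    by (simp only: case_prod_unfold prod.collapse)
  then show ?thesis by (rule lborel_pair.Fubini_integral)
qed

text \<open>The kernel is symmetric in its two variables, so both sides are one double integral.
  This duality carries Plancherel's identity and, extended to mean-square limits, inversion and the
  transfer of weak limits between space and frequency.\<close>

lemma fourier_L1_multiplication_formula:
  assumes g: "integrable lborel g" and h: "integrable lborel h"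
  shows "(LINT \<xi>|lborel. fourier_L1 g \<xi> * h \<xi>) = (LINT x|lborel. g x * fourier_L1 h x)"
proof -
  have "(LINT \<xi>|lborel. fourier_L1 g \<xi> * h \<xi>) = (LINT \<xi>|lborel. (LINT x|lborel. cis (- (x * \<xi>)) * g x * h \<xi>))"
    by (simp add: fourier_L1_def)
  also have "\<dots> = (LINT x|lborel. (LINT \<xi>|lborel. cis (- (x * \<xi>)) * g x * h \<xi>))"
    using Fubini_bounded_kernel[OF g h _, of "\<lambda>z. cis (- (fst z * snd z))" 1] by simp
  also have "\<dots> = (LINT x|lborel. g x * fourier_L1 h x)"
  proof (rule Bochner_Integration.integral_cong)
    fix x
    have "(LINT \<xi>|lborel. cis (- (x * \<xi>)) * g x * h \<xi>) = (LINT \<xi>|lborel. g x * (cis (- (\<xi> * x)) * h \<xi>))"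
      by (simp add: mult_ac)
    then show "(LINT \<xi>|lborel. cis (- (x * \<xi>)) * g x * h \<xi>) = g x * fourier_L1 h x"
      by (simp add: fourier_L1_def)
  qed simp
  finally show ?thesis .
qed

section \<open>Gaussian regularisation and Plancherel's identity\<close>

definition gauss :: "real \<Rightarrow> real \<Rightarrow> real" where
  "gauss e \<xi> = exp (- (e * \<xi>)\<^sup>2 / 2)"

lemma gauss_std_normal: "gauss e \<xi> = sqrt (2 * pi) * std_normal_density (e * \<xi>)"
  by (simp add: gauss_def std_normal_density_def)

lemma gauss_measurable [measurable]: "gauss e \<in> borel_measurable borel"
  unfolding gauss_def[abs_def] by measurable

lemma integrable_gauss: "e > 0 \<Longrightarrow> integrable lborel (gauss e)"
  using lborel_integrable_real_affine[OF integrable_normal_density[of 1 0], of e 0]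
  unfolding gauss_std_normal[abs_def] by simp

lemma integrable_gauss_complex: "e > 0 \<Longrightarrow> integrable lborel (\<lambda>x. complex_of_real (gauss e x))"
  by (intro integrable_of_real integrable_gauss)

text \<open>This is the characteristic function of the standard normal law.\<close>

lemma std_normal_integral_cis:
  "(LINT x|lborel. complex_of_real (std_normal_density x) * cis (t * x)) = complex_of_real (exp (- t\<^sup>2 / 2))"
proof -
  have "complex_of_real (exp (- t\<^sup>2 / 2)) = char std_normal_distribution t"
    by (simp add: char_std_normal_distribution)
  also have "\<dots> = (LINT x|lborel. std_normal_density x *\<^sub>R iexp (t * x))"
    unfolding char_def by (subst integral_density) auto
  also have "\<dots> = (LINT x|lborel. complex_of_real (std_normal_density x) * cis (t * x))"
    by (simp add: cis_conv_exp scaleR_conv_of_real)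
  finally show ?thesis by simp
qed

lemma fourier_L1_gauss:
  assumes e: "e > 0"
  shows "fourier_L1 (\<lambda>\<xi>. complex_of_real (gauss e \<xi>)) x = complex_of_real (sqrt (2 * pi) / e * exp (- (x / e)\<^sup>2 / 2))"
proof -
  have "fourier_L1 (\<lambda>\<xi>. complex_of_real (gauss e \<xi>)) x =
      (1/e) *\<^sub>R (LINT \<xi>|lborel. cis (- ((\<xi> / e) * x)) * complex_of_real (gauss e (\<xi> / e)))"
    unfolding fourier_L1_def
    using e by (subst lborel_integral_real_affine[of "1/e" _ 0]) auto
  also have "(LINT \<xi>|lborel. cis (- ((\<xi> / e) * x)) * complex_of_real (gauss e (\<xi> / e))) =
     (LINT \<xi>|lborel. complex_of_real (sqrt (2 * pi)) * (complex_of_real (std_normal_density \<xi>) * cis ((- x / e) * \<xi>)))"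
    using e by (intro Bochner_Integration.integral_cong) (auto simp: gauss_std_normal field_simps)
  also have "\<dots> = complex_of_real (sqrt (2 * pi)) * complex_of_real (exp (- (- x / e)\<^sup>2 / 2))"
    using std_normal_integral_cis[of "- x / e"] by simp
  finally show ?thesis using e by (simp add: scaleR_conv_of_real field_simps)
qed

text \<open>Writing the conjugate of a transform as a transform again allows duality to be applied a
  second time.\<close>

lemma fourier_L1_reflect_cnj: "fourier_L1 (\<lambda>y. cnj (g (- y))) \<xi> = cnj (fourier_L1 g \<xi>)"
proof -
  have "cnj (fourier_L1 g \<xi>) = (LINT y|lborel. cis (y * \<xi>) * cnj (g y))"
    unfolding fourier_L1_def by (simp flip: Bochner_Integration.integral_cnj add: cis_cnj)
  also have "\<dots> = (LINT y|lborel. cis (- (y * \<xi>)) * cnj (g (- y)))"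
    by (subst lborel_integral_real_affine[of "-1" _ 0]) auto
  finally show ?thesis by (simp add: fourier_L1_def)
qed

text \<open>The Gaussian factor makes the squared transform integrable before this is known without
  it. Applying duality twice moves the factor to the space side, where it averages the
  autocorrelation of \<open>g\<close> over shifts of size \<open>e\<close>. The constant is one
  \<open>sqrt (2 * pi)\<close> from the transform of the Gaussian times another from normalising the
  normal density.\<close>

lemma Plancherel_gauss:
  assumes g: "integrable lborel g" and M: "\<And>x. cmod (g x) \<le> M" and e: "e > 0"
  shows "(LINT \<xi>|lborel. complex_of_real ((cmod (fourier_L1 g \<xi>))\<^sup>2 * gauss e \<xi>)) =
    2 * pi * (LINT s|lborel. complex_of_real (std_normal_density s) * (LINT x|lborel. g x * cnj (g (x - e * s))))"
proof -
  have [measurable]: "g \<in> borel_measurable borel" using g by auto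
  let ?\<gamma> = "\<lambda>\<xi>. complex_of_real (gauss e \<xi>)"
  let ?\<Phi> = "fourier_L1 ?\<gamma>"
  have i\<gamma>: "integrable lborel ?\<gamma>" by (rule integrable_gauss_complex[OF e])
  have i\<Phi>: "integrable lborel ?\<Phi>"
    unfolding fourier_L1_gauss[OF e]
    using integrable_mult_right[OF integrable_gauss[of "1/e"], of "sqrt (2 * pi) / e"] e
    by (intro integrable_of_real) (simp add: gauss_def)
  have ih: "integrable lborel (\<lambda>\<xi>. cnj (fourier_L1 g \<xi>) * ?\<gamma> \<xi>)"
  proof (rule Bochner_Integration.integrable_bound)
    show "integrable lborel (\<lambda>\<xi>. (LINT x|lborel. cmod (g x)) * gauss e \<xi>)"
      by (intro integrable_mult_right integrable_gauss e)
    have "norm (cnj (fourier_L1 g \<xi>) * ?\<gamma> \<xi>) \<le> norm ((LINT x|lborel. cmod (g x)) * gauss e \<xi>)" for \<xi>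
      using fourier_L1_bound[of g \<xi>] by (simp add: norm_mult abs_mult mult_right_mono)
    then show "AE \<xi> in lborel. norm (cnj (fourier_L1 g \<xi>) * ?\<gamma> \<xi>) \<le> norm ((LINT x|lborel. cmod (g x)) * gauss e \<xi>)"
      by simp
  qed simp
  have ig': "integrable lborel (\<lambda>y. cnj (g (- y)))"
    using lborel_integrable_real_affine[OF g, of "-1" 0] by simp
  have Fh: "fourier_L1 (\<lambda>\<xi>. cnj (fourier_L1 g \<xi>) * ?\<gamma> \<xi>) x = (LINT t|lborel. cnj (g (x - t)) * ?\<Phi> t)" for x
  proof -
    have "fourier_L1 (\<lambda>\<xi>. cnj (fourier_L1 g \<xi>) * ?\<gamma> \<xi>) x =
       (LINT \<xi>|lborel. fourier_L1 (\<lambda>y. cnj (g (- y))) \<xi> * (cis (- (\<xi> * x)) * ?\<gamma> \<xi>))"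
      unfolding fourier_L1_def[of _ x] fourier_L1_reflect_cnj by (simp add: mult_ac)
    also have "\<dots> = (LINT y|lborel. cnj (g (- y)) * fourier_L1 (\<lambda>\<xi>. cis (- (\<xi> * x)) * ?\<gamma> \<xi>) y)"
      by (rule fourier_L1_multiplication_formula[OF ig']) (intro integrable_cis_mult i\<gamma>, measurable)
    also have "\<dots> = (LINT y|lborel. cnj (g (- y)) * ?\<Phi> (x + y))"
    proof -
      have "cis (- (\<xi> * y)) * (cis (- (\<xi> * x)) * ?\<gamma> \<xi>) = cis (- (\<xi> * (x + y))) * ?\<gamma> \<xi>" for \<xi> y
        unfolding mult.assoc[symmetric] cis_mult by (simp add: distrib_left add.commute)
      then show ?thesis unfolding fourier_L1_def by (simp only:)
    qed
    also have "\<dots> = (LINT t|lborel. cnj (g (x - t)) * ?\<Phi> t)"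
      by (subst lborel_integral_real_affine[of 1 _ "-x"]) auto
    finally show ?thesis .
  qed
  have "(LINT \<xi>|lborel. complex_of_real ((cmod (fourier_L1 g \<xi>))\<^sup>2 * gauss e \<xi>)) =
     (LINT \<xi>|lborel. fourier_L1 g \<xi> * (cnj (fourier_L1 g \<xi>) * ?\<gamma> \<xi>))"
    by (simp only: of_real_mult complex_norm_square mult.assoc)
  also have "\<dots> = (LINT x|lborel. g x * fourier_L1 (\<lambda>\<xi>. cnj (fourier_L1 g \<xi>) * ?\<gamma> \<xi>) x)"
    by (rule fourier_L1_multiplication_formula[OF g ih])
  also have "\<dots> = (LINT x|lborel. (LINT t|lborel. cnj (g (x - t)) * g x * ?\<Phi> t))"
  proof -
    have "(LINT t|lborel. cnj (g (x - t)) * g x * ?\<Phi> t) = g x * (LINT t|lborel. cnj (g (x - t)) * ?\<Phi> t)" for x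
      by (subst integral_mult_right_zero[symmetric]) (simp add: mult_ac)
    then show ?thesis unfolding Fh by simp
  qed
  also have "\<dots> = (LINT t|lborel. (LINT x|lborel. cnj (g (x - t)) * g x * ?\<Phi> t))"
    using Fubini_bounded_kernel[OF g i\<Phi>, of "\<lambda>z. cnj (g (fst z - snd z))" M] M by simp
  also have "\<dots> = (LINT t|lborel. ?\<Phi> t * (LINT x|lborel. g x * cnj (g (x - t))))"
  proof -
    have "(LINT x|lborel. cnj (g (x - t)) * g x * ?\<Phi> t) = ?\<Phi> t * (LINT x|lborel. g x * cnj (g (x - t)))" for t
      by (subst integral_mult_right_zero[symmetric]) (simp add: mult_ac)
    then show ?thesis by (simp only:)
  qed
  \<comment> \<open>The substitution \<open>t = e * s\<close> fixes the density, so that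
    \<open>e\<close> survives only inside the autocorrelation, where the limit is taken.\<close>
  also have "\<dots> = e *\<^sub>R (LINT s|lborel. ?\<Phi> (e * s) * (LINT x|lborel. g x * cnj (g (x - e * s))))"
    using e by (subst lborel_integral_real_affine[of e _ 0]) auto
  also have "\<dots> = (LINT s|lborel. 2 * pi * (complex_of_real (std_normal_density s) * (LINT x|lborel. g x * cnj (g (x - e * s)))))"
  proof -
    have "complex_of_real e * ?\<Phi> (e * s) = 2 * pi * complex_of_real (std_normal_density s)" for s
    proof -
      have "e * (sqrt (2 * pi) / e * exp (- (e * s / e)\<^sup>2 / 2)) = 2 * pi * std_normal_density s"
        using e real_sqrt_mult_self[of "2 * pi"] by (simp add: std_normal_density_def field_simps)
      then show ?thesis unfolding fourier_L1_gauss[OF e] of_real_mult[symmetric] by simp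
    qed
    then have "2 * pi * (complex_of_real (std_normal_density s) * A) = complex_of_real e * (?\<Phi> (e * s) * A)" for s A
      by (simp only: mult.assoc[symmetric])
    then have "(LINT s|lborel. 2 * pi * (complex_of_real (std_normal_density s) * (LINT x|lborel. g x * cnj (g (x - e * s)))))
      = (LINT s|lborel. complex_of_real e * (?\<Phi> (e * s) * (LINT x|lborel. g x * cnj (g (x - e * s)))))"
      by (simp only:)
    also have "\<dots> = e *\<^sub>R (LINT s|lborel. ?\<Phi> (e * s) * (LINT x|lborel. g x * cnj (g (x - e * s))))"
      unfolding scaleR_conv_of_real by (rule integral_mult_right_zero)
    finally show ?thesis by (rule sym)
  qed
  also have "\<dots> = 2 * pi * (LINT s|lborel. complex_of_real (std_normal_density s) * (LINT x|lborel. g x * cnj (g (x - e * s))))"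
    by (rule integral_mult_right_zero)
  finally show ?thesis .
qed

text \<open>As \<open>g\<close> is bounded by \<open>M\<close>, the error is at most
  \<open>M\<close> times the mean of a translation difference, so continuity of translations in the
  mean applies.\<close>

lemma autocorrelation_tendsto:
  assumes g: "integrable lborel g" and M: "\<And>x. cmod (g x) \<le> M" and t: "t \<longlonglongrightarrow> 0"
  shows "(\<lambda>n. LINT x|lborel. g x * cnj (g (x - t n))) \<longlonglongrightarrow> complex_of_real (nsq g)"
proof -
  have [measurable]: "g \<in> borel_measurable borel" using g by auto
  have int: "integrable lborel (\<lambda>x. g x * cnj (g (x - s)))" for s
  proof (rule Bochner_Integration.integrable_bound)
    show "integrable lborel (\<lambda>x. M * cmod (g x))" using g by simp
    have "norm (g x * cnj (g (x - s))) \<le> norm (M * cmod (g x))" for x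
      using mult_right_mono[OF M[of "x - s"] norm_ge_zero[of "g x"]] abs_ge_self[of "M * cmod (g x)"]
      by (simp add: norm_mult mult.commute)
    then show "AE x in lborel. norm (g x * cnj (g (x - s))) \<le> norm (M * cmod (g x))" by simp
  qed simp
  have M0: "0 \<le> M" using order_trans[OF norm_ge_zero M] .
  have "(\<lambda>n. (LINT x|lborel. g x * cnj (g (x - t n))) - (LINT x|lborel. g x * cnj (g x))) \<longlonglongrightarrow> 0"
  proof (rule Lim_null_comparison)
    show "(\<lambda>n. M * (LINT x|lborel. norm (g (x - t n) - g x))) \<longlonglongrightarrow> 0"
      using tendsto_mult_right_zero[OF L1_translation_continuous[OF g t], of M] by simp
    have "norm ((LINT x|lborel. g x * cnj (g (x - t n))) - (LINT x|lborel. g x * cnj (g x)))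
      \<le> M * (LINT x|lborel. norm (g (x - t n) - g x))" for n
    proof -
      have "(LINT x|lborel. g x * cnj (g (x - t n))) - (LINT x|lborel. g x * cnj (g x))
        = (LINT x|lborel. g x * cnj (g (x - t n)) - g x * cnj (g x))"
        using int[of "t n"] int[of 0] by simp
      also have "norm \<dots> \<le> (LINT x|lborel. norm (g x * cnj (g (x - t n)) - g x * cnj (g x)))"
        by (rule integral_norm_bound)
      also have "\<dots> \<le> (LINT x|lborel. M * norm (g (x - t n) - g x))"
      proof (rule integral_mono)
        show "integrable lborel (\<lambda>x. norm (g x * cnj (g (x - t n)) - g x * cnj (g x)))"
          using int[of "t n"] int[of 0] by (intro integrable_norm Bochner_Integration.integrable_diff) auto
        show "integrable lborel (\<lambda>x. M * norm (g (x - t n) - g x))"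
          by (intro integrable_mult_right integrable_norm Bochner_Integration.integrable_diff integrable_shift g)
        fix x
        have "norm (g x * cnj (g (x - t n)) - g x * cnj (g x)) = norm (g x) * norm (g (x - t n) - g x)"
          by (simp add: norm_mult flip: right_diff_distrib complex_cnj_diff)
        also have "\<dots> \<le> M * norm (g (x - t n) - g x)" by (intro mult_right_mono M) simp
        finally show "norm (g x * cnj (g (x - t n)) - g x * cnj (g x)) \<le> M * norm (g (x - t n) - g x)" .
      qed
      also have "\<dots> = M * (LINT x|lborel. norm (g (x - t n) - g x))" by (rule integral_mult_right_zero)
      finally show ?thesis .
    qed
    then show "\<forall>\<^sub>F n in sequentially. norm ((LINT x|lborel. g x * cnj (g (x - t n))) - (LINT x|lborel. g x * cnj (g x)))
      \<le> M * (LINT x|lborel. norm (g (x - t n) - g x))" by simp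
  qed
  moreover have "(LINT x|lborel. g x * cnj (g x)) = complex_of_real (nsq g)"
    unfolding nsq_def complex_norm_square[symmetric] by (rule integral_complex_of_real)
  ultimately show ?thesis by (simp add: LIM_zero_iff)
qed

text \<open>As \<open>e\<close> decreases to 0 the Gaussians increase to 1. The space side converges
  by domination, and monotone convergence on the frequency side then delivers integrability of the
  squared transform together with its value.\<close>

lemma Plancherel_bounded:
  assumes g: "integrable lborel g" and M: "\<And>x. cmod (g x) \<le> M"
  shows "L2 (fourier_L1 g)" "nsq (fourier_L1 g) = 2 * pi * nsq g"
proof -
  have [measurable]: "g \<in> borel_measurable borel" using g by auto
  have M0: "0 \<le> M" using order_trans[OF norm_ge_zero M] .
  define e where "e n = inverse (real (Suc n))" for n
  have e: "e n > 0" for n by (simp add: e_def)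
  have e0: "e \<longlonglongrightarrow> 0" unfolding e_def[abs_def] by (rule LIMSEQ_inverse_real_of_nat)
  define A where "A t = (LINT x|lborel. g x * cnj (g (x - t)))" for t
  define L where "L n = (LINT \<xi>|lborel. (cmod (fourier_L1 g \<xi>))\<^sup>2 * gauss (e n) \<xi>)" for n
  have Ameas[measurable]: "A \<in> borel_measurable borel" unfolding A_def[abs_def] by measurable
  have A: "cmod (A t) \<le> M * (LINT x|lborel. cmod (g x))" for t
  proof -
    have "cmod (A t) \<le> (LINT x|lborel. cmod (g x * cnj (g (x - t))))"
      unfolding A_def by (rule integral_norm_bound)
    also have "\<dots> \<le> (LINT x|lborel. M * cmod (g x))"
    proof (rule integral_mono')
      show "cmod (g x * cnj (g (x - t))) \<le> M * cmod (g x)" for x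
        using mult_right_mono[OF M[of "x - t"] norm_ge_zero[of "g x"]] by (simp add: norm_mult mult.commute)
    qed (use g M0 in auto)
    finally show ?thesis by simp
  qed
  have "(\<lambda>n. LINT s|lborel. complex_of_real (std_normal_density s) * A (e n * s)) \<longlonglongrightarrow>
     (LINT s|lborel. complex_of_real (std_normal_density s) * complex_of_real (nsq g))"
  proof (rule Bochner_Integration.integral_dominated_convergence[where
        w="\<lambda>s. std_normal_density s * (M * (LINT x|lborel. cmod (g x)))"])
    show "integrable lborel (\<lambda>s. std_normal_density s * (M * (LINT x|lborel. cmod (g x))))"
      by (intro integrable_mult_left integrable_normal_density) simp
    have "(\<lambda>n. A (e n * s)) \<longlonglongrightarrow> complex_of_real (nsq g)" for s
      unfolding A_def using tendsto_mult_left_zero[OF e0, of s]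
      by (intro autocorrelation_tendsto[OF g M]) auto
    then show "AE s in lborel. (\<lambda>n. complex_of_real (std_normal_density s) * A (e n * s)) \<longlonglongrightarrow>
        complex_of_real (std_normal_density s) * complex_of_real (nsq g)"
      by (intro always_eventually allI tendsto_mult tendsto_const)
    show "AE s in lborel. norm (complex_of_real (std_normal_density s) * A (e n * s))
       \<le> std_normal_density s * (M * (LINT x|lborel. cmod (g x)))" for n
      using A by (auto simp: norm_mult intro!: mult_left_mono)
  qed measurable
  then have "(\<lambda>n. 2 * pi * (LINT s|lborel. complex_of_real (std_normal_density s) * A (e n * s))) \<longlonglongrightarrow>
     2 * pi * (LINT s|lborel. complex_of_real (std_normal_density s) * complex_of_real (nsq g))"
    by (rule tendsto_mult_left)
  also have "(LINT s|lborel. complex_of_real (std_normal_density s) * complex_of_real (nsq g)) = complex_of_real (nsq g)"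
    using integral_complex_of_real[of lborel std_normal_density] integral_normal_density[of 1 0] by simp
  also have "(\<lambda>n. 2 * pi * (LINT s|lborel. complex_of_real (std_normal_density s) * A (e n * s))) = (\<lambda>n. complex_of_real (L n))"
    unfolding L_def A_def using Plancherel_gauss[OF g M e]
    by (simp only: integral_complex_of_real)
  finally have "(\<lambda>n. complex_of_real (L n)) \<longlonglongrightarrow> complex_of_real (2 * pi * nsq g)" by simp
  then have L: "L \<longlonglongrightarrow> 2 * pi * nsq g" by (simp only: tendsto_of_real_iff)
  have int: "integrable lborel (\<lambda>\<xi>. (cmod (fourier_L1 g \<xi>))\<^sup>2 * gauss (e n) \<xi>)" for n
  proof (rule Bochner_Integration.integrable_bound)
    show "integrable lborel (\<lambda>\<xi>. (LINT x|lborel. cmod (g x))\<^sup>2 * gauss (e n) \<xi>)"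
      by (intro integrable_mult_right integrable_gauss e)
    have "norm ((cmod (fourier_L1 g \<xi>))\<^sup>2 * gauss (e n) \<xi>) \<le> norm ((LINT x|lborel. cmod (g x))\<^sup>2 * gauss (e n) \<xi>)" for \<xi>
      using power_mono[OF fourier_L1_bound[of g \<xi>] norm_ge_zero, of 2] by (simp add: abs_mult mult_right_mono)
    then show "AE \<xi> in lborel. norm ((cmod (fourier_L1 g \<xi>))\<^sup>2 * gauss (e n) \<xi>) \<le> norm ((LINT x|lborel. cmod (g x))\<^sup>2 * gauss (e n) \<xi>)"
      by simp
  qed measurable
  have mono: "AE \<xi> in lborel. mono (\<lambda>n. (cmod (fourier_L1 g \<xi>))\<^sup>2 * gauss (e n) \<xi>)"
  proof (intro always_eventually allI monoI mult_left_mono)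
    fix \<xi> :: real and m n :: nat assume "m \<le> n"
    then have "e n \<le> e m" by (simp add: e_def le_imp_inverse_le)
    then have "(e n * \<xi>)\<^sup>2 \<le> (e m * \<xi>)\<^sup>2"
      using e[of n] by (simp add: power_mult_distrib mult_right_mono power_mono)
    then show "gauss (e m) \<xi> \<le> gauss (e n) \<xi>" by (simp add: gauss_def)
  qed simp
  have lim: "AE \<xi> in lborel. (\<lambda>n. (cmod (fourier_L1 g \<xi>))\<^sup>2 * gauss (e n) \<xi>) \<longlonglongrightarrow> (cmod (fourier_L1 g \<xi>))\<^sup>2"
  proof (intro always_eventually allI)
    fix \<xi>
    have "(\<lambda>n. (cmod (fourier_L1 g \<xi>))\<^sup>2 * exp (- (e n * \<xi>)\<^sup>2 / 2)) \<longlonglongrightarrow> (cmod (fourier_L1 g \<xi>))\<^sup>2 * exp (- (0 * \<xi>)\<^sup>2 / 2)"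
      by (intro tendsto_intros e0) simp
    then show "(\<lambda>n. (cmod (fourier_L1 g \<xi>))\<^sup>2 * gauss (e n) \<xi>) \<longlonglongrightarrow> (cmod (fourier_L1 g \<xi>))\<^sup>2"
      by (simp add: gauss_def)
  qed
  note mc = int mono lim L[unfolded L_def[abs_def]]
  have "integrable lborel (\<lambda>\<xi>. (cmod (fourier_L1 g \<xi>))\<^sup>2)"
    by (rule integrable_monotone_convergence[OF mc]) measurable
  then show "L2 (fourier_L1 g)" by (simp add: L2_def)
  show "nsq (fourier_L1 g) = 2 * pi * nsq g"
    unfolding nsq_def[of "fourier_L1 g"]
    by (rule integral_monotone_convergence[OF mc]) measurable
qed

text \<open>Boundedness is removed by truncating the values of \<open>g\<close>. Fatou's lemma first
  gives only an inequality; applied to differences, this inequality yields mean-square convergence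
  of the transforms and hence equality.\<close>

theorem Plancherel_L1_L2:
  assumes g1: "integrable lborel g" and g2: "L2 g"
  shows "L2 (fourier_L1 g)" "nsq (fourier_L1 g) = 2 * pi * nsq g"
proof -
  \<comment> \<open>Integrability of \<open>f\<close> makes the transforms of the truncations
    converge pointwise; square-integrability makes the truncations converge in the mean.\<close>
  have trunc: "\<exists>h. (\<forall>n. integrable lborel (h n) \<and> L2 (h n) \<and> L2 (fourier_L1 (h n)) \<and> nsq (fourier_L1 (h n)) = 2 * pi * nsq (h n))
      \<and> (\<lambda>n. nsq (\<lambda>x. h n x - f x)) \<longlonglongrightarrow> 0 \<and> (\<forall>\<xi>. (\<lambda>n. fourier_L1 (h n) \<xi>) \<longlonglongrightarrow> fourier_L1 f \<xi>)"
    if f1: "integrable lborel f" and f2: "L2 f" for f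
  proof -
    have [measurable]: "f \<in> borel_measurable borel" using f1 by auto
    define h where "h n x = (if cmod (f x) \<le> real n then f x else 0)" for n :: nat and x
    have hm[measurable]: "h n \<in> borel_measurable borel" for n unfolding h_def[abs_def] by measurable
    have hf: "cmod (h n x) \<le> cmod (f x)" for n x by (simp add: h_def)
    have h1: "integrable lborel (h n)" for n
      by (rule Bochner_Integration.integrable_bound[OF f1]) (simp_all add: hf)
    have h2: "L2 (h n)" for n by (rule L2_dominated[OF f2, of _ 1]) (simp_all add: hf)
    have hb: "cmod (h n x) \<le> real n" for n x by (simp add: h_def)
    have lim: "(\<lambda>n. h n x) \<longlonglongrightarrow> f x" for x
    proof (rule tendsto_eventually)
      obtain N :: nat where "cmod (f x) \<le> real N" using real_arch_simple by blast
      then have "cmod (f x) \<le> real n" if "n \<ge> N" for n using that by linarith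
      then show "\<forall>\<^sub>F n in sequentially. h n x = f x"
        unfolding eventually_sequentially h_def by auto
    qed
    have "(\<lambda>n. nsq (\<lambda>x. h n x - f x)) \<longlonglongrightarrow> 0"
    proof (rule nsq_dominated_convergence[OF f2])
      show "(\<lambda>n. h n x - f x) \<longlonglongrightarrow> 0" for x using lim[of x] by (simp add: LIM_zero)
      show "cmod (h n x - f x) \<le> cmod (f x)" for n x by (simp add: h_def)
    qed measurable
    moreover have "(\<lambda>n. fourier_L1 (h n) \<xi>) \<longlonglongrightarrow> fourier_L1 f \<xi>" for \<xi>
      unfolding fourier_L1_def
    proof (rule Bochner_Integration.integral_dominated_convergence[where w="\<lambda>x. cmod (f x)"])
      show "AE x in lborel. (\<lambda>n. cis (- (x * \<xi>)) * h n x) \<longlonglongrightarrow> cis (- (x * \<xi>)) * f x"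
        by (intro always_eventually allI tendsto_intros lim)
      show "AE x in lborel. norm (cis (- (x * \<xi>)) * h n x) \<le> cmod (f x)" for n
        by (simp add: norm_mult hf)
    qed (use f1 in auto)
    ultimately show ?thesis using h1 h2 Plancherel_bounded[OF h1 hb] by blast
  qed
  have bound: "L2 (fourier_L1 f) \<and> nsq (fourier_L1 f) \<le> 2 * pi * nsq f"
    if f1: "integrable lborel f" and f2: "L2 f" for f
  proof -
    have [measurable]: "f \<in> borel_measurable borel" using f1 by auto
    obtain h where h: "\<And>n. integrable lborel (h n)" "\<And>n. L2 (h n)" "\<And>n. L2 (fourier_L1 (h n))"
      "\<And>n. nsq (fourier_L1 (h n)) = 2 * pi * nsq (h n)"
      and hf: "(\<lambda>n. nsq (\<lambda>x. h n x - f x)) \<longlonglongrightarrow> 0" and lim: "\<And>\<xi>. (\<lambda>n. fourier_L1 (h n) \<xi>) \<longlonglongrightarrow> fourier_L1 f \<xi>"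
      using trunc[OF f1 f2] by blast
    have [measurable]: "fourier_L1 (h n) \<in> borel_measurable borel" for n using h(3) by (simp add: L2_def)
    have "(\<lambda>n. nsq (h n)) \<longlonglongrightarrow> nsq f" by (rule nsq_tendsto[OF h(2) f2 hf])
    then have lim2: "(\<lambda>n. 2 * pi * nsq (h n)) \<longlonglongrightarrow> 2 * pi * nsq f" by (intro tendsto_intros)
    have le: "(\<integral>\<^sup>+x. ennreal ((norm (fourier_L1 f x))\<^sup>2) \<partial>lborel) \<le> ennreal (2 * pi * nsq f + e)" if "e > 0" for e
    proof -
      have "\<forall>\<^sub>F n in sequentially. 2 * pi * nsq (h n) < 2 * pi * nsq f + e"
        by (rule order_tendstoD(2)[OF lim2]) (use that in simp)
      then have "\<forall>\<^sub>F n in sequentially. (\<integral>\<^sup>+x. ennreal ((norm (0 - fourier_L1 (h n) x))\<^sup>2) \<partial>lborel) \<le> ennreal (2 * pi * nsq f + e)"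
        by eventually_elim (simp add: nsq_nn_integral[OF h(3)] h(4) ennreal_leI)
      then show ?thesis
        using lim_power_mean_bound[of "\<lambda>n. fourier_L1 (h n)" lborel "\<lambda>x. 0" "fourier_L1 f" 2] lim by simp
    qed
    have fL: "L2 (fourier_L1 f)" by (rule L2_bound(1)[OF _ le[of 1]]) (simp_all add: add_nonneg_nonneg)
    moreover have "nsq (fourier_L1 f) \<le> 2 * pi * nsq f"
    proof (rule field_le_epsilon)
      fix e :: real assume "e > 0"
      then show "nsq (fourier_L1 f) \<le> 2 * pi * nsq f + e"
        by (intro L2_bound(2)[OF _ le]) (simp_all add: add_nonneg_nonneg)
    qed
    ultimately show ?thesis by blast
  qed
  show "L2 (fourier_L1 g)" using bound[OF g1 g2] by blast
  obtain h where h: "\<And>n. integrable lborel (h n)" "\<And>n. L2 (h n)" "\<And>n. L2 (fourier_L1 (h n))"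
      "\<And>n. nsq (fourier_L1 (h n)) = 2 * pi * nsq (h n)"
      and hg: "(\<lambda>n. nsq (\<lambda>x. h n x - g x)) \<longlonglongrightarrow> 0"
    using trunc[OF g1 g2] by blast
  \<comment> \<open>Here the inequality is used for \<open>h n - g\<close>, whose transform is the
    difference of the transforms.\<close>
  have "(\<lambda>n. nsq (\<lambda>\<xi>. fourier_L1 (h n) \<xi> - fourier_L1 g \<xi>)) \<longlonglongrightarrow> 0"
  proof (rule Lim_null_comparison)
    show "(\<lambda>n. 2 * pi * nsq (\<lambda>x. h n x - g x)) \<longlonglongrightarrow> 0" using tendsto_mult_left[OF hg, of "2 * pi"] by simp
    have "fourier_L1 (\<lambda>x. h n x - g x) = (\<lambda>\<xi>. fourier_L1 (h n) \<xi> - fourier_L1 g \<xi>)" for n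
      by (rule ext) (rule fourier_L1_diff[OF h(1) g1])
    then have "nsq (\<lambda>\<xi>. fourier_L1 (h n) \<xi> - fourier_L1 g \<xi>) \<le> 2 * pi * nsq (\<lambda>x. h n x - g x)" for n
      using bound[OF Bochner_Integration.integrable_diff[OF h(1) g1] L2_diff[OF h(2) g2], of n] by simp
    then show "\<forall>\<^sub>F n in sequentially. norm (nsq (\<lambda>\<xi>. fourier_L1 (h n) \<xi> - fourier_L1 g \<xi>)) \<le> 2 * pi * nsq (\<lambda>x. h n x - g x)"
      by simp
  qed
  then have "(\<lambda>n. nsq (fourier_L1 (h n))) \<longlonglongrightarrow> nsq (fourier_L1 g)"
    by (rule nsq_tendsto[OF h(3) conjunct1[OF bound[OF g1 g2]]])
  moreover have "(\<lambda>n. nsq (fourier_L1 (h n))) \<longlonglongrightarrow> 2 * pi * nsq g"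
    unfolding h(4) by (intro tendsto_intros nsq_tendsto[OF h(2) g2 hg])
  ultimately show "nsq (fourier_L1 g) = 2 * pi * nsq g" by (rule LIMSEQ_unique)
qed

subsection \<open>The Fourier transform of square-integrable functions\<close>

lemma nsq_add_le:
  fixes f g :: "real \<Rightarrow> 'a::{real_normed_vector,second_countable_topology}"
  assumes f: "L2 f" and g: "L2 g"
  shows "nsq (\<lambda>x. f x + g x) \<le> 2 * nsq f + 2 * nsq g"
proof -
  have "nsq (\<lambda>x. f x + g x) \<le> (sqrt (nsq f) + sqrt (nsq g))\<^sup>2"
    using nsq_triangle[OF f g] by (metis nsq_nonneg real_sqrt_ge_0_iff real_sqrt_pow2 power_mono)
  also have "\<dots> \<le> 2 * (sqrt (nsq f))\<^sup>2 + 2 * (sqrt (nsq g))\<^sup>2" by (rule sum_sq_bound)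
  finally show ?thesis by simp
qed

lemma nsq_uminus [simp]: "nsq (\<lambda>x. - f x) = nsq f"
  by (simp add: nsq_def)

lemma nsq_diff_le:
  fixes f g :: "real \<Rightarrow> 'a::{real_normed_vector,second_countable_topology}"
  assumes f: "L2 f" and g: "L2 g"
  shows "nsq (\<lambda>x. f x - g x) \<le> 2 * nsq f + 2 * nsq g"
  using nsq_add_le[OF f L2_uminus[OF g]] by simp

text \<open>Through the cross term a statement about pairings becomes one about distances; inversion
  and the splitting of the energy along a weak limit are both obtained this way.\<close>

lemma nsq_diff_expand:
  fixes f g :: "real \<Rightarrow> complex"
  assumes f: "L2 f" and g: "L2 g"
  shows "nsq (\<lambda>x. f x - g x) = nsq f + nsq g - 2 * Re (LINT x|lborel. f x * cnj (g x))"
proof -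
  have i: "integrable lborel (\<lambda>x. f x * cnj (g x))"
    using L2_mult_integrable[OF f, of "\<lambda>x. cnj (g x)"] g by simp
  have "nsq (\<lambda>x. f x - g x) = (LINT x|lborel. (cmod (f x))\<^sup>2 + (cmod (g x))\<^sup>2 - 2 * Re (f x * cnj (g x)))"
    unfolding nsq_def cmod_power2
    by (intro Bochner_Integration.integral_cong) (simp_all add: power2_eq_square algebra_simps)
  also have "\<dots> = nsq f + nsq g - 2 * (LINT x|lborel. Re (f x * cnj (g x)))"
    unfolding nsq_def using L2_integrable_sq[OF f] L2_integrable_sq[OF g] integrable_Re[OF i]
    by (simp del: complex_cnj_cnj times_complex.sel)
  finally show ?thesis unfolding integral_Re[OF i] .
qed

lemma integral_mult_tendsto:
  fixes f g :: "'i \<Rightarrow> real \<Rightarrow> complex"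
  assumes f: "\<And>n. L2 (f n)" "L2 f'" and g: "\<And>n. L2 (g n)" "L2 g'"
    and limf: "((\<lambda>n. nsq (\<lambda>x. f n x - f' x)) \<longlongrightarrow> 0) F" and limg: "((\<lambda>n. nsq (\<lambda>x. g n x - g' x)) \<longlongrightarrow> 0) F"
  shows "((\<lambda>n. LINT x|lborel. f n x * g n x) \<longlongrightarrow> (LINT x|lborel. f' x * g' x)) F"
proof -
  have "((\<lambda>n. (LINT x|lborel. f n x * g n x) - (LINT x|lborel. f' x * g' x)) \<longlongrightarrow> 0) F"
  proof (rule Lim_null_comparison)
    have "((\<lambda>n. sqrt (nsq (\<lambda>x. f n x - f' x)) * sqrt (nsq (g n)) + sqrt (nsq f') * sqrt (nsq (\<lambda>x. g n x - g' x)))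
       \<longlongrightarrow> sqrt 0 * sqrt (nsq g') + sqrt (nsq f') * sqrt 0) F"
      by (intro tendsto_intros limf limg nsq_tendsto[OF g limg])
    then show "((\<lambda>n. sqrt (nsq (\<lambda>x. f n x - f' x)) * sqrt (nsq (g n)) + sqrt (nsq f') * sqrt (nsq (\<lambda>x. g n x - g' x))) \<longlongrightarrow> 0) F"
      by simp
    have "norm ((LINT x|lborel. f n x * g n x) - (LINT x|lborel. f' x * g' x))
      \<le> sqrt (nsq (\<lambda>x. f n x - f' x)) * sqrt (nsq (g n)) + sqrt (nsq f') * sqrt (nsq (\<lambda>x. g n x - g' x))" for n
    proof -
      note i = L2_mult_integrable[OF f(1)[of n] g(1)[of n]] L2_mult_integrable[OF f(2) g(2)] L2_mult_integrable[OF f(2) g(1)[of n]]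
      have "(LINT x|lborel. f n x * g n x) - (LINT x|lborel. f' x * g' x) =
        (LINT x|lborel. (f n x - f' x) * g n x) + (LINT x|lborel. f' x * (g n x - g' x))"
        using i by (simp add: left_diff_distrib right_diff_distrib)
      also have "norm \<dots> \<le> norm (LINT x|lborel. (f n x - f' x) * g n x) + norm (LINT x|lborel. f' x * (g n x - g' x))"
        by (rule norm_triangle_ineq)
      finally show ?thesis
        using Cauchy_Schwarz_integral[OF L2_diff[OF f(1)[of n] f(2)] g(1)[of n]]
          Cauchy_Schwarz_integral[OF f(2) L2_diff[OF g(1)[of n] g(2)]] by linarith
    qed
    then show "\<forall>\<^sub>F n in F. norm ((LINT x|lborel. f n x * g n x) - (LINT x|lborel. f' x * g' x))
      \<le> sqrt (nsq (\<lambda>x. f n x - f' x)) * sqrt (nsq (g n)) + sqrt (nsq f') * sqrt (nsq (\<lambda>x. g n x - g' x))" by simp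
  qed
  then show ?thesis by (simp add: LIM_zero_iff)
qed

text \<open>On a set of finite measure the bound \<open>norm f \<le> 1 + (norm f)\<^sup>2\<close>
  suffices; this makes truncated integrals, in space and in frequency, meaningful.\<close>

lemma L2_indicator_integrable:
  fixes f :: "real \<Rightarrow> complex"
  assumes f: "L2 f" and [measurable]: "A \<in> sets borel" and fin: "emeasure lborel A < \<infinity>"
  shows "integrable lborel (\<lambda>x. indicator A x *\<^sub>R f x)"
proof (rule Bochner_Integration.integrable_bound)
  have [measurable]: "f \<in> borel_measurable borel" using f by (simp add: L2_def)
  show "integrable lborel (\<lambda>x. indicator A x + (norm (f x))\<^sup>2)" using f fin by (simp add: L2_def)
  have "norm (f x) \<le> 1 + (norm (f x))\<^sup>2" for x
  proof -
    have "2 * norm (f x) \<le> 1 + (norm (f x))\<^sup>2" using sum_squares_bound[of 1 "norm (f x)"] by simp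
    with norm_ge_zero[of "f x"] show ?thesis by linarith
  qed
  then show "AE x in lborel. norm (indicator A x *\<^sub>R f x) \<le> norm (indicator A x + (norm (f x))\<^sup>2)"
    by (auto simp: indicator_def)
next
  have [measurable]: "f \<in> borel_measurable borel" using f by (simp add: L2_def)
  show "(\<lambda>x. indicator A x *\<^sub>R f x) \<in> borel_measurable lborel" by simp
qed

section \<open>Truncation in space and the mean-square transform\<close>

definition cutoff :: "real \<Rightarrow> (real \<Rightarrow> complex) \<Rightarrow> real \<Rightarrow> complex" where
  "cutoff R u x = indicator {-R..R} x *\<^sub>R u x"

lemma fourier_trunc_cutoff: "fourier_trunc u R = fourier_L1 (cutoff R u)"
  by (rule ext) (simp add: fourier_trunc_def fourier_L1_def cutoff_def set_lebesgue_integral_def)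

lemma cutoff_integrable: "L2 u \<Longrightarrow> integrable lborel (cutoff R u)"
  unfolding cutoff_def[abs_def] by (rule L2_indicator_integrable) (auto simp: emeasure_lborel_Icc_eq)

lemma cutoff_L2: "L2 u \<Longrightarrow> L2 (cutoff R u)"
  unfolding cutoff_def[abs_def] by (rule L2_indicator) auto

lemma cutoff_tendsto:
  assumes u: "L2 u"
  shows "((\<lambda>R. nsq (\<lambda>x. cutoff R u x - u x)) \<longlongrightarrow> 0) at_top"
proof (rule tendsto_at_topI_sequentially)
  fix X :: "nat \<Rightarrow> real" assume X: "filterlim X at_top sequentially"
  have [measurable]: "u \<in> borel_measurable borel" using u by (simp add: L2_def)
  show "(\<lambda>n. nsq (\<lambda>x. cutoff (X n) u x - u x)) \<longlonglongrightarrow> 0"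
  proof (rule nsq_dominated_convergence[OF u])
    show "(\<lambda>x. cutoff (X n) u x - u x) \<in> borel_measurable borel" for n unfolding cutoff_def[abs_def] by measurable
    show "norm (cutoff (X n) u x - u x) \<le> norm (u x)" for n x by (simp add: cutoff_def indicator_def)
    fix x
    have "\<forall>\<^sub>F n in sequentially. X n \<ge> \<bar>x\<bar>" using X by (simp add: filterlim_at_top)
    then have "\<forall>\<^sub>F n in sequentially. cutoff (X n) u x - u x = 0"
      by eventually_elim (auto simp: cutoff_def indicator_def)
    then show "(\<lambda>n. cutoff (X n) u x - u x) \<longlonglongrightarrow> 0" by (rule tendsto_eventually)
  qed
qed

lemma fourier_L1_cutoff_diff:
  assumes u: "L2 u"
  shows "L2 (\<lambda>\<xi>. fourier_L1 (cutoff R u) \<xi> - fourier_L1 (cutoff S u) \<xi>)"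
    "nsq (\<lambda>\<xi>. fourier_L1 (cutoff R u) \<xi> - fourier_L1 (cutoff S u) \<xi>)
       \<le> 4 * pi * (nsq (\<lambda>x. cutoff R u x - u x) + nsq (\<lambda>x. cutoff S u x - u x))"
proof -
  have eq: "(\<lambda>\<xi>. fourier_L1 (cutoff R u) \<xi> - fourier_L1 (cutoff S u) \<xi>) = fourier_L1 (\<lambda>x. cutoff R u x - cutoff S u x)"
    by (rule ext) (simp add: fourier_L1_diff cutoff_integrable u)
  note i = Bochner_Integration.integrable_diff[OF cutoff_integrable[OF u] cutoff_integrable[OF u], of R S]
    L2_diff[OF cutoff_L2[OF u] cutoff_L2[OF u], of R S]
  show "L2 (\<lambda>\<xi>. fourier_L1 (cutoff R u) \<xi> - fourier_L1 (cutoff S u) \<xi>)"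
    unfolding eq by (rule Plancherel_L1_L2[OF i])
  have "nsq (\<lambda>x. cutoff R u x - cutoff S u x) \<le> 2 * nsq (\<lambda>x. cutoff R u x - u x) + 2 * nsq (\<lambda>x. cutoff S u x - u x)"
    using nsq_diff_le[OF L2_diff[OF cutoff_L2[OF u] u] L2_diff[OF cutoff_L2[OF u] u], of R S] by simp
  then have "2 * pi * nsq (\<lambda>x. cutoff R u x - cutoff S u x)
      \<le> 2 * pi * (2 * nsq (\<lambda>x. cutoff R u x - u x) + 2 * nsq (\<lambda>x. cutoff S u x - u x))"
    by (intro mult_left_mono) auto
  then show "nsq (\<lambda>\<xi>. fourier_L1 (cutoff R u) \<xi> - fourier_L1 (cutoff S u) \<xi>)
       \<le> 4 * pi * (nsq (\<lambda>x. cutoff R u x - u x) + nsq (\<lambda>x. cutoff S u x - u x))"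
    unfolding eq Plancherel_L1_L2(2)[OF i] by (simp add: algebra_simps)
qed

lemma is_fourierI:
  assumes "L2 u" "L2 v" "((\<lambda>R. nsq (\<lambda>\<xi>. v \<xi> - fourier_L1 (cutoff R u) \<xi>)) \<longlongrightarrow> 0) at_top"
  shows "is_fourier u v"
  using assms by (simp add: is_fourier_def nsq_def fourier_trunc_cutoff)

lemma is_fourierD:
  assumes "is_fourier u v"
  shows "L2 u" "L2 v" "((\<lambda>R. nsq (\<lambda>\<xi>. v \<xi> - fourier_L1 (cutoff R u) \<xi>)) \<longlongrightarrow> 0) at_top"
  using assms by (simp_all add: is_fourier_def nsq_def fourier_trunc_cutoff)

text \<open>By Plancherel the transforms of the cutoffs form a Cauchy family. A subsequence along
  integer radii converges almost everywhere and defines the candidate; Fatou's lemma then controls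
  its distance to every cutoff transform.\<close>

theorem fourier_exists:
  assumes u: "L2 u"
  shows "\<exists>v. is_fourier u v"
proof -
  define d where "d R = nsq (\<lambda>x. cutoff R u x - u x)" for R
  have d0: "(d \<longlongrightarrow> 0) at_top" unfolding d_def[abs_def] by (rule cutoff_tendsto[OF u])
  have dn: "(\<lambda>n. d (real n)) \<longlonglongrightarrow> 0" by (rule filterlim_compose[OF d0 filterlim_real_sequentially])
  let ?f = "\<lambda>n. fourier_L1 (cutoff (real n) u)"
  have F2: "L2 (fourier_L1 (cutoff R u))" for R by (rule Plancherel_L1_L2[OF cutoff_integrable[OF u] cutoff_L2[OF u]])
  have [measurable]: "fourier_L1 (cutoff R u) \<in> borel_measurable borel" for R using F2 by (simp add: L2_def)
  have diff: "(\<integral>\<^sup>+\<xi>. ennreal ((norm (fourier_L1 (cutoff R u) \<xi> - fourier_L1 (cutoff S u) \<xi>))^2) \<partial>lborel) \<le> ennreal (4 * pi * (d R + d S))" for R S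
    unfolding nsq_nn_integral[OF fourier_L1_cutoff_diff(1)[OF u]] d_def
    by (intro ennreal_leI fourier_L1_cutoff_diff u)
  obtain k where k: "strict_mono (k::nat\<Rightarrow>nat)" and conv: "AE \<xi> in lborel. convergent (\<lambda>i. ?f (k i) \<xi>)"
  proof (rule Cauchy_power_mean_convergent_subsequence[of 2 ?f lborel])
    fix e :: real assume e: "e > 0"
    have "\<forall>\<^sub>F n in sequentially. d (real n) < e / (8 * pi)" by (rule order_tendstoD(2)[OF dn]) (use e in simp)
    then obtain N where N: "\<And>n. n \<ge> N \<Longrightarrow> d (real n) < e / (8 * pi)" by (auto simp: eventually_sequentially)
    have "4 * pi * (d (real m) + d (real n)) \<le> e" if "m \<ge> N" "n \<ge> N" for m n
      using N[OF that(1)] N[OF that(2)] by (simp add: field_simps)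
    then show "\<exists>N. \<forall>m\<ge>N. \<forall>n\<ge>N. (\<integral>\<^sup>+\<xi>. ennreal ((norm (?f m \<xi> - ?f n \<xi>))^2) \<partial>lborel) \<le> ennreal e"
      by (intro exI[of _ N] allI impI order_trans[OF diff] ennreal_leI)
  qed (auto intro: that)
  \<comment> \<open>Where the sequence diverges, on a null set, \<open>lim\<close> has an
    unspecified value; \<open>v\<close> is measurable all the same.\<close>
  define v where "v \<xi> = lim (\<lambda>i. ?f (k i) \<xi>)" for \<xi>
  have [measurable]: "v \<in> borel_measurable borel"
    unfolding v_def[abs_def] by (rule borel_measurable_lim_metric) measurable
  have lim: "AE \<xi> in lborel. (\<lambda>i. ?f (k i) \<xi>) \<longlonglongrightarrow> v \<xi>"
    using conv by eventually_elim (simp add: v_def convergent_LIMSEQ_iff)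
  have dnn: "d R \<ge> 0" for R by (simp add: d_def)
  \<comment> \<open>The subsequence runs only in the second slot. The first keeps an arbitrary real
    radius \<open>R\<close>, as \<open>is_fourier\<close> asks for a limit over real radii.\<close>
  have bnd: "(\<integral>\<^sup>+\<xi>. ennreal ((norm (fourier_L1 (cutoff R u) \<xi> - v \<xi>))^2) \<partial>lborel) \<le> ennreal (4 * pi * (d R + e))" if e: "e > 0" for R e
  proof (rule lim_power_mean_bound[OF _ _ lim])
    have "\<forall>\<^sub>F n in sequentially. d (real n) < e" by (rule order_tendstoD(2)[OF dn]) (use e in simp)
    then have "\<forall>\<^sub>F i in sequentially. d (real (k i)) < e" using k by (rule eventually_subseq[rotated])
    then show "\<forall>\<^sub>F i in sequentially. (\<integral>\<^sup>+\<xi>. ennreal ((norm (fourier_L1 (cutoff R u) \<xi> - ?f (k i) \<xi>))^2) \<partial>lborel) \<le> ennreal (4 * pi * (d R + e))"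
    proof eventually_elim
      case (elim i)
      show ?case by (rule order_trans[OF diff]) (use elim in \<open>auto intro!: ennreal_leI\<close>)
    qed
  qed measurable
  have L: "L2 (\<lambda>\<xi>. fourier_L1 (cutoff R u) \<xi> - v \<xi>)" for R
    by (rule L2_bound(1)[OF _ bnd[of 1]]) (simp_all add: dnn add_nonneg_nonneg)
  have le: "nsq (\<lambda>\<xi>. fourier_L1 (cutoff R u) \<xi> - v \<xi>) \<le> 4 * pi * d R" for R
  proof (rule field_le_epsilon)
    fix e :: real assume e: "e > 0"
    have "nsq (\<lambda>\<xi>. fourier_L1 (cutoff R u) \<xi> - v \<xi>) \<le> 4 * pi * (d R + e / (4 * pi))"
      by (rule L2_bound(2)[OF _ bnd]) (use e dnn in \<open>simp_all add: add_nonneg_nonneg\<close>)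
    also have "4 * pi * (d R + e / (4 * pi)) = 4 * pi * d R + e" by (simp add: distrib_left)
    finally show "nsq (\<lambda>\<xi>. fourier_L1 (cutoff R u) \<xi> - v \<xi>) \<le> 4 * pi * d R + e" .
  qed
  have v2: "L2 v" using L2_diff[OF F2 L, of 0 0] by simp
  have "((\<lambda>R. nsq (\<lambda>\<xi>. v \<xi> - fourier_L1 (cutoff R u) \<xi>)) \<longlongrightarrow> 0) at_top"
  proof (rule Lim_null_comparison)
    show "((\<lambda>R. 4 * pi * d R) \<longlongrightarrow> 0) at_top" using tendsto_mult_left[OF d0, of "4 * pi"] by simp
    show "\<forall>\<^sub>F R in at_top. norm (nsq (\<lambda>\<xi>. v \<xi> - fourier_L1 (cutoff R u) \<xi>)) \<le> 4 * pi * d R"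
      using le by (subst nsq_minus_commute) simp
  qed
  then show ?thesis using is_fourierI[OF u v2] by blast
qed

theorem is_fourier_Plancherel:
  assumes "is_fourier u v"
  shows "nsq v = 2 * pi * nsq u"
proof -
  note D = is_fourierD[OF assms]
  note F = Plancherel_L1_L2[OF cutoff_integrable[OF D(1)] cutoff_L2[OF D(1)]]
  have "((\<lambda>R. nsq (\<lambda>\<xi>. fourier_L1 (cutoff R u) \<xi> - v \<xi>)) \<longlongrightarrow> 0) at_top"
    using D(3) by (subst nsq_minus_commute)
  then have "((\<lambda>R. nsq (fourier_L1 (cutoff R u))) \<longlongrightarrow> nsq v) at_top"
    by (rule nsq_tendsto[OF F(1) D(2)])
  moreover have "((\<lambda>R. nsq (fourier_L1 (cutoff R u))) \<longlongrightarrow> 2 * pi * nsq u) at_top"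
    unfolding F(2) by (intro tendsto_intros nsq_tendsto[OF cutoff_L2[OF D(1)] D(1) cutoff_tendsto[OF D(1)]])
  ultimately show ?thesis by (rule tendsto_unique[rotated]) simp
qed

lemma is_fourier_lincomb:
  assumes "is_fourier u v" "is_fourier u' v'"
  shows "is_fourier (\<lambda>x. a * u x + b * u' x) (\<lambda>\<xi>. a * v \<xi> + b * v' \<xi>)"
proof -
  note D = is_fourierD[OF assms(1)] and D' = is_fourierD[OF assms(2)]
  note F = Plancherel_L1_L2(1)[OF cutoff_integrable[OF D(1)] cutoff_L2[OF D(1)]]
    and F' = Plancherel_L1_L2(1)[OF cutoff_integrable[OF D'(1)] cutoff_L2[OF D'(1)]]
  have cut: "cutoff R (\<lambda>x. a * u x + b * u' x) = (\<lambda>x. a * cutoff R u x + b * cutoff R u' x)" for R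
    by (auto simp: cutoff_def indicator_def)
  have eq: "fourier_L1 (cutoff R (\<lambda>x. a * u x + b * u' x)) \<xi> = a * fourier_L1 (cutoff R u) \<xi> + b * fourier_L1 (cutoff R u') \<xi>" for R \<xi>
  proof -
    note i = integrable_cis_mult[OF cutoff_integrable[OF D(1)], of "\<lambda>x. - (x * \<xi>)" R]
      integrable_cis_mult[OF cutoff_integrable[OF D'(1)], of "\<lambda>x. - (x * \<xi>)" R]
    have "fourier_L1 (cutoff R (\<lambda>x. a * u x + b * u' x)) \<xi> =
      (LINT x|lborel. a * (cis (- (x * \<xi>)) * cutoff R u x) + b * (cis (- (x * \<xi>)) * cutoff R u' x))"
      unfolding fourier_L1_def cut by (intro Bochner_Integration.integral_cong) (auto simp: algebra_simps)
    also have "\<dots> = a * fourier_L1 (cutoff R u) \<xi> + b * fourier_L1 (cutoff R u') \<xi>"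
      unfolding fourier_L1_def using i by simp
    finally show ?thesis .
  qed
  show ?thesis
  proof (rule is_fourierI)
    show "L2 (\<lambda>x. a * u x + b * u' x)" "L2 (\<lambda>\<xi>. a * v \<xi> + b * v' \<xi>)"
      using D D' by (auto intro!: L2_add L2_cmult)
    let ?d = "\<lambda>R \<xi>. v \<xi> - fourier_L1 (cutoff R u) \<xi>" and ?d' = "\<lambda>R \<xi>. v' \<xi> - fourier_L1 (cutoff R u') \<xi>"
    have d: "L2 (?d R)" "L2 (?d' R)" for R using D D' F F' by (auto intro!: L2_diff)
    show "((\<lambda>R. nsq (\<lambda>\<xi>. a * v \<xi> + b * v' \<xi> - fourier_L1 (cutoff R (\<lambda>x. a * u x + b * u' x)) \<xi>)) \<longlongrightarrow> 0) at_top"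
    proof (rule Lim_null_comparison)
      have "((\<lambda>R. 2 * ((cmod a)\<^sup>2 * nsq (?d R)) + 2 * ((cmod b)\<^sup>2 * nsq (?d' R))) \<longlongrightarrow>
          2 * ((cmod a)\<^sup>2 * 0) + 2 * ((cmod b)\<^sup>2 * 0)) at_top"
        by (intro tendsto_intros D D')
      then show "((\<lambda>R. 2 * ((cmod a)\<^sup>2 * nsq (?d R)) + 2 * ((cmod b)\<^sup>2 * nsq (?d' R))) \<longlongrightarrow> 0) at_top" by simp
      have "(\<lambda>\<xi>. a * v \<xi> + b * v' \<xi> - fourier_L1 (cutoff R (\<lambda>x. a * u x + b * u' x)) \<xi>) = (\<lambda>\<xi>. a * ?d R \<xi> + b * ?d' R \<xi>)" for R
        by (simp add: eq algebra_simps)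
      then have "nsq (\<lambda>\<xi>. a * v \<xi> + b * v' \<xi> - fourier_L1 (cutoff R (\<lambda>x. a * u x + b * u' x)) \<xi>)
         \<le> 2 * ((cmod a)\<^sup>2 * nsq (?d R)) + 2 * ((cmod b)\<^sup>2 * nsq (?d' R))" for R
        using nsq_add_le[OF L2_cmult[OF d(1)] L2_cmult[OF d(2)], of a R b R] by (simp add: nsq_cmult)
      then show "\<forall>\<^sub>F R in at_top. norm (nsq (\<lambda>\<xi>. a * v \<xi> + b * v' \<xi> - fourier_L1 (cutoff R (\<lambda>x. a * u x + b * u' x)) \<xi>))
         \<le> 2 * ((cmod a)\<^sup>2 * nsq (?d R)) + 2 * ((cmod b)\<^sup>2 * nsq (?d' R))" by simp
    qed
  qed
qed

lemma is_fourier_diff: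
  assumes "is_fourier u v" "is_fourier u' v'"
  shows "is_fourier (\<lambda>x. u x - u' x) (\<lambda>\<xi>. v \<xi> - v' \<xi>)"
  using is_fourier_lincomb[OF assms, of 1 "-1"] by simp

lemma is_fourier_cmult:
  assumes "is_fourier u v"
  shows "is_fourier (\<lambda>x. a * u x) (\<lambda>\<xi>. a * v \<xi>)"
  using is_fourier_lincomb[OF assms assms, of a 0] by simp

text \<open>By linearity the difference is a transform of 0, so its norm vanishes by
  Plancherel.\<close>

lemma is_fourier_unique:
  assumes "is_fourier u v" "is_fourier u v'"
  shows "AE \<xi> in lborel. v \<xi> = v' \<xi>"
proof -
  have d: "is_fourier (\<lambda>x. 0) (\<lambda>\<xi>. v \<xi> - v' \<xi>)" using is_fourier_diff[OF assms] by simp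
  have "AE \<xi> in lborel. v \<xi> - v' \<xi> = 0"
    using is_fourier_Plancherel[OF d] is_fourierD(2)[OF d] by (intro nsq_zero_AE) (auto simp: nsq_def)
  then show ?thesis by simp
qed

lemma is_fourier_cong_AE:
  assumes F: "is_fourier u v" and [measurable]: "v' \<in> borel_measurable borel" and ae: "AE \<xi> in lborel. v \<xi> = v' \<xi>"
  shows "is_fourier u v'"
proof (rule is_fourierI)
  note D = is_fourierD[OF F]
  have m[measurable]: "v \<in> borel_measurable borel" "u \<in> borel_measurable borel" using D by (simp_all add: L2_def)
  show "L2 u" by fact
  show "L2 v'" by (rule L2_cong_AE[OF D(2) _ ae]) measurable
  have [measurable]: "cutoff R u \<in> borel_measurable borel" for R unfolding cutoff_def[abs_def] by measurable
  have "nsq (\<lambda>\<xi>. v' \<xi> - fourier_L1 (cutoff R u) \<xi>) = nsq (\<lambda>\<xi>. v \<xi> - fourier_L1 (cutoff R u) \<xi>)" for R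
    by (rule nsq_cong_AE) (use ae in auto)
  then show "((\<lambda>R. nsq (\<lambda>\<xi>. v' \<xi> - fourier_L1 (cutoff R u) \<xi>)) \<longlongrightarrow> 0) at_top" using D(3) by simp
qed

text \<open>Let \<open>w\<close> be a transform of \<open>u'\<close>. By Plancherel
  \<open>v n\<close> converges to \<open>w\<close> in the mean, while it also converges to
  \<open>v'\<close>.\<close>

lemma is_fourier_closed:
  assumes F: "\<And>n. is_fourier (u n) (v n)" and u: "L2 u'" and v: "L2 v'"
    and limu: "(\<lambda>n. nsq (\<lambda>x. u n x - u' x)) \<longlonglongrightarrow> 0" and limv: "(\<lambda>n. nsq (\<lambda>x. v n x - v' x)) \<longlonglongrightarrow> 0"
  shows "is_fourier u' v'"
proof -
  obtain w where w: "is_fourier u' w" using fourier_exists[OF u] by blast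
  note W = is_fourierD(2)[OF w] and V = is_fourierD(2)[OF F]
  have le: "nsq (\<lambda>\<xi>. w \<xi> - v' \<xi>) \<le> 2 * (2 * pi * nsq (\<lambda>x. u n x - u' x)) + 2 * nsq (\<lambda>x. v n x - v' x)" for n
    using nsq_diff_le[OF L2_diff[OF V[of n] v] L2_diff[OF V[of n] W]] is_fourier_Plancherel[OF is_fourier_diff[OF F[of n] w]]
    by simp
  have "(\<lambda>n. 2 * (2 * pi * nsq (\<lambda>x. u n x - u' x)) + 2 * nsq (\<lambda>x. v n x - v' x)) \<longlonglongrightarrow> 2 * (2 * pi * 0) + 2 * 0"
    by (intro tendsto_intros limu limv)
  from LIMSEQ_le_const[OF this, of "nsq (\<lambda>\<xi>. w \<xi> - v' \<xi>)"] le have "nsq (\<lambda>\<xi>. w \<xi> - v' \<xi>) \<le> 0" by auto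
  then have "nsq (\<lambda>\<xi>. w \<xi> - v' \<xi>) = 0" using nsq_nonneg by (rule order_antisym)
  then have "AE \<xi> in lborel. w \<xi> - v' \<xi> = 0" by (rule nsq_zero_AE[OF L2_diff[OF W v]])
  then show ?thesis by (intro is_fourier_cong_AE[OF w]) (use v in \<open>auto simp: L2_def\<close>)
qed

lemma is_fourier_L1:
  assumes u1: "integrable lborel u" and u2: "L2 u"
  shows "is_fourier u (fourier_L1 u)"
proof (rule is_fourierI[OF u2 Plancherel_L1_L2(1)[OF u1 u2]])
  have "(\<lambda>\<xi>. fourier_L1 u \<xi> - fourier_L1 (cutoff R u) \<xi>) = fourier_L1 (\<lambda>x. u x - cutoff R u x)" for R
    by (rule ext) (simp add: fourier_L1_diff u1 cutoff_integrable[OF u2])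
  then have "nsq (\<lambda>\<xi>. fourier_L1 u \<xi> - fourier_L1 (cutoff R u) \<xi>) = 2 * pi * nsq (\<lambda>x. cutoff R u x - u x)" for R
    using Plancherel_L1_L2(2)[OF Bochner_Integration.integrable_diff[OF u1 cutoff_integrable[OF u2]]
       L2_diff[OF u2 cutoff_L2[OF u2]], of R] unfolding nsq_minus_commute[of "cutoff R u" u] by simp
  then show "((\<lambda>R. nsq (\<lambda>\<xi>. fourier_L1 u \<xi> - fourier_L1 (cutoff R u) \<xi>)) \<longlongrightarrow> 0) at_top"
    using tendsto_mult_left[OF cutoff_tendsto[OF u2], of "2 * pi"] by simp
qed

section \<open>Duality, conjugation and inversion\<close>

lemma is_fourier_multiplication_formula:
  assumes f: "is_fourier f F" and g: "is_fourier g G"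
  shows "(LINT x|lborel. F x * g x) = (LINT x|lborel. f x * G x)"
proof -
  note f' = is_fourierD[OF f] and g' = is_fourierD[OF g]
  note Ff = Plancherel_L1_L2(1)[OF cutoff_integrable[OF f'(1)] cutoff_L2[OF f'(1)]]
  note Fg = Plancherel_L1_L2(1)[OF cutoff_integrable[OF g'(1)] cutoff_L2[OF g'(1)]]
  have "((\<lambda>R. LINT x|lborel. fourier_L1 (cutoff R f) x * cutoff R g x) \<longlongrightarrow> (LINT x|lborel. F x * g x)) at_top"
    using f'(3) by (intro integral_mult_tendsto Ff cutoff_L2 f' g' cutoff_tendsto) (subst nsq_minus_commute)
  moreover have "((\<lambda>R. LINT x|lborel. cutoff R f x * fourier_L1 (cutoff R g) x) \<longlongrightarrow> (LINT x|lborel. f x * G x)) at_top"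
    using g'(3) by (intro integral_mult_tendsto Fg cutoff_L2 f' g' cutoff_tendsto) (subst nsq_minus_commute)
  ultimately show ?thesis
    unfolding fourier_L1_multiplication_formula[OF cutoff_integrable[OF f'(1)] cutoff_integrable[OF g'(1)]]
    by (rule tendsto_unique[rotated]) simp
qed

lemma is_fourier_cnj:
  assumes "is_fourier f F"
  shows "is_fourier (\<lambda>x. cnj (f x)) (\<lambda>\<xi>. cnj (F (- \<xi>)))"
proof (rule is_fourierI)
  note D = is_fourierD[OF assms]
  show "L2 (\<lambda>x. cnj (f x))" using D by simp
  show "L2 (\<lambda>\<xi>. cnj (F (- \<xi>)))" using L2_affine[OF D(2), of "-1" 0] by simp
  have "fourier_L1 (cutoff R (\<lambda>x. cnj (f x))) \<xi> = cnj (fourier_L1 (cutoff R f) (- \<xi>))" for R \<xi>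
  proof -
    have "cnj (fourier_L1 (cutoff R f) (- \<xi>)) = (LINT x|lborel. cnj (cis (- (x * - \<xi>)) * cutoff R f x))"
      unfolding fourier_L1_def by (rule Bochner_Integration.integral_cnj[symmetric])
    then show ?thesis by (simp add: fourier_L1_def cutoff_def cis_cnj)
  qed
  then have "nsq (\<lambda>\<xi>. cnj (F (- \<xi>)) - fourier_L1 (cutoff R (\<lambda>x. cnj (f x))) \<xi>) = nsq (\<lambda>\<xi>. F \<xi> - fourier_L1 (cutoff R f) \<xi>)" for R
    using nsq_affine[of "-1" "\<lambda>\<xi>. F \<xi> - fourier_L1 (cutoff R f) \<xi>" 0]
    by (simp add: nsq_def flip: complex_cnj_diff)
  then show "((\<lambda>R. nsq (\<lambda>\<xi>. cnj (F (- \<xi>)) - fourier_L1 (cutoff R (\<lambda>x. cnj (f x))) \<xi>)) \<longlongrightarrow> 0) at_top"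
    using D(3) by simp
qed

text \<open>No pointwise inversion formula enters. If \<open>U\<close> is a transform of the
  candidate, Plancherel applied twice shows that \<open>U\<close> and \<open>v\<close> have the same
  norm, and duality evaluates their pairing as \<open>nsq v\<close>; expanding the square gives
  \<open>nsq (U - v) = 0\<close>.\<close>

theorem fourier_inversion:
  assumes "is_fourier v V"
  shows "is_fourier (\<lambda>x. V (- x) / (2 * pi)) v"
proof -
  note D = is_fourierD[OF assms]
  let ?u = "\<lambda>x. V (- x) / (2 * pi)"
  have V': "L2 (\<lambda>x. V (- x))" using L2_affine[OF D(2), of "-1" 0] by simp
  then have u: "L2 ?u" using L2_cmult[OF V', of "1 / (2 * pi)"] by simp
  have nV: "nsq (\<lambda>x. V (- x)) = 2 * pi * nsq v"
    using nsq_affine[of "-1" V 0] is_fourier_Plancherel[OF assms] by simp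
  have nu: "nsq ?u = nsq v / (2 * pi)"
    using nsq_cmult[of "1 / (2 * pi)" "\<lambda>x. V (- x)"] by (simp add: nV norm_divide norm_mult power2_eq_square)
  obtain U where U: "is_fourier ?u U" using fourier_exists[OF u] by blast
  note U' = is_fourierD(2)[OF U]
  have nU: "nsq U = nsq v" using is_fourier_Plancherel[OF U] unfolding nu by simp
  have "(LINT x|lborel. U x * cnj (v x)) = (LINT x|lborel. ?u x * cnj (V (- x)))"
    by (rule is_fourier_multiplication_formula[OF U is_fourier_cnj[OF assms]])
  also have "\<dots> = (LINT x|lborel. complex_of_real ((cmod (V (- x)))\<^sup>2) / (2 * pi))"
    by (simp only: complex_norm_square times_divide_eq_left)
  also have "\<dots> = complex_of_real (nsq (\<lambda>x. V (- x))) / (2 * pi)"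
    unfolding nsq_def integral_divide_zero by (simp only: integral_complex_of_real)
  finally have "Re (LINT x|lborel. U x * cnj (v x)) = nsq v" by (simp add: nV)
  then have "nsq (\<lambda>x. U x - v x) = 0" using nsq_diff_expand[OF U' D(1)] nU by simp
  then have "AE x in lborel. U x - v x = 0" by (rule nsq_zero_AE[OF L2_diff[OF U' D(1)]])
  then show ?thesis by (intro is_fourier_cong_AE[OF U]) (use D in \<open>auto simp: L2_def\<close>)
qed

lemma fourier_surj: "L2 v \<Longrightarrow> \<exists>u. is_fourier u v"
  using fourier_inversion fourier_exists by blast

text \<open>The truncations in \<open>is_fourier\<close> are symmetric about 0, and translation
  destroys this symmetry. The formula is therefore computed for cutoffs, where the integral is
  absolutely convergent, and extended by closedness of the graph.\<close>

lemma is_fourier_translate: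
  assumes "is_fourier u v"
  shows "is_fourier (\<lambda>x. u (x + y)) (\<lambda>\<xi>. cis (y * \<xi>) * v \<xi>)"
proof -
  note D = is_fourierD[OF assms]
  have shift: "(\<lambda>x. f (x + y)) = (\<lambda>x. f (y + 1 * x))" for f :: "real \<Rightarrow> complex" by (simp add: add.commute)
  have [measurable]: "v \<in> borel_measurable borel" using D by (simp add: L2_def)
  let ?w = "\<lambda>n. cutoff (real n) u"
  show ?thesis
  proof (rule is_fourier_closed)
    fix n
    have i: "integrable lborel (\<lambda>x. ?w n (x + y))" "L2 (\<lambda>x. ?w n (x + y))"
      unfolding shift by (intro lborel_integrable_real_affine L2_affine cutoff_integrable cutoff_L2 D; simp)+
    have "fourier_L1 (\<lambda>x. ?w n (x + y)) = (\<lambda>\<xi>. cis (y * \<xi>) * fourier_L1 (?w n) \<xi>)"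
    proof
      fix \<xi>
      have "fourier_L1 (?w n) \<xi> = (LINT x|lborel. cis (- ((y + 1 * x) * \<xi>)) * ?w n (y + 1 * x))"
        unfolding fourier_L1_def by (subst lborel_integral_real_affine[of 1 _ y]) auto
      then have "cis (y * \<xi>) * fourier_L1 (?w n) \<xi> = (LINT x|lborel. cis (y * \<xi>) * (cis (- ((y + 1 * x) * \<xi>)) * ?w n (y + 1 * x)))"
        by (simp only: integral_mult_right_zero)
      also have "\<dots> = fourier_L1 (\<lambda>x. ?w n (x + y)) \<xi>"
        unfolding fourier_L1_def mult.assoc[symmetric] cis_mult
        by (intro Bochner_Integration.integral_cong) (auto simp: algebra_simps)
      finally show "fourier_L1 (\<lambda>x. ?w n (x + y)) \<xi> = cis (y * \<xi>) * fourier_L1 (?w n) \<xi>" by simp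
    qed
    then show "is_fourier (\<lambda>x. ?w n (x + y)) (\<lambda>\<xi>. cis (y * \<xi>) * fourier_L1 (?w n) \<xi>)"
      using is_fourier_L1[OF i] by simp
  next
    show "L2 (\<lambda>x. u (x + y))" unfolding shift by (intro L2_affine D) simp
    show "L2 (\<lambda>\<xi>. cis (y * \<xi>) * v \<xi>)" by (rule L2_dominated[OF D(2), of _ 1]) (simp_all add: norm_mult)
    have "nsq (\<lambda>x. ?w n (x + y) - u (x + y)) = nsq (\<lambda>x. ?w n x - u x)" for n
      using nsq_affine[of 1 "\<lambda>x. ?w n x - u x" y] by (simp add: add.commute)
    then show "(\<lambda>n. nsq (\<lambda>x. ?w n (x + y) - u (x + y))) \<longlonglongrightarrow> 0"
      using filterlim_compose[OF cutoff_tendsto[OF D(1)] filterlim_real_sequentially] by simp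
    have "nsq (\<lambda>x. cis (y * x) * fourier_L1 (?w n) x - cis (y * x) * v x) = nsq (\<lambda>x. v x - fourier_L1 (?w n) x)" for n
      by (simp add: nsq_def norm_mult norm_minus_commute flip: right_diff_distrib)
    then show "(\<lambda>n. nsq (\<lambda>x. cis (y * x) * fourier_L1 (?w n) x - cis (y * x) * v x)) \<longlonglongrightarrow> 0"
      using filterlim_compose[OF D(3) filterlim_real_sequentially] by simp
  qed
qed

lemma fourier_is_fourier: "L2 u \<Longrightarrow> is_fourier u (fourier u)"
  unfolding fourier_def using fourier_exists by (rule someI_ex)

text \<open>This is the inverse transform of \<open>v\<close> restricted to \<open>A\<close>,
  written as an integral so that it is a function with a value at every point; suprema and the value
  at the origin are needed later.\<close>

definition band :: "real set \<Rightarrow> (real \<Rightarrow> complex) \<Rightarrow> real \<Rightarrow> complex" where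
  "band A v x = fourier_L1 (\<lambda>\<xi>. indicator A \<xi> *\<^sub>R v \<xi>) (- x) / (2 * pi)"

lemma band_is_fourier:
  assumes "L2 v" "A \<in> sets borel" "emeasure lborel A < \<infinity>"
  shows "is_fourier (band A v) (\<lambda>\<xi>. indicator A \<xi> *\<^sub>R v \<xi>)"
  unfolding band_def[abs_def]
  by (intro fourier_inversion is_fourier_L1 L2_indicator_integrable L2_indicator assms)

subsection \<open>A dyadic Sobolev inequality\<close>

lemma one_le_powr_nonpos:
  fixes t :: real
  assumes "0 < t" "t \<le> 1" "a \<le> 0"
  shows "1 \<le> t powr a"
  using powr_mono'[of a 0 t] assms by simp

text \<open>Convexity of the power at the points \<open>a / (1 - t)\<close> and
  \<open>b / t\<close>. The weight \<open>t\<close> is kept free: as it tends to 0 the coefficient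
  of \<open>a\<close> tends to 1 (Brezis--Lieb), and a suitable fixed value makes that coefficient
  \<open>3/2\<close> (dyadic sums).\<close>

lemma powr_add_le_weighted:
  fixes a b t q :: real
  assumes a: "0 \<le> a" and b: "0 \<le> b" and t: "0 < t" "t < 1" and q: "1 \<le> q"
  shows "(a + b) powr q \<le> (1 - t) powr (1 - q) * a powr q + t powr (1 - q) * b powr q"
proof -
  consider "a = 0" | "b = 0" | "a > 0" "b > 0" using a b by fastforce
  then show ?thesis
  proof cases
    case 1
    have "1 * b powr q \<le> t powr (1 - q) * b powr q" by (intro mult_right_mono one_le_powr_nonpos) (use t q in auto)
    then show ?thesis using 1 q by simp
  next
    case 2
    have "1 * a powr q \<le> (1 - t) powr (1 - q) * a powr q" by (intro mult_right_mono one_le_powr_nonpos) (use t q in auto)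
    then show ?thesis using 2 q by simp
  next
    case 3
    have s: "s * (x / s) powr q = s powr (1 - q) * x powr q" if "s > 0" "x > 0" for s x :: real
      using that by (simp add: powr_divide powr_diff)
    have "((1 - t) *\<^sub>R (a / (1 - t)) + t *\<^sub>R (b / t)) powr q \<le> (1 - t) * (a / (1 - t)) powr q + t * (b / t) powr q"
      by (rule convex_onD[OF powr_convex[OF q]]) (use t 3 in auto)
    then show ?thesis using t 3 by (simp add: s)
  qed
qed

text \<open>The first summand is peeled off as the term \<open>b\<close>, and the rest as
  \<open>a\<close> takes the factor \<open>(1 - t) powr (1 - q)\<close>; by iteration the
  \<open>j\<close>-th summand collects \<open>j\<close> such factors. The growth rate can thus be
  made as close to 1 as desired.\<close>

lemma powr_sum_le_geometric:
  fixes f :: "nat \<Rightarrow> real"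
  assumes "\<And>j. 0 \<le> f j" and t: "0 < t" "t < 1" and q: "1 \<le> q"
  shows "(\<Sum>j<J. f j) powr q \<le> (\<Sum>j<J. t powr (1 - q) * ((1 - t) powr (1 - q)) ^ j * f j powr q)"
  using assms(1)
proof (induction J arbitrary: f)
  case (Suc J)
  have "(\<Sum>j<Suc J. f j) powr q = ((\<Sum>j<J. f (Suc j)) + f 0) powr q"
    unfolding sum.lessThan_Suc_shift by (simp add: add.commute)
  also have "\<dots> \<le> (1 - t) powr (1 - q) * (\<Sum>j<J. f (Suc j)) powr q + t powr (1 - q) * f 0 powr q"
    by (rule powr_add_le_weighted) (use Suc.prems t q in \<open>auto intro: sum_nonneg\<close>)
  also have "\<dots> \<le> (1 - t) powr (1 - q) * (\<Sum>j<J. t powr (1 - q) * ((1 - t) powr (1 - q)) ^ j * f (Suc j) powr q)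
      + t powr (1 - q) * f 0 powr q"
    using Suc.IH[of "\<lambda>j. f (Suc j)"] Suc.prems by (intro add_right_mono mult_left_mono) auto
  also have "\<dots> = (\<Sum>j<Suc J. t powr (1 - q) * ((1 - t) powr (1 - q)) ^ j * f j powr q)"
    unfolding sum.lessThan_Suc_shift by (simp add: sum_distrib_left mult_ac)
  finally show ?case .
qed simp

lemma Fatou_bound:
  assumes [measurable]: "\<And>i. f i \<in> borel_measurable M"
    and lim: "AE x in M. (\<lambda>i. f i x) \<longlonglongrightarrow> g x" and le: "\<And>i::nat. (\<integral>\<^sup>+x. f i x \<partial>M) \<le> C"
  shows "(\<integral>\<^sup>+x. g x \<partial>M) \<le> (C::ennreal)"
proof -
  have "(\<integral>\<^sup>+x. g x \<partial>M) = (\<integral>\<^sup>+x. liminf (\<lambda>i. f i x) \<partial>M)"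
    by (rule nn_integral_cong_AE, use lim in eventually_elim) (simp add: lim_imp_Liminf)
  also have "\<dots> \<le> liminf (\<lambda>i. \<integral>\<^sup>+x. f i x \<partial>M)" by (rule nn_integral_liminf) simp
  also have "\<dots> \<le> C"
    using Liminf_mono[OF always_eventually[OF allI[OF le]], of sequentially] by (simp add: Liminf_const)
  finally show ?thesis .
qed

section \<open>Supremum bounds for band-limited functions\<close>

lemma L2_indicator_interval: "L2 (indicator {-R..R} :: real \<Rightarrow> real)"
proof -
  have "(\<lambda>x. (norm (indicator {-R..R} x :: real))\<^sup>2) = indicator {-R..R}" by (auto simp: indicator_def)
  then show ?thesis by (simp add: L2_def integrable_indicator_iff emeasure_lborel_Icc_eq)
qed

lemma nsq_indicator_interval:
  assumes "0 \<le> R"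
  shows "nsq (indicator {-R..R} :: real \<Rightarrow> real) = 2 * R"
proof -
  have "nsq (indicator {-R..R} :: real \<Rightarrow> real) = (LINT x|lborel. indicator {-R..R} x)"
    unfolding nsq_def by (intro Bochner_Integration.integral_cong) (auto simp: indicator_def)
  then show ?thesis using assms by simp
qed

lemma L1_band_bound:
  assumes v: "L2 v" and A[measurable]: "A \<in> sets borel" and AR: "A \<subseteq> {-R..R}" and R: "0 \<le> R"
  shows "(LINT \<xi>|lborel. cmod (indicator A \<xi> *\<^sub>R v \<xi>))
    \<le> sqrt (2 * R) * sqrt (nsq (\<lambda>\<xi>. indicator A \<xi> *\<^sub>R v \<xi>))"
proof -
  let ?g = "\<lambda>\<xi>. indicator A \<xi> *\<^sub>R v \<xi>"
  have "(LINT \<xi>|lborel. cmod (?g \<xi>)) = (LINT \<xi>|lborel. norm (indicator {-R..R} \<xi> :: real) * norm (?g \<xi>))"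
    using AR by (intro Bochner_Integration.integral_cong) (auto simp: indicator_def)
  also have "\<dots> \<le> sqrt (2 * R) * sqrt (nsq ?g)"
    using Cauchy_Schwarz_nsq[OF L2_indicator_interval[of R] L2_indicator[OF v A]] by (simp only: nsq_indicator_interval[OF R])
  finally show ?thesis .
qed

lemma L1_interval_bound:
  assumes v: "L2 v" and R: "0 \<le> R" and T: "nsq v \<le> T"
  shows "(LINT \<xi>|lborel. cmod (indicator {-R..R} \<xi> *\<^sub>R v \<xi>)) \<le> sqrt (2 * R) * sqrt T"
proof (rule order_trans[OF L1_band_bound[OF v _ order_refl R]])
  have [measurable]: "v \<in> borel_measurable borel" using v by (simp add: L2_def)
  have "nsq (\<lambda>\<xi>. indicator {-R..R} \<xi> *\<^sub>R v \<xi>) \<le> nsq v"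
    by (rule nsq_mono[OF v]) (auto simp: indicator_def)
  then show "sqrt (2 * R) * sqrt (nsq (\<lambda>\<xi>. indicator {-R..R} \<xi> *\<^sub>R v \<xi>)) \<le> sqrt (2 * R) * sqrt T"
    using T R by (intro mult_left_mono) auto
qed simp

lemma cmod_band_le: "cmod (band A v x) \<le> (LINT \<xi>|lborel. cmod (indicator A \<xi> *\<^sub>R v \<xi>)) / (2 * pi)"
  unfolding band_def using fourier_L1_bound[of "\<lambda>\<xi>. indicator A \<xi> *\<^sub>R v \<xi>" "- x"]
  by (simp add: norm_divide norm_mult divide_right_mono del: norm_scaleR)

text \<open>Bernstein's inequality from mean square to supremum: Cauchy-Schwarz in frequency costs
  the square root of the bandwidth.\<close>

lemma band_bound:
  assumes "L2 v" "A \<in> sets borel" "A \<subseteq> {-R..R}" "0 \<le> R"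
  shows "cmod (band A v x) \<le> sqrt (2 * R) * sqrt (nsq (\<lambda>\<xi>. indicator A \<xi> *\<^sub>R v \<xi>)) / (2 * pi)"
  by (rule order_trans[OF cmod_band_le]) (intro divide_right_mono L1_band_bound assms; simp)

lemma band_interval_bound:
  assumes v: "L2 v" and R: "0 \<le> R" and T: "nsq v \<le> T"
  shows "cmod (band {-R..R} v x) \<le> sqrt (2 * R) * sqrt T"
proof -
  have T0: "0 \<le> T" using order_trans[OF nsq_nonneg T] .
  have "cmod (band {-R..R} v x) \<le> (LINT \<xi>|lborel. cmod (indicator {-R..R} \<xi> *\<^sub>R v \<xi>)) / (2 * pi)"
    by (rule cmod_band_le)
  also have "\<dots> \<le> sqrt (2 * R) * sqrt T / (2 * pi)"
    by (intro divide_right_mono L1_interval_bound assms) auto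
  also have "\<dots> \<le> sqrt (2 * R) * sqrt T / 1"
    using R T0 pi_ge_two by (intro divide_left_mono) auto
  finally show ?thesis by simp
qed

section \<open>Dyadic rings in frequency\<close>

abbreviation sob_finite :: "real \<Rightarrow> (real \<Rightarrow> complex) \<Rightarrow> bool" where
  "sob_finite s v \<equiv> integrable lborel (\<lambda>\<xi>. (1 + \<xi>\<^sup>2) powr s * (cmod (v \<xi>))\<^sup>2)"

abbreviation sob_nsq :: "real \<Rightarrow> (real \<Rightarrow> complex) \<Rightarrow> real" where
  "sob_nsq s v \<equiv> LINT \<xi>|lborel. (1 + \<xi>\<^sup>2) powr s * (cmod (v \<xi>))\<^sup>2"

text \<open>Shifting the dyadic radii by one puts the origin into the zeroth ring.\<close>
definition dyadic :: "nat \<Rightarrow> real set" where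
  "dyadic j = {\<xi>. 2 ^ j - 1 \<le> \<bar>\<xi>\<bar> \<and> \<bar>\<xi>\<bar> < 2 ^ (j + 1) - 1}"

lemma dyadic_borel [measurable]: "dyadic j \<in> sets borel"
  unfolding dyadic_def by measurable

lemma dyadic_subset: "dyadic j \<subseteq> {- (2 * 2 ^ j)..2 * 2 ^ j}"
  by (auto simp: dyadic_def)

lemma emeasure_dyadic: "emeasure lborel (dyadic j) < \<infinity>"
  by (rule order_le_less_trans[OF emeasure_mono[OF dyadic_subset]]) (simp_all add: emeasure_lborel_Icc_eq)

lemma sum_indicator_dyadic:
  "(\<Sum>j<J. indicator (dyadic j) \<xi>) = (indicator {\<xi>. \<bar>\<xi>\<bar> < 2 ^ J - 1} \<xi> :: real)"
proof (induction J)
  case (Suc J)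
  define a b where "a = (2::real) ^ J - 1" and "b = (2::real) ^ (J + 1) - 1"
  have "a \<le> b" by (simp add: a_def b_def)
  then have "indicator {\<xi>. \<bar>\<xi>\<bar> < a} \<xi> + indicator {\<xi>. a \<le> \<bar>\<xi>\<bar> \<and> \<bar>\<xi>\<bar> < b} \<xi> = (indicator {\<xi>. \<bar>\<xi>\<bar> < b} \<xi> :: real)"
    by (auto simp: indicator_def)
  then show ?case unfolding sum.lessThan_Suc Suc.IH by (simp only: dyadic_def a_def b_def Suc_eq_plus1)
qed simp

text \<open>On the ring \<open>2 ^ j \<le> 1 + \<bar>\<xi>\<bar>\<close>, so
  \<open>sqrt (1 + \<xi>\<^sup>2)\<close> is at least \<open>2 ^ j / 2\<close>; the weight is at
  least this root because \<open>s \<ge> 1/2\<close> and its base is at least 1.\<close>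

lemma nsq_dyadic:
  assumes v: "L2 v" and s: "1/2 \<le> s" and int: "sob_finite s v"
    and T: "(sob_nsq s v) \<le> T"
  shows "nsq (\<lambda>\<xi>. indicator (dyadic j) \<xi> *\<^sub>R v \<xi>) \<le> 2 * T / 2 ^ j"
proof -
  have pw: "2 ^ j / 2 \<le> (1 + \<xi>\<^sup>2) powr s" if "\<xi> \<in> dyadic j" for \<xi>
  proof -
    have "(2::real) ^ j \<le> 1 + \<bar>\<xi>\<bar>" using that by (simp add: dyadic_def)
    then have "((2::real) ^ j)\<^sup>2 \<le> (1 + \<bar>\<xi>\<bar>)\<^sup>2" by (intro power_mono) auto
    also have "\<dots> \<le> 2 * 1\<^sup>2 + 2 * \<bar>\<xi>\<bar>\<^sup>2" by (rule sum_sq_bound)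
    finally have "((2::real) ^ j)\<^sup>2 \<le> 2 * (1 + \<xi>\<^sup>2)" by simp
    \<comment> \<open>Dividing by 4, although 2 would do, keeps the left side the square of a simple
      expression.\<close>
    then have "((2::real) ^ j)\<^sup>2 / 4 \<le> (2 * (1 + \<xi>\<^sup>2)) / 4" by (rule divide_right_mono) simp
    also have "\<dots> \<le> 1 + \<xi>\<^sup>2" using zero_le_power2[of \<xi>] by simp
    finally have "(2 ^ j / 2)\<^sup>2 \<le> 1 + \<xi>\<^sup>2" by (simp only: power_divide) simp
    then have "2 ^ j / 2 \<le> sqrt (1 + \<xi>\<^sup>2)" by (rule real_le_rsqrt)
    also have "\<dots> = (1 + \<xi>\<^sup>2) powr (1/2)" by (simp add: powr_half_sqrt)
    also have "\<dots> \<le> (1 + \<xi>\<^sup>2) powr s" by (intro powr_mono s) simp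
    finally show ?thesis .
  qed
  have "2 ^ j / 2 * nsq (\<lambda>\<xi>. indicator (dyadic j) \<xi> *\<^sub>R v \<xi>)
     = (LINT \<xi>|lborel. 2 ^ j / 2 * (cmod (indicator (dyadic j) \<xi> *\<^sub>R v \<xi>))\<^sup>2)"
    unfolding nsq_def by (rule integral_mult_right_zero[symmetric])
  also have "\<dots> \<le> (sob_nsq s v)"
  proof (rule integral_mono')
    show "2 ^ j / 2 * (cmod (indicator (dyadic j) \<xi> *\<^sub>R v \<xi>))\<^sup>2 \<le> (1 + \<xi>\<^sup>2) powr s * (cmod (v \<xi>))\<^sup>2" for \<xi>
      using mult_right_mono[OF pw[of \<xi>], of "(cmod (v \<xi>))\<^sup>2"] by (cases "\<xi> \<in> dyadic j") auto
  qed (auto intro: int)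
  also note T
  finally show ?thesis by (simp add: field_simps)
qed

text \<open>The factor \<open>sqrt (2 ^ j)\<close> lost to the bandwidth cancels against the decay
  of the mass in the ring. The bound is uniform in \<open>j\<close> but not summable, which is the
  critical situation at \<open>s = 1/2\<close>.\<close>

lemma band_dyadic_bound:
  assumes v: "L2 v" and s: "1/2 \<le> s" and int: "sob_finite s v"
    and T: "(sob_nsq s v) \<le> T"
  shows "cmod (band (dyadic j) v x) \<le> sqrt T"
proof -
  have "cmod (band (dyadic j) v x) \<le> sqrt (2 * (2 * 2 ^ j)) * sqrt (nsq (\<lambda>\<xi>. indicator (dyadic j) \<xi> *\<^sub>R v \<xi>)) / (2 * pi)"
    by (rule band_bound[OF v _ dyadic_subset]) auto
  also have "\<dots> \<le> sqrt (2 * (2 * 2 ^ j)) * sqrt (2 * T / 2 ^ j) / (2 * pi)"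
    by (intro divide_right_mono mult_left_mono real_sqrt_le_mono nsq_dyadic[OF assms]) auto
  also have "\<dots> = sqrt (8 * T) / (2 * pi)"
    unfolding real_sqrt_mult[symmetric] by simp
  \<comment> \<open>Replacing 8 by 9 gives a rational root, and \<open>3 \<le> 2 * pi\<close> then
    removes the constant.\<close>
  also have "\<dots> \<le> sqrt (9 * T) / (2 * pi)"
  proof -
    have "0 \<le> T" using order_trans[OF _ T] by (simp add: integral_nonneg_AE)
    then show ?thesis by (intro divide_right_mono real_sqrt_le_mono) auto
  qed
  also have "\<dots> = 3 / (2 * pi) * sqrt T" by (simp add: real_sqrt_mult)
  also have "\<dots> \<le> 1 * sqrt T"
  proof (rule mult_right_mono)
    show "3 / (2 * pi) \<le> 1" using pi_ge_two by (simp add: field_simps)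
    show "0 \<le> sqrt T" using order_trans[OF _ T, of 0] by (simp add: integral_nonneg_AE)
  qed
  finally show ?thesis by simp
qed

lemma is_fourier_sum_bands:
  assumes v: "L2 v"
  shows "is_fourier (\<lambda>x. \<Sum>j<J. band (dyadic j) v x) (\<lambda>\<xi>. indicator {\<xi>. \<bar>\<xi>\<bar> < 2 ^ J - 1} \<xi> *\<^sub>R v \<xi>)"
proof -
  have "is_fourier (\<lambda>x. \<Sum>j<J. band (dyadic j) v x) (\<lambda>\<xi>. \<Sum>j<J. indicator (dyadic j) \<xi> *\<^sub>R v \<xi>)"
  proof (induction J)
    case 0
    have "is_fourier (\<lambda>x. 0 * band (dyadic 0) v x) (\<lambda>\<xi>. 0 * (indicator (dyadic 0) \<xi> *\<^sub>R v \<xi>))"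
      by (intro is_fourier_cmult band_is_fourier v emeasure_dyadic) measurable
    then show ?case by simp
  next
    case (Suc J)
    show ?case
      using is_fourier_lincomb[OF Suc.IH band_is_fourier[OF v dyadic_borel emeasure_dyadic], of 1 1 J] by simp
  qed
  then show ?thesis by (simp only: scaleR_sum_left[symmetric] sum_indicator_dyadic)
qed

lemma nsq_indicator_tendsto:
  fixes v :: "real \<Rightarrow> complex"
  assumes v: "L2 v" and R: "filterlim R at_top sequentially"
  shows "(\<lambda>n. nsq (\<lambda>\<xi>. indicator {\<xi>. \<bar>\<xi>\<bar> < R n} \<xi> *\<^sub>R v \<xi> - v \<xi>)) \<longlonglongrightarrow> 0"
proof (rule nsq_dominated_convergence[OF v])
  have [measurable]: "v \<in> borel_measurable borel" using v by (simp add: L2_def)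
  show "(\<lambda>\<xi>. indicator {\<xi>. \<bar>\<xi>\<bar> < R n} \<xi> *\<^sub>R v \<xi> - v \<xi>) \<in> borel_measurable borel" for n by measurable
  show "norm (indicator {\<xi>. \<bar>\<xi>\<bar> < R n} \<xi> *\<^sub>R v \<xi> - v \<xi>) \<le> norm (v \<xi>)" for n \<xi> by (simp add: indicator_def)
  fix \<xi>
  have "\<forall>\<^sub>F n in sequentially. R n > \<bar>\<xi>\<bar>" using R by (simp add: filterlim_at_top_dense)
  then have "\<forall>\<^sub>F n in sequentially. indicator {\<xi>. \<bar>\<xi>\<bar> < R n} \<xi> *\<^sub>R v \<xi> - v \<xi> = 0"
    by eventually_elim simp
  then show "(\<lambda>n. indicator {\<xi>. \<bar>\<xi>\<bar> < R n} \<xi> *\<^sub>R v \<xi> - v \<xi>) \<longlonglongrightarrow> 0" by (rule tendsto_eventually)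
qed

text \<open>The loss \<open>(3/2)\<^sup>j\<close> caused by the choice of \<open>t\<close> is compensated by the decay \<open>2\<^sup>-\<^sup>j\<close> of the mass in the
  \<open>j\<close>-th ring; this is where \<open>s \<ge> 1/2\<close> enters.\<close>
theorem dyadic_Lq_bound:
  assumes uv: "is_fourier u v" and s: "1/2 \<le> s"
    and int: "sob_finite s v"
    and T: "(sob_nsq s v) \<le> T"
    and B: "\<And>j x. cmod (band (dyadic j) v x) \<le> B j" and M: "\<And>j. B j \<le> M" and q: "2 < q"
    and t: "0 < t" "t < 1" "(1 - t) powr (1 - q) = 3/2"
  shows "(\<integral>\<^sup>+x. ennreal (cmod (u x) powr q) \<partial>lborel)
    \<le> ennreal (t powr (1 - q) * T * (\<Sum>j. (3/4) ^ j * B j powr (q - 2)))"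
proof -
  note D = is_fourierD[OF uv]
  have T0: "0 \<le> T" using order_trans[OF _ T] by (simp add: integral_nonneg_AE)
  have B0: "0 \<le> B j" for j using order_trans[OF norm_ge_zero B] .
  define w where "w j = band (dyadic j) v" for j
  have wF: "is_fourier (w j) (\<lambda>\<xi>. indicator (dyadic j) \<xi> *\<^sub>R v \<xi>)" for j
    unfolding w_def by (rule band_is_fourier[OF D(2) dyadic_borel emeasure_dyadic])
  have [measurable]: "u \<in> borel_measurable borel" "w j \<in> borel_measurable borel" for j
    using D is_fourierD(1)[OF wF] by (auto simp: L2_def)
  \<comment> \<open>Interpolation between supremum and mean square: \<open>q - 2\<close> powers go
    to the bound \<open>B j\<close>, the other two to Plancherel. The factor 2 in the mass of a ring
    is absorbed by \<open>2 * pi\<close>.\<close>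
  have wq: "(\<integral>\<^sup>+x. ennreal (cmod (w j x) powr q) \<partial>lborel) \<le> ennreal (B j powr (q - 2) * (T / 2 ^ j))" for j
  proof -
    have pt: "cmod (w j x) powr q \<le> B j powr (q - 2) * (cmod (w j x))\<^sup>2" for x
    proof (cases "w j x = 0")
      case False
      have "cmod (w j x) powr q = cmod (w j x) powr (q - 2) * cmod (w j x) powr 2"
        by (subst powr_add[symmetric]) simp
      also have "\<dots> = cmod (w j x) powr (q - 2) * (cmod (w j x))\<^sup>2" using False by simp
      also have "\<dots> \<le> B j powr (q - 2) * (cmod (w j x))\<^sup>2"
        using q B[of j x] by (intro mult_right_mono powr_mono2) (auto simp: w_def)
      finally show ?thesis .
    qed (use q in simp)
    have nw: "nsq (w j) \<le> T / 2 ^ j"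
    proof -
      have "2 * pi * nsq (w j) \<le> 2 * (T / 2 ^ j)"
        using nsq_dyadic[OF D(2) s int T, of j] is_fourier_Plancherel[OF wF[of j]] by simp
      moreover have "2 * nsq (w j) \<le> 2 * pi * nsq (w j)"
        using pi_ge_two by (intro mult_right_mono) auto
      ultimately show ?thesis by linarith
    qed
    have "(\<integral>\<^sup>+x. ennreal (cmod (w j x) powr q) \<partial>lborel) \<le> (\<integral>\<^sup>+x. ennreal (B j powr (q - 2)) * ennreal ((cmod (w j x))\<^sup>2) \<partial>lborel)"
      by (intro nn_integral_mono) (simp add: pt ennreal_leI flip: ennreal_mult)
    also have "\<dots> = ennreal (B j powr (q - 2)) * ennreal (nsq (w j))"
      using nsq_nn_integral[OF is_fourierD(1)[OF wF[of j]]] by (simp add: nn_integral_cmult)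
    also have "\<dots> = ennreal (B j powr (q - 2) * nsq (w j))" by (simp add: ennreal_mult)
    also have "\<dots> \<le> ennreal (B j powr (q - 2) * (T / 2 ^ j))"
      by (intro ennreal_leI mult_left_mono nw) simp
    finally show ?thesis .
  qed
  have sm: "summable (\<lambda>j. (3/4) ^ j * B j powr (q - 2))"
  proof (rule summable_comparison_test)
    show "summable (\<lambda>j. (3/4::real) ^ j * M powr (q - 2))" by (intro summable_mult2 summable_geometric) simp
    have "norm ((3/4) ^ j * B j powr (q - 2)) \<le> (3/4) ^ j * M powr (q - 2)" for j
      using q B0[of j] M[of j] by (simp add: abs_mult powr_mono2)
    then show "\<exists>N. \<forall>j\<ge>N. norm ((3/4) ^ j * B j powr (q - 2)) \<le> (3/4) ^ j * M powr (q - 2)" by blast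
  qed
  define C where "C = t powr (1 - q)"
  have C0: "0 \<le> C" by (simp add: C_def)
  define S where "S J x = (\<Sum>j<J. w j x)" for J x
  have SF: "is_fourier (S J) (\<lambda>\<xi>. indicator {\<xi>. \<bar>\<xi>\<bar> < 2 ^ J - 1} \<xi> *\<^sub>R v \<xi>)" for J
    unfolding S_def[abs_def] w_def by (rule is_fourier_sum_bands[OF D(2)])
  have [measurable]: "S J \<in> borel_measurable borel" for J unfolding S_def[abs_def] by measurable
  have Sq: "(\<integral>\<^sup>+x. ennreal (cmod (S J x) powr q) \<partial>lborel) \<le> ennreal (C * T * (\<Sum>j. (3/4) ^ j * B j powr (q - 2)))" for J
  proof -
    have "(\<integral>\<^sup>+x. ennreal (cmod (S J x) powr q) \<partial>lborel) \<le> (\<integral>\<^sup>+x. (\<Sum>j<J. ennreal (C * (3/2) ^ j) * ennreal (cmod (w j x) powr q)) \<partial>lborel)"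
    proof (rule nn_integral_mono)
      fix x
      have "cmod (S J x) powr q \<le> (\<Sum>j<J. cmod (w j x)) powr q"
        unfolding S_def using q by (intro powr_mono2 norm_sum) auto
      also have "\<dots> \<le> (\<Sum>j<J. t powr (1 - q) * ((1 - t) powr (1 - q)) ^ j * cmod (w j x) powr q)"
        by (rule powr_sum_le_geometric) (use t q in auto)
      also have "\<dots> = (\<Sum>j<J. C * (3/2) ^ j * cmod (w j x) powr q)" by (simp only: t(3) C_def)
      finally have "ennreal (cmod (S J x) powr q) \<le> ennreal (\<Sum>j<J. C * (3/2) ^ j * cmod (w j x) powr q)"
        by (rule ennreal_leI)
      also have "\<dots> = (\<Sum>j<J. ennreal (C * (3/2) ^ j * cmod (w j x) powr q))"
        using C0 by (intro sum_ennreal[symmetric]) simp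
      also have "\<dots> = (\<Sum>j<J. ennreal (C * (3/2) ^ j) * ennreal (cmod (w j x) powr q))"
        using C0 by (intro sum.cong refl ennreal_mult) auto
      finally show "ennreal (cmod (S J x) powr q) \<le> (\<Sum>j<J. ennreal (C * (3/2) ^ j) * ennreal (cmod (w j x) powr q))" .
    qed
    also have "\<dots> = (\<Sum>j<J. ennreal (C * (3/2) ^ j) * (\<integral>\<^sup>+x. ennreal (cmod (w j x) powr q) \<partial>lborel))"
      by (subst nn_integral_sum) (auto intro!: sum.cong nn_integral_cmult)
    also have "\<dots> \<le> (\<Sum>j<J. ennreal (C * (3/2) ^ j) * ennreal (B j powr (q - 2) * (T / 2 ^ j)))"
      by (intro sum_mono mult_left_mono wq) simp
    also have "\<dots> = (\<Sum>j<J. ennreal (C * T * ((3/4) ^ j * B j powr (q - 2))))"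
    proof (intro sum.cong refl)
      fix j
      have "(3/2::real) ^ j / 2 ^ j = (3/4) ^ j" unfolding power_divide[symmetric] by simp
      moreover have "C * X * (b * (T / Y)) = C * T * (X / Y * b)" for X Y b by simp
      ultimately have "C * (3/2) ^ j * (B j powr (q - 2) * (T / 2 ^ j)) = C * T * ((3/4) ^ j * B j powr (q - 2))"
        by (simp only:)
      then show "ennreal (C * (3/2) ^ j) * ennreal (B j powr (q - 2) * (T / 2 ^ j)) = ennreal (C * T * ((3/4) ^ j * B j powr (q - 2)))"
        using C0 T0 by (subst ennreal_mult[symmetric]) auto
    qed
    also have "\<dots> = ennreal (\<Sum>j<J. C * T * ((3/4) ^ j * B j powr (q - 2)))"
      using C0 T0 by (intro sum_ennreal) simp
    also have "\<dots> \<le> ennreal (C * T * (\<Sum>j. (3/4) ^ j * B j powr (q - 2)))"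
      unfolding sum_distrib_left[symmetric] using C0 T0
      by (intro ennreal_leI mult_left_mono sum_le_suminf sm) auto
    finally show ?thesis .
  qed
  \<comment> \<open>The partial sums are the sharp frequency truncations of \<open>u\<close>, so
    they converge in the mean; along a subsequence they converge almost everywhere, and Fatou's
    lemma passes the uniform bound to \<open>u\<close>.\<close>
  have lim: "(\<lambda>J. nsq (\<lambda>x. S J x - u x)) \<longlonglongrightarrow> 0"
  proof -
    have "real J \<le> 2 ^ J - 1" for J
    proof -
      have "Suc J \<le> 2 ^ J" by (rule Suc_leI[OF less_exp])
      then have "real (Suc J) \<le> real (2 ^ J)" by (simp only: of_nat_le_iff)
      then show ?thesis by simp
    qed
    then have "filterlim (\<lambda>J. (2::real) ^ J - 1) at_top sequentially"
      by (intro filterlim_at_top_mono[OF filterlim_real_sequentially] always_eventually allI)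
    then have "(\<lambda>J. nsq (\<lambda>\<xi>. indicator {\<xi>. \<bar>\<xi>\<bar> < 2 ^ J - 1} \<xi> *\<^sub>R v \<xi> - v \<xi>)) \<longlonglongrightarrow> 0"
      by (rule nsq_indicator_tendsto[OF D(2)])
    then have "(\<lambda>J. 2 * pi * nsq (\<lambda>x. S J x - u x)) \<longlonglongrightarrow> 0"
      unfolding is_fourier_Plancherel[OF is_fourier_diff[OF SF uv]] .
    then have "(\<lambda>J. inverse (2 * pi) * (2 * pi * nsq (\<lambda>x. S J x - u x))) \<longlonglongrightarrow> 0"
      by (rule tendsto_mult_right_zero)
    moreover have "inverse (2 * pi) * (2 * pi * a) = a" for a :: real
      by (simp add: field_simps)
    ultimately show ?thesis by (simp only:)
  qed
  have "\<exists>r::nat\<Rightarrow>nat. strict_mono r \<and> (AE x in lborel. (\<lambda>i. (cmod (S (r i) x - u x))\<^sup>2) \<longlonglongrightarrow> 0)"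
  proof (rule tendsto_L1_AE_subseq)
    show "integrable lborel (\<lambda>x. (cmod (S J x - u x))\<^sup>2)" for J
      by (rule L2_integrable_sq[OF L2_diff[OF is_fourierD(1)[OF SF] D(1)]])
    show "(\<lambda>J. LINT x|lborel. norm ((cmod (S J x - u x))\<^sup>2)) \<longlonglongrightarrow> 0" using lim by (simp add: nsq_def)
  qed
  then obtain r :: "nat \<Rightarrow> nat" where ae: "AE x in lborel. (\<lambda>i. (cmod (S (r i) x - u x))\<^sup>2) \<longlonglongrightarrow> 0" by blast
  have "AE x in lborel. (\<lambda>i. ennreal (cmod (S (r i) x) powr q)) \<longlonglongrightarrow> ennreal (cmod (u x) powr q)"
    using ae
  proof eventually_elim
    case (elim x)
    have "(\<lambda>i. sqrt ((cmod (S (r i) x - u x))\<^sup>2)) \<longlonglongrightarrow> sqrt 0" by (intro tendsto_intros elim)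
    then have "(\<lambda>i. S (r i) x - u x) \<longlonglongrightarrow> 0" by (simp add: tendsto_norm_zero_iff)
    then have "(\<lambda>i. S (r i) x) \<longlonglongrightarrow> u x" by (simp add: LIM_zero_iff)
    then have "(\<lambda>i. cmod (S (r i) x) powr q) \<longlonglongrightarrow> cmod (u x) powr q"
      using q by (intro tendsto_powr2 tendsto_norm tendsto_const) auto
    then show ?case by (rule tendsto_ennrealI)
  qed
  then show ?thesis unfolding C_def[symmetric]
    by (rule Fatou_bound[rotated]) (use Sq in auto)
qed

subsection \<open>Local compactness\<close>

lemma cmod_cis_diff_le: "cmod (cis a - cis b) \<le> \<bar>a - b\<bar>"
proof -
  have "cis a - cis b = cis b * (cis (a - b) - 1)" by (simp add: right_diff_distrib cis_mult)
  then have "cmod (cis a - cis b) = cmod (cis (a - b) - 1)" by (simp add: norm_mult)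
  also have "\<dots> = 2 * \<bar>sin ((a - b) / 2)\<bar>" using dist_exp_i_1[of "a - b"] by (simp add: cis_conv_exp)
  also have "\<dots> \<le> 2 * \<bar>(a - b) / 2\<bar>" by (intro mult_left_mono abs_sin_x_le_abs_x) simp
  finally show ?thesis by simp
qed

text \<open>Phases with frequency at most \<open>R\<close> vary at rate at most \<open>R\<close>.
  This supplies the equicontinuity for the diagonal argument.\<close>

lemma band_Lipschitz:
  assumes v: "L2 v" and R: "0 \<le> R"
  shows "cmod (band {-R..R} v x - band {-R..R} v y) \<le> R * (LINT \<xi>|lborel. cmod (indicator {-R..R} \<xi> *\<^sub>R v \<xi>)) * \<bar>x - y\<bar>"
proof -
  let ?g = "\<lambda>\<xi>. indicator {-R..R} \<xi> *\<^sub>R v \<xi>"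
  have g: "integrable lborel ?g" by (rule L2_indicator_integrable[OF v]) (auto simp: emeasure_lborel_Icc_eq)
  have i: "integrable lborel (\<lambda>\<xi>. cis (\<xi> * z) * ?g \<xi>)" for z by (rule integrable_cis_mult[OF g]) measurable
  have "band {-R..R} v x - band {-R..R} v y = (LINT \<xi>|lborel. cis (\<xi> * x) * ?g \<xi> - cis (\<xi> * y) * ?g \<xi>) / (2 * pi)"
    unfolding band_def fourier_L1_def using i by (simp add: diff_divide_distrib del: scaleR_conv_of_real)
  then have "cmod (band {-R..R} v x - band {-R..R} v y) = cmod (LINT \<xi>|lborel. cis (\<xi> * x) * ?g \<xi> - cis (\<xi> * y) * ?g \<xi>) / (2 * pi)"
    by (simp add: norm_divide norm_mult)
  also have "\<dots> \<le> cmod (LINT \<xi>|lborel. cis (\<xi> * x) * ?g \<xi> - cis (\<xi> * y) * ?g \<xi>) / 1"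
    using pi_ge_two by (intro divide_left_mono) auto
  also have "\<dots> \<le> (LINT \<xi>|lborel. cmod (cis (\<xi> * x) * ?g \<xi> - cis (\<xi> * y) * ?g \<xi>))"
    unfolding div_by_1 by (rule integral_norm_bound)
  also have "\<dots> \<le> (LINT \<xi>|lborel. R * \<bar>x - y\<bar> * cmod (?g \<xi>))"
  proof (rule integral_mono)
    show "integrable lborel (\<lambda>\<xi>. cmod (cis (\<xi> * x) * ?g \<xi> - cis (\<xi> * y) * ?g \<xi>))"
      using i by (intro integrable_norm Bochner_Integration.integrable_diff)
    show "integrable lborel (\<lambda>\<xi>. R * \<bar>x - y\<bar> * cmod (?g \<xi>))" using g by (intro integrable_mult_right integrable_norm)
    fix \<xi>
    have "cmod (cis (\<xi> * x) * ?g \<xi> - cis (\<xi> * y) * ?g \<xi>) = cmod (cis (\<xi> * x) - cis (\<xi> * y)) * cmod (?g \<xi>)"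
      by (simp only: left_diff_distrib[symmetric] norm_mult)
    also have "\<dots> \<le> \<bar>\<xi> * x - \<xi> * y\<bar> * cmod (?g \<xi>)" by (intro mult_right_mono cmod_cis_diff_le) simp
    also have "\<dots> = \<bar>\<xi>\<bar> * \<bar>x - y\<bar> * cmod (?g \<xi>)" by (simp only: right_diff_distrib[symmetric] abs_mult)
    also have "\<dots> \<le> R * \<bar>x - y\<bar> * cmod (?g \<xi>)"
    proof (cases "\<xi> \<in> {-R..R}")
      case True
      then show ?thesis by (intro mult_right_mono) auto
    qed simp
    finally show "cmod (cis (\<xi> * x) * ?g \<xi> - cis (\<xi> * y) * ?g \<xi>) \<le> R * \<bar>x - y\<bar> * cmod (?g \<xi>)" .
  qed
  also have "\<dots> = R * \<bar>x - y\<bar> * (LINT \<xi>|lborel. cmod (?g \<xi>))" by (rule integral_mult_right_zero)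
  finally show ?thesis by (simp only: mult_ac)
qed

text \<open>A diagonal sequence converges at all rational points, and the common Lipschitz constant
  extends this to all reals. Pairs of radius and point form a single countable index set, so one
  subsequence serves all radii.\<close>

lemma band_pointwise_convergent_subsequence:
  assumes v: "\<And>n. L2 (v n)" and T: "\<And>n. nsq (v n) \<le> T"
  obtains k where "strict_mono (k::nat\<Rightarrow>nat)" "\<And>R x. convergent (\<lambda>i. band {- real R..real R} (v (k i)) x)"
proof -
  define M where "M R = sqrt (2 * real R) * sqrt T" for R
  have T0: "0 \<le> T" using order_trans[OF nsq_nonneg T] .
  have M0: "0 \<le> M R" for R using T0 by (simp add: M_def)
  define P where "P n z = band {- real (fst z)..real (fst z)} (v n) (snd z)" for n and z :: "nat \<times> real"
  have P: "cmod (P n z) \<le> M (fst z)" for n z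
    unfolding P_def M_def by (intro band_interval_bound v T) simp
  have "countable (UNIV \<times> \<rat> :: (nat \<times> real) set)" by (intro countable_SIGMA countable_rat) auto
  \<comment> \<open>The diagonal theorem asks for one bound over all indices, whereas
    \<open>M\<close> depends on the radius; the summand 1 excludes division by 0.\<close>
  moreover have "norm (P n z / complex_of_real (M (fst z) + 1)) \<le> 1" for n z
    using P[of n z] M0[of "fst z"] by (simp add: norm_divide divide_le_eq)
  ultimately obtain k where k: "strict_mono (k::nat\<Rightarrow>nat)"
    and conv: "\<And>z. z \<in> UNIV \<times> \<rat> \<Longrightarrow> \<exists>l. (\<lambda>i. P (k i) z / complex_of_real (M (fst z) + 1)) \<longlonglongrightarrow> l"
    by (rule function_convergent_subsequence[where f="\<lambda>n z. P n z / complex_of_real (M (fst z) + 1)" and M=1]) auto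
  have convQ: "Cauchy (\<lambda>i. P (k i) (R, y))" if yQ: "y \<in> \<rat>" for R y
  proof -
    obtain l where "(\<lambda>i. P (k i) (R, y) / complex_of_real (M R + 1)) \<longlonglongrightarrow> l" using conv[of "(R, y)"] yQ by auto
    then have "(\<lambda>i. complex_of_real (M R + 1) * (P (k i) (R, y) / complex_of_real (M R + 1))) \<longlonglongrightarrow> complex_of_real (M R + 1) * l"
      by (rule tendsto_mult_left)
    moreover have "complex_of_real (M R + 1) \<noteq> 0"
      using M0[of R] by (metis add_nonneg_pos of_real_eq_0_iff order_less_irrefl zero_less_one)
    ultimately have "(\<lambda>i. P (k i) (R, y)) \<longlonglongrightarrow> complex_of_real (M R + 1) * l" by simp
    then show ?thesis by (rule LIMSEQ_imp_Cauchy)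
  qed
  have "Cauchy (\<lambda>i. P (k i) (R, x))" for R x
  proof (rule metric_CauchyI)
    fix e :: real assume e: "e > 0"
    define L where "L = real R * M R + 1"
    have L: "L > 0" using M0[of R] by (simp add: L_def add_nonneg_pos)
    obtain y where y: "y \<in> \<rat>" "x - e / (3 * L) < y" "y < x + e / (3 * L)"
      using Rats_dense_in_real[of "x - e / (3 * L)" "x + e / (3 * L)"] e L by auto
    then have xy: "\<bar>x - y\<bar> < e / (3 * L)" by linarith
    have lip: "cmod (P n (R, x) - P n (R, y)) < e / 3" for n
    proof -
      have "cmod (P n (R, x) - P n (R, y)) \<le> real R * (LINT \<xi>|lborel. cmod (indicator {-real R..real R} \<xi> *\<^sub>R v n \<xi>)) * \<bar>x - y\<bar>"
        unfolding P_def fst_conv snd_conv by (rule band_Lipschitz[OF v]) simp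
      also have "\<dots> \<le> real R * M R * \<bar>x - y\<bar>"
        unfolding M_def by (intro mult_right_mono mult_left_mono L1_interval_bound v T) auto
      also have "\<dots> \<le> L * \<bar>x - y\<bar>" by (intro mult_right_mono) (auto simp: L_def)
      also have "\<dots> < L * (e / (3 * L))" using L xy by (intro mult_strict_left_mono)
      also have "\<dots> = e / 3" using L by simp
      finally show ?thesis .
    qed
    obtain N where N: "\<And>m n. m \<ge> N \<Longrightarrow> n \<ge> N \<Longrightarrow> dist (P (k m) (R, y)) (P (k n) (R, y)) < e / 3"
      using metric_CauchyD[OF convQ[OF y(1), of R], of "e/3"] e by auto
    have "dist (P (k m) (R, x)) (P (k n) (R, x)) < e" if "m \<ge> N" "n \<ge> N" for m n
    proof -
      have "dist (P (k m) (R, x)) (P (k n) (R, x)) \<le> dist (P (k m) (R, x)) (P (k m) (R, y))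
          + dist (P (k m) (R, y)) (P (k n) (R, y)) + dist (P (k n) (R, x)) (P (k n) (R, y))"
        by metric
      then show ?thesis using lip[of "k m"] lip[of "k n"] N[OF that] by (simp add: dist_norm)
    qed
    then show "\<exists>N. \<forall>m\<ge>N. \<forall>n\<ge>N. dist (P (k m) (R, x)) (P (k n) (R, x)) < e" by blast
  qed
  then have "convergent (\<lambda>i. band {- real R..real R} (v (k i)) x)" for R x
    unfolding P_def fst_conv snd_conv by (simp add: Cauchy_convergent_iff)
  with k that show thesis by blast
qed

section \<open>Mean convergence with an integrable weight\<close>

lemma integrable_inverse_one_plus_sq: "integrable lborel (\<lambda>x::real. inverse (1 + x\<^sup>2))"
  using integrable_inverse_1_plus_square by (simp add: set_integrable_def einterval_def)

lemma L2_inverse_one_plus_sq: "L2 (\<lambda>x::real. inverse (1 + x\<^sup>2))"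
proof -
  have "integrable lborel (\<lambda>x::real. (norm (inverse (1 + x\<^sup>2)))\<^sup>2)"
  proof (rule Bochner_Integration.integrable_bound[OF integrable_inverse_one_plus_sq])
    have "(inverse (1 + x\<^sup>2))\<^sup>2 \<le> inverse (1 + x\<^sup>2)" for x :: real
    proof -
      have "inverse (1 + x\<^sup>2) \<le> 1" by (simp add: inverse_le_1_iff)
      then show ?thesis using mult_left_mono[of "inverse (1 + x\<^sup>2)" 1 "inverse (1 + x\<^sup>2)"] by (simp add: power2_eq_square)
    qed
    then show "AE x::real in lborel. norm ((norm (inverse (1 + x\<^sup>2)))\<^sup>2) \<le> norm (inverse (1 + x\<^sup>2))" by simp
  qed measurable
  then show ?thesis by (simp add: L2_def)
qed

text \<open>Outside the interval the weight is at least \<open>R\<close>, so the mass at high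
  frequencies is small uniformly over a bounded family.\<close>

lemma nsq_outside:
  assumes v: "L2 v" and s: "1/2 \<le> s" and int: "sob_finite s v"
    and T: "(sob_nsq s v) \<le> T" and R: "0 < R"
  shows "nsq (\<lambda>\<xi>. v \<xi> - indicator {-R..R} \<xi> *\<^sub>R v \<xi>) \<le> T / R"
proof -
  have pw: "R \<le> (1 + \<xi>\<^sup>2) powr s" if "\<xi> \<notin> {-R..R}" for \<xi>
  proof -
    have "R \<le> \<bar>\<xi>\<bar>" using that by auto
    then have "R\<^sup>2 \<le> \<bar>\<xi>\<bar>\<^sup>2" using R by (intro power_mono) auto
    then have "R \<le> sqrt (1 + \<xi>\<^sup>2)" by (intro real_le_rsqrt) simp
    also have "\<dots> = (1 + \<xi>\<^sup>2) powr (1/2)" by (simp add: powr_half_sqrt)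
    also have "\<dots> \<le> (1 + \<xi>\<^sup>2) powr s" by (intro powr_mono s) simp
    finally show ?thesis .
  qed
  have "R * nsq (\<lambda>\<xi>. v \<xi> - indicator {-R..R} \<xi> *\<^sub>R v \<xi>) = (LINT \<xi>|lborel. R * (cmod (v \<xi> - indicator {-R..R} \<xi> *\<^sub>R v \<xi>))\<^sup>2)"
    unfolding nsq_def by (rule integral_mult_right_zero[symmetric])
  also have "\<dots> \<le> (sob_nsq s v)"
  proof (rule integral_mono')
    show "R * (cmod (v \<xi> - indicator {-R..R} \<xi> *\<^sub>R v \<xi>))\<^sup>2 \<le> (1 + \<xi>\<^sup>2) powr s * (cmod (v \<xi>))\<^sup>2" for \<xi>
      using mult_right_mono[OF pw[of \<xi>], of "(cmod (v \<xi>))\<^sup>2"] by (cases "\<xi> \<in> {-R..R}") auto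
  qed (auto intro: int)
  also note T
  finally show ?thesis using R by (simp add: field_simps)
qed

text \<open>The weight \<open>1 / (1 + x\<^sup>2)\<close> is both integrable and square-integrable, so it controls the bounded
  band-limited parts and the uniformly small high-frequency parts alike.\<close>
lemma weighted_L1_Cauchy:
  fixes P :: "nat \<Rightarrow> real \<Rightarrow> complex"
  assumes [measurable]: "\<And>n. P n \<in> borel_measurable borel" and M: "\<And>n x. cmod (P n x) \<le> M"
    and conv: "\<And>x. convergent (\<lambda>i. P i x)" and e: "e > 0"
  shows "\<exists>N. \<forall>m\<ge>N. \<forall>n\<ge>N. (LINT x|lborel. cmod (P m x - P n x) * inverse (1 + x\<^sup>2)) \<le> e"
proof -
  define U where "U x = lim (\<lambda>i. P i x)" for x
  have [measurable]: "U \<in> borel_measurable borel"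
    unfolding U_def[abs_def] by (rule borel_measurable_lim_metric) measurable
  have lim: "(\<lambda>i. P i x) \<longlonglongrightarrow> U x" for x using conv by (simp add: U_def convergent_LIMSEQ_iff)
  have U: "cmod (U x) \<le> M" for x
    by (rule LIMSEQ_le_const2[OF tendsto_norm[OF lim]]) (use M in auto)
  let ?h = "\<lambda>x::real. inverse (1 + x\<^sup>2)"
  have h0: "0 \<le> ?h x" for x by simp
  have PU: "cmod (P i x - U x) * ?h x \<le> 2 * M * ?h x" for i x
    using norm_triangle_ineq4[of "P i x" "U x"] M[of i x] U[of x] by (intro mult_right_mono h0) linarith
  have w: "integrable lborel (\<lambda>x. 2 * M * ?h x)"
    by (intro integrable_mult_right integrable_inverse_one_plus_sq)
  have i: "integrable lborel (\<lambda>x. cmod (P i x - U x) * ?h x)" for i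
  proof (rule Bochner_Integration.integrable_bound[OF w])
    have "norm (cmod (P i x - U x) * ?h x) \<le> norm (2 * M * ?h x)" for x
      using PU[of i x] abs_ge_self[of "2 * M * ?h x"] by (simp add: abs_mult)
    then show "AE x in lborel. norm (cmod (P i x - U x) * ?h x) \<le> norm (2 * M * ?h x)" by simp
  qed measurable
  have "(\<lambda>i. LINT x|lborel. cmod (P i x - U x) * ?h x) \<longlonglongrightarrow> (LINT x|(lborel::real measure). 0)"
  proof (rule Bochner_Integration.integral_dominated_convergence[OF _ _ w])
    have "(\<lambda>i. cmod (P i x - U x) * ?h x) \<longlonglongrightarrow> 0" for x
      using tendsto_mult_left_zero[OF tendsto_norm_zero[OF LIM_zero[OF lim[of x]]], of "?h x"] .
    then show "AE x in lborel. (\<lambda>i. cmod (P i x - U x) * ?h x) \<longlonglongrightarrow> 0" by simp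
    have "norm (cmod (P i x - U x) * ?h x) \<le> 2 * M * ?h x" for i x
      using PU[of i x] by (simp add: abs_mult)
    then show "AE x in lborel. norm (cmod (P i x - U x) * ?h x) \<le> 2 * M * ?h x" for i by simp
  qed measurable
  then have "\<forall>\<^sub>F i in sequentially. (LINT x|lborel. cmod (P i x - U x) * ?h x) < e / 2"
    by (rule order_tendstoD(2)) (use e in simp)
  then obtain N where N: "\<And>i. i \<ge> N \<Longrightarrow> (LINT x|lborel. cmod (P i x - U x) * ?h x) < e / 2"
    by (auto simp: eventually_sequentially)
  have "(LINT x|lborel. cmod (P m x - P n x) * ?h x) \<le> e" if mn: "m \<ge> N" "n \<ge> N" for m n
  proof -
    have "(LINT x|lborel. cmod (P m x - P n x) * ?h x) \<le> (LINT x|lborel. cmod (P m x - U x) * ?h x + cmod (P n x - U x) * ?h x)"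
    proof (rule integral_mono')
      show "integrable lborel (\<lambda>x. cmod (P m x - U x) * ?h x + cmod (P n x - U x) * ?h x)" using i by simp
      show "cmod (P m x - P n x) * ?h x \<le> cmod (P m x - U x) * ?h x + cmod (P n x - U x) * ?h x" for x
        unfolding distrib_right[symmetric] using norm_triangle_ineq4[of "P m x - U x" "P n x - U x"]
        by (intro mult_right_mono h0) simp
    qed simp
    also have "\<dots> = (LINT x|lborel. cmod (P m x - U x) * ?h x) + (LINT x|lborel. cmod (P n x - U x) * ?h x)"
      by (rule Bochner_Integration.integral_add[OF i i])
    finally show ?thesis using N[OF mn(1)] N[OF mn(2)] by linarith
  qed
  then show ?thesis by blast
qed

text \<open>A test function that is bounded and has bounded support is dominated by a multiple of
  the weight. A general \<open>g\<close> differs from such functions by an arbitrarily small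
  mean-square error, which Cauchy-Schwarz controls uniformly in \<open>n\<close>.\<close>

lemma weighted_L1_imp_weak:
  fixes f :: "nat \<Rightarrow> real \<Rightarrow> complex"
  assumes f: "\<And>n. L2 (f n)" and C: "\<And>n. nsq (f n) \<le> C" and g: "L2 g"
    and lim: "(\<lambda>n. LINT x|lborel. cmod (f n x) * inverse (1 + x\<^sup>2)) \<longlonglongrightarrow> 0"
  shows "(\<lambda>n. LINT x|lborel. f n x * g x) \<longlonglongrightarrow> 0"
proof (rule LIMSEQ_I)
  fix e :: real assume e: "e > 0"
  have [measurable]: "g \<in> borel_measurable borel" using g by (simp add: L2_def)
  have C0: "0 \<le> C" using order_trans[OF nsq_nonneg C] .
  let ?h = "\<lambda>x::real. inverse (1 + x\<^sup>2)"
  define G where "G M x = (if \<bar>x\<bar> \<le> real M \<and> cmod (g x) \<le> real M then g x else 0)" for M :: nat and x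
  have [measurable]: "G M \<in> borel_measurable borel" for M unfolding G_def[abs_def] by measurable
  have G2: "L2 (G M)" for M by (rule L2_dominated[OF g, of _ 1]) (auto simp: G_def)
  have "(\<lambda>M. nsq (\<lambda>x. g x - G M x)) \<longlonglongrightarrow> 0"
  proof (rule nsq_dominated_convergence[OF g])
    show "norm (g x - G M x) \<le> norm (g x)" for M x by (simp add: G_def)
    fix x
    obtain N :: nat where "max \<bar>x\<bar> (cmod (g x)) \<le> real N" using real_arch_simple by blast
    then have "g x - G M x = 0" if "M \<ge> N" for M using that by (simp add: G_def)
    then have "\<forall>\<^sub>F M in sequentially. g x - G M x = 0" unfolding eventually_sequentially by blast
    then show "(\<lambda>M. g x - G M x) \<longlonglongrightarrow> 0" by (rule tendsto_eventually)
  qed measurable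
  then have "(\<lambda>M. sqrt C * sqrt (nsq (\<lambda>x. g x - G M x))) \<longlonglongrightarrow> sqrt C * sqrt 0" by (intro tendsto_intros)
  then have "\<forall>\<^sub>F M in sequentially. sqrt C * sqrt (nsq (\<lambda>x. g x - G M x)) < e / 2"
    by (intro order_tendstoD(2)[where y="sqrt C * sqrt 0"]) (use e in auto)
  then obtain M where M: "sqrt C * sqrt (nsq (\<lambda>x. g x - G M x)) < e / 2"
    using eventually_happens trivial_limit_sequentially by blast
  \<comment> \<open>Where \<open>G M\<close> does not vanish, its modulus is at most
    \<open>M\<close> and the weight is at least \<open>1 / (1 + M\<^sup>2)\<close>.\<close>
  define K where "K = real M * (1 + (real M)\<^sup>2)"
  have GK: "cmod (G M x) \<le> K * ?h x" for x
  proof (cases "\<bar>x\<bar> \<le> real M \<and> cmod (g x) \<le> real M")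
    case True
    then have "x\<^sup>2 \<le> (real M)\<^sup>2" using power_mono[of "\<bar>x\<bar>" "real M" 2] by simp
    then have "real M * (1 + x\<^sup>2) \<le> K" unfolding K_def by (intro mult_left_mono) auto
    then have "real M * (1 + x\<^sup>2) * ?h x \<le> K * ?h x" by (intro mult_right_mono) auto
    moreover have "real M * (1 + x\<^sup>2) * ?h x = real M"
      using sum_power2_gt_zero_iff[of 1 x] by (simp add: mult.assoc)
    ultimately show ?thesis using True by (simp add: G_def)
  next
    case False
    then have "G M x = 0" by (auto simp: G_def)
    then show ?thesis by (simp add: K_def)
  qed
  have "(\<lambda>n. K * (LINT x|lborel. cmod (f n x) * ?h x)) \<longlonglongrightarrow> K * 0" by (intro tendsto_intros lim)
  then have "\<forall>\<^sub>F n in sequentially. K * (LINT x|lborel. cmod (f n x) * ?h x) < e / 2"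
    by (intro order_tendstoD(2)[where y="K * 0"]) (use e in auto)
  then obtain N where N: "\<And>n. n \<ge> N \<Longrightarrow> K * (LINT x|lborel. cmod (f n x) * ?h x) < e / 2"
    by (auto simp: eventually_sequentially)
  have "norm ((LINT x|lborel. f n x * g x) - 0) < e" if n: "n \<ge> N" for n
  proof -
    have "(LINT x|lborel. f n x * g x) = (LINT x|lborel. f n x * G M x) + (LINT x|lborel. f n x * (g x - G M x))"
      using L2_mult_integrable[OF f[of n] g] L2_mult_integrable[OF f[of n] G2[of M]]
      by (simp add: right_diff_distrib)
    also have "norm \<dots> \<le> norm (LINT x|lborel. f n x * G M x) + norm (LINT x|lborel. f n x * (g x - G M x))"
      by (rule norm_triangle_ineq)
    also have "norm (LINT x|lborel. f n x * G M x) \<le> K * (LINT x|lborel. cmod (f n x) * ?h x)"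
    proof -
      have "norm (LINT x|lborel. f n x * G M x) \<le> (LINT x|lborel. norm (f n x * G M x))" by (rule integral_norm_bound)
      also have "\<dots> \<le> (LINT x|lborel. K * (cmod (f n x) * ?h x))"
      proof (rule integral_mono')
        show "integrable lborel (\<lambda>x. K * (cmod (f n x) * ?h x))"
          using L2_norm_mult_integrable[OF f[of n] L2_inverse_one_plus_sq] by (intro integrable_mult_right) simp
        show "norm (f n x * G M x) \<le> K * (cmod (f n x) * ?h x)" for x
          using mult_left_mono[OF GK[of x] norm_ge_zero[of "f n x"]] by (simp add: norm_mult mult_ac)
      qed (simp add: K_def)
      finally show ?thesis by simp
    qed
    also have "norm (LINT x|lborel. f n x * (g x - G M x)) \<le> sqrt C * sqrt (nsq (\<lambda>x. g x - G M x))"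
    proof (rule order_trans[OF Cauchy_Schwarz_integral[OF f[of n] L2_diff[OF g G2[of M]]]])
      show "sqrt (nsq (f n)) * sqrt (nsq (\<lambda>x. g x - G M x)) \<le> sqrt C * sqrt (nsq (\<lambda>x. g x - G M x))"
        by (intro mult_right_mono real_sqrt_le_mono C) simp
    qed
    finally show ?thesis using N[OF n] M by simp
  qed
  then show "\<exists>N. \<forall>n\<ge>N. norm ((LINT x|lborel. f n x * g x) - 0) < e" by blast
qed

text \<open>The functions times the weight \<open>1 / (1 + x\<^sup>2)\<close> form a Cauchy sequence
  in the mean: low frequencies converge pointwise with a uniform bound, high ones are uniformly
  small. This single fact yields both convergence almost everywhere and weak convergence, the latter
  carried to the transforms by duality.\<close>

theorem Sobolev_local_compactness:
  fixes u :: "nat \<Rightarrow> real \<Rightarrow> real"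
  assumes F: "\<And>n. is_fourier (\<lambda>x. complex_of_real (u n x)) (v n)" and s: "1/2 \<le> s"
    and int: "\<And>n. sob_finite s (v n)"
    and T: "\<And>n. (sob_nsq s (v n)) \<le> T"
  obtains k u' v' where "strict_mono (k::nat\<Rightarrow>nat)" "is_fourier (\<lambda>x. complex_of_real (u' x)) v'"
    "AE x in lborel. (\<lambda>i. u (k i) x) \<longlonglongrightarrow> u' x"
    "\<And>g. L2 g \<Longrightarrow> (\<lambda>i. LINT \<xi>|lborel. v (k i) \<xi> * g \<xi>) \<longlonglongrightarrow> (LINT \<xi>|lborel. v' \<xi> * g \<xi>)"
proof -
  note D = is_fourierD[OF F]
  have u2: "L2 (u n)" for n using D(1)[of n] by simp
  have [measurable]: "u n \<in> borel_measurable borel" "v n \<in> borel_measurable borel" for n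
    using u2[of n] D(2)[of n] by (simp_all add: L2_def)
  have T0: "0 \<le> T" using order_trans[OF _ T] by (simp add: integral_nonneg_AE)
  have nv: "nsq (v n) \<le> T" for n
  proof -
    have "nsq (v n) \<le> (sob_nsq s (v n))"
      unfolding nsq_def
    proof (rule integral_mono'[OF int])
      fix \<xi> :: real
      have "1 \<le> (1 + \<xi>\<^sup>2) powr s" using s by (intro ge_one_powr_ge_zero) auto
      then show "(cmod (v n \<xi>))\<^sup>2 \<le> (1 + \<xi>\<^sup>2) powr s * (cmod (v n \<xi>))\<^sup>2"
        using mult_right_mono[of 1 "(1 + \<xi>\<^sup>2) powr s" "(cmod (v n \<xi>))\<^sup>2"] by simp
    qed simp
    then show ?thesis using T[of n] by simp
  qed
  have nu: "nsq (u n) \<le> T" for n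
  proof -
    have "nsq (\<lambda>x. complex_of_real (u n x)) = nsq (u n)" by (simp add: nsq_def)
    then have "2 * pi * nsq (u n) \<le> T" using nv[of n] is_fourier_Plancherel[OF F[of n]] by simp
    moreover have "1 * nsq (u n) \<le> 2 * pi * nsq (u n)" using pi_ge_two by (intro mult_right_mono) auto
    ultimately show ?thesis by simp
  qed
  let ?h = "\<lambda>x::real. inverse (1 + x\<^sup>2)"
  define H where "H = nsq ?h"
  obtain k1 where k1: "strict_mono (k1::nat\<Rightarrow>nat)"
    and conv: "\<And>R x. convergent (\<lambda>i. band {- real R..real R} (v (k1 i)) x)"
  proof (rule band_pointwise_convergent_subsequence[OF D(2) nv])
    fix k :: "nat \<Rightarrow> nat"
    assume "strict_mono k" "\<And>R x. convergent (\<lambda>i. band {- real R..real R} (v (k i)) x)"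
    then show thesis by (rule that)
  qed
  define f where "f i x = u (k1 i) x * ?h x" for i x
  have [measurable]: "f i \<in> borel_measurable borel" for i unfolding f_def[abs_def] by measurable
  have uh: "integrable lborel (\<lambda>x. g x * ?h x)" if "L2 g" for g :: "real \<Rightarrow> real"
    by (rule L2_mult_integrable[OF that L2_inverse_one_plus_sq])
  have cauchy: "\<exists>N. \<forall>m\<ge>N. \<forall>n\<ge>N. (\<integral>\<^sup>+x. ennreal ((norm (f m x - f n x))^1) \<partial>lborel) \<le> ennreal e" if e: "e > 0" for e
  proof -
    \<comment> \<open>Two high-frequency parts contribute at most \<open>4 * T / R\<close> to the
      squared norm; by Cauchy-Schwarz against the weight, \<open>4 * T / R * H\<close> must not
      exceed the square of \<open>e / 2\<close>.\<close>
    obtain R0 :: nat where R0: "16 * T * H / e\<^sup>2 \<le> real R0" using real_arch_simple by blast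
    define R where "R = Suc R0"
    have R: "real R > 0" "16 * T * H / e\<^sup>2 \<le> real R" using R0 by (simp_all add: R_def)
    let ?A = "{- real R..real R}"
    define P where "P i = band ?A (v (k1 i))" for i
    have PF: "is_fourier (P i) (\<lambda>\<xi>. indicator ?A \<xi> *\<^sub>R v (k1 i) \<xi>)" for i
      unfolding P_def by (rule band_is_fourier[OF D(2)]) (auto simp: emeasure_lborel_Icc_eq)
    have Pm[measurable]: "P i \<in> borel_measurable borel" for i using is_fourierD(1)[OF PF[of i]] by (simp add: L2_def)
    have "\<exists>N. \<forall>m\<ge>N. \<forall>n\<ge>N. (LINT x|lborel. cmod (P m x - P n x) * ?h x) \<le> e / 2"
    proof (rule weighted_L1_Cauchy)
      show "cmod (P n x) \<le> sqrt (2 * real R) * sqrt T" for n x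
        unfolding P_def by (rule band_interval_bound[OF D(2) _ nv]) simp
      show "convergent (\<lambda>i. P i x)" for x unfolding P_def by (rule conv)
    qed (use e in auto)
    then obtain N where N: "\<And>m n. m \<ge> N \<Longrightarrow> n \<ge> N \<Longrightarrow> (LINT x|lborel. cmod (P m x - P n x) * ?h x) \<le> e / 2" by blast
    have "(\<integral>\<^sup>+x. ennreal ((norm (f m x - f n x))^1) \<partial>lborel) \<le> ennreal e" if mn: "m \<ge> N" "n \<ge> N" for m n
    proof -
      let ?u = "\<lambda>i x. complex_of_real (u (k1 i) x)"
      let ?d = "\<lambda>x. (?u m x - P m x) - (?u n x - P n x)"
      note F1 = is_fourier_diff[OF F[of "k1 m"] PF[of m]] and F2 = is_fourier_diff[OF F[of "k1 n"] PF[of n]]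
      have dF: "is_fourier ?d (\<lambda>\<xi>. (v (k1 m) \<xi> - indicator ?A \<xi> *\<^sub>R v (k1 m) \<xi>) - (v (k1 n) \<xi> - indicator ?A \<xi> *\<^sub>R v (k1 n) \<xi>))"
        by (rule is_fourier_diff[OF F1 F2])
      note d2 = is_fourierD(1)[OF dF]
      have "nsq ?d \<le> 2 * pi * nsq ?d"
        using mult_right_mono[of 1 "2 * pi" "nsq ?d"] pi_ge_two by simp
      also have "\<dots> \<le> 2 * (T / R) + 2 * (T / R)"
        unfolding is_fourier_Plancherel[OF dF, symmetric]
        by (rule order_trans[OF nsq_diff_le[OF is_fourierD(2)[OF F1] is_fourierD(2)[OF F2]]])
          (intro add_mono mult_left_mono nsq_outside[OF D(2) s int T R(1)]; simp)
      finally have "nsq ?d \<le> 4 * T / R" by simp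
      then have "nsq ?d * H \<le> 4 * T / R * H" by (rule mult_right_mono) (simp add: H_def)
      also have "\<dots> \<le> (e / 2)\<^sup>2" using R e by (simp add: field_simps power2_eq_square)
      finally have "sqrt (nsq ?d * H) \<le> e / 2" using e by (intro real_le_lsqrt) (auto simp: H_def)
      then have dH: "(LINT x|lborel. norm (?d x) * norm (?h x)) \<le> e / 2"
        using Cauchy_Schwarz_nsq[OF d2 L2_inverse_one_plus_sq] by (simp add: real_sqrt_mult H_def)
      have iP: "integrable lborel (\<lambda>x. cmod (P m x - P n x) * ?h x)"
        using L2_norm_mult_integrable[OF L2_diff[OF is_fourierD(1)[OF PF[of m]] is_fourierD(1)[OF PF[of n]]] L2_inverse_one_plus_sq] by simp
      have id: "integrable lborel (\<lambda>x. norm (?d x) * ?h x)"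
        using L2_norm_mult_integrable[OF d2 L2_inverse_one_plus_sq] by simp
      have iu: "integrable lborel (\<lambda>x. norm (f m x - f n x))"
        unfolding f_def by (intro integrable_norm Bochner_Integration.integrable_diff uh u2)
      have "(LINT x|lborel. norm (f m x - f n x)) \<le> (LINT x|lborel. cmod (P m x - P n x) * ?h x + norm (?d x) * ?h x)"
      proof (rule integral_mono[OF iu Bochner_Integration.integrable_add[OF iP id]])
        fix x
        have "norm (f m x - f n x) = \<bar>u (k1 m) x - u (k1 n) x\<bar> * ?h x"
          unfolding f_def left_diff_distrib[symmetric] by (simp add: abs_mult)
        also have "\<dots> = cmod (?u m x - ?u n x) * ?h x" by (simp only: of_real_diff[symmetric] norm_of_real)
        also have "\<dots> = cmod ((P m x - P n x) + ?d x) * ?h x" by (simp add: algebra_simps)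
        also have "\<dots> \<le> (cmod (P m x - P n x) + cmod (?d x)) * ?h x"
          by (intro mult_right_mono norm_triangle_ineq) simp
        finally show "norm (f m x - f n x) \<le> cmod (P m x - P n x) * ?h x + norm (?d x) * ?h x" by (simp only: distrib_right)
      qed
      also have "\<dots> = (LINT x|lborel. cmod (P m x - P n x) * ?h x) + (LINT x|lborel. norm (?d x) * ?h x)"
        by (rule Bochner_Integration.integral_add[OF iP id])
      also have "\<dots> \<le> e / 2 + e / 2" using dH by (intro add_mono N mn) simp
      finally have "(LINT x|lborel. norm (f m x - f n x)) \<le> e" by simp
      then show ?thesis using nn_integral_eq_integral[OF iu] by (simp add: ennreal_leI)
    qed
    then show ?thesis by blast
  qed
  obtain r where r: "strict_mono (r::nat\<Rightarrow>nat)" and fconv: "AE x in lborel. convergent (\<lambda>i. f (r i) x)"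
    using Cauchy_power_mean_convergent_subsequence[of 1 f lborel] cauchy by auto
  define k where "k = k1 \<circ> r"
  have k: "strict_mono k" unfolding k_def by (rule strict_mono_o[OF k1 r])
  define u' where "u' x = lim (\<lambda>i. u (k i) x)" for x
  have [measurable]: "u' \<in> borel_measurable borel"
    unfolding u'_def[abs_def] by (rule borel_measurable_lim_metric) measurable
  \<comment> \<open>The weight vanishes nowhere, so it can be divided out pointwise.\<close>
  have ulim: "AE x in lborel. (\<lambda>i. u (k i) x) \<longlonglongrightarrow> u' x"
    using fconv
  proof eventually_elim
    case (elim x)
    have "f (r i) x * (1 + x\<^sup>2) = u (k i) x" for i
      using sum_power2_gt_zero_iff[of 1 x] by (simp add: f_def k_def mult.assoc)
    moreover have "convergent (\<lambda>i. f (r i) x * (1 + x\<^sup>2))" by (intro convergent_mult elim convergent_const)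
    ultimately show ?case by (simp add: u'_def convergent_LIMSEQ_iff)
  qed
  have "(\<integral>\<^sup>+x. ennreal ((norm (0 - u' x))^2) \<partial>lborel) \<le> ennreal T"
  proof (rule lim_power_mean_bound[OF _ _ ulim])
    have "(\<integral>\<^sup>+x. ennreal ((norm (0 - u (k i) x))^2) \<partial>lborel) \<le> ennreal T" for i
      using nsq_nn_integral[OF u2[of "k i"]] nu[of "k i"] by (simp add: ennreal_leI)
    then show "\<forall>\<^sub>F i in sequentially. (\<integral>\<^sup>+x. ennreal ((norm (0 - u (k i) x))^2) \<partial>lborel) \<le> ennreal T" by simp
  qed measurable
  then have u'2: "L2 u'" and nu': "nsq u' \<le> T" using L2_bound[of u' T] T0 by simp_all
  have L1: "(\<lambda>i. LINT x|lborel. cmod (complex_of_real (u (k i) x) - complex_of_real (u' x)) * ?h x) \<longlonglongrightarrow> 0"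
  proof (rule LIMSEQ_I)
    fix e :: real assume e: "e > 0"
    obtain N where N: "\<And>m n. m \<ge> N \<Longrightarrow> n \<ge> N \<Longrightarrow> (\<integral>\<^sup>+x. ennreal ((norm (f m x - f n x))^1) \<partial>lborel) \<le> ennreal (e / 2)"
      using cauchy[of "e/2"] e by auto
    have rN: "r i \<ge> N" if "i \<ge> N" for i using seq_suble[OF r, of i] that by simp
    have flim: "AE x in lborel. (\<lambda>i. f (r i) x) \<longlonglongrightarrow> u' x * ?h x"
      using ulim by eventually_elim (auto simp: f_def k_def intro!: tendsto_mult)
    have "norm ((LINT x|lborel. cmod (complex_of_real (u (k i) x) - complex_of_real (u' x)) * ?h x) - 0) < e" if i: "i \<ge> N" for i
    proof -
      have "(\<integral>\<^sup>+x. ennreal ((norm (f (r i) x - u' x * ?h x))^1) \<partial>lborel) \<le> ennreal (e / 2)"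
      proof (rule lim_power_mean_bound[OF _ _ flim])
        show "\<forall>\<^sub>F j in sequentially. (\<integral>\<^sup>+x. ennreal ((norm (f (r i) x - f (r j) x))^1) \<partial>lborel) \<le> ennreal (e / 2)"
          unfolding eventually_sequentially using N[OF rN[OF i] rN] by blast
      qed measurable
      moreover have "integrable lborel (\<lambda>x. norm (f (r i) x - u' x * ?h x))"
        unfolding f_def by (intro integrable_norm Bochner_Integration.integrable_diff uh u2 u'2)
      ultimately have "(LINT x|lborel. norm (f (r i) x - u' x * ?h x)) \<le> e / 2"
        using nn_integral_eq_integral[of lborel "\<lambda>x. norm (f (r i) x - u' x * ?h x)"] e by simp
      moreover have "norm (f (r i) x - u' x * ?h x) = cmod (complex_of_real (u (k i) x) - complex_of_real (u' x)) * ?h x" for x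
        unfolding f_def left_diff_distrib[symmetric] of_real_diff[symmetric] norm_of_real by (simp add: k_def abs_mult)
      ultimately show ?thesis using e by (simp add: integral_nonneg_AE)
    qed
    then show "\<exists>N. \<forall>i\<ge>N. norm ((LINT x|lborel. cmod (complex_of_real (u (k i) x) - complex_of_real (u' x)) * ?h x) - 0) < e" by blast
  qed
  obtain v' where v': "is_fourier (\<lambda>x. complex_of_real (u' x)) v'" using fourier_exists[of "\<lambda>x. complex_of_real (u' x)"] u'2 by auto
  \<comment> \<open>Pairing the transforms with \<open>g\<close> is pairing the functions with the
    transform \<open>G\<close> of \<open>g\<close>, where convergence in the weighted mean
    applies.\<close>
  have weak: "(\<lambda>i. LINT \<xi>|lborel. v (k i) \<xi> * g \<xi>) \<longlonglongrightarrow> (LINT \<xi>|lborel. v' \<xi> * g \<xi>)" if g: "L2 g" for g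
  proof -
    obtain G where G: "is_fourier g G" using fourier_exists[OF g] by blast
    note G2 = is_fourierD(2)[OF G]
    have d2: "L2 (\<lambda>x. complex_of_real (u (k i) x) - complex_of_real (u' x))" for i
      by (intro L2_diff) (simp_all add: u2 u'2)
    have "(\<lambda>i. LINT x|lborel. (complex_of_real (u (k i) x) - complex_of_real (u' x)) * G x) \<longlonglongrightarrow> 0"
    proof (rule weighted_L1_imp_weak[OF d2 _ G2 L1])
      show "nsq (\<lambda>x. complex_of_real (u (k i) x) - complex_of_real (u' x)) \<le> 2 * T + 2 * T" for i
      proof -
        have "nsq (\<lambda>x. u (k i) x - u' x) \<le> 2 * T + 2 * T"
          by (rule order_trans[OF nsq_diff_le[OF u2 u'2]]) (intro add_mono mult_left_mono nu nu'; simp)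
        then show ?thesis by (simp add: nsq_def flip: of_real_diff)
      qed
    qed
    moreover have "(LINT x|lborel. (complex_of_real (u (k i) x) - complex_of_real (u' x)) * G x)
      = (LINT \<xi>|lborel. v (k i) \<xi> * g \<xi>) - (LINT \<xi>|lborel. v' \<xi> * g \<xi>)" for i
      unfolding is_fourier_multiplication_formula[OF F G] is_fourier_multiplication_formula[OF v' G] left_diff_distrib
      by (intro Bochner_Integration.integral_diff L2_mult_integrable G2 is_fourierD(1)[OF F] is_fourierD(1)[OF v'])
    ultimately show ?thesis by (simp add: LIM_zero_iff)
  qed
  show thesis by (rule that[OF k v' ulim weak])
qed

subsection \<open>Weak limits and non-vanishing\<close>

text \<open>Multiplying by the square root of \<open>W\<close> turns the claim into the expansion of
  an ordinary square. As \<open>W\<close> may be unbounded, the weighted limit is a legitimate test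
  function only after truncation in frequency. The second conclusion compares energies along the
  sequence, because convergence of the energies is not among the assumptions.\<close>

lemma weak_limit_weighted:
  fixes v :: "nat \<Rightarrow> real \<Rightarrow> complex"
  assumes [measurable]: "W \<in> borel_measurable borel" and W0: "\<And>\<xi>. 0 \<le> W \<xi>"
    and Wb: "\<And>R \<xi>. \<bar>\<xi>\<bar> \<le> real R \<Longrightarrow> W \<xi> \<le> K R"
    and v: "\<And>n. L2 (v n)" and v': "L2 v'"
    and weak: "\<And>g. L2 g \<Longrightarrow> (\<lambda>n. LINT \<xi>|lborel. v n \<xi> * g \<xi>) \<longlonglongrightarrow> (LINT \<xi>|lborel. v' \<xi> * g \<xi>)"
    and int: "\<And>n. integrable lborel (\<lambda>\<xi>. W \<xi> * (cmod (v n \<xi>))\<^sup>2)"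
    and T: "\<And>n. (LINT \<xi>|lborel. W \<xi> * (cmod (v n \<xi>))\<^sup>2) \<le> T"
  shows "integrable lborel (\<lambda>\<xi>. W \<xi> * (cmod (v' \<xi>))\<^sup>2)"
    and "(\<lambda>n. (LINT \<xi>|lborel. W \<xi> * (cmod (v n \<xi> - v' \<xi>))\<^sup>2) - (LINT \<xi>|lborel. W \<xi> * (cmod (v n \<xi>))\<^sup>2))
      \<longlonglongrightarrow> - (LINT \<xi>|lborel. W \<xi> * (cmod (v' \<xi>))\<^sup>2)"
proof -
  have [measurable]: "v n \<in> borel_measurable borel" "v' \<in> borel_measurable borel" for n
    using v[of n] v' by (simp_all add: L2_def)
  have T0: "0 \<le> T" using order_trans[OF _ T] W0 by (simp add: integral_nonneg_AE)
  define w where "w \<xi> = complex_of_real (sqrt (W \<xi>))" for \<xi>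
  have [measurable]: "w \<in> borel_measurable borel" unfolding w_def[abs_def] by measurable
  have sq: "(cmod (w \<xi> * z))\<^sup>2 = W \<xi> * (cmod z)\<^sup>2" for \<xi> z
    using W0 by (simp add: w_def norm_mult power_mult_distrib)
  define x where "x n \<xi> = w \<xi> * v n \<xi>" for n \<xi>
  define x' where "x' \<xi> = w \<xi> * v' \<xi>" for \<xi>
  have [measurable]: "x' \<in> borel_measurable borel" unfolding x'_def[abs_def] by measurable
  have [measurable]: "x n \<in> borel_measurable borel" for n unfolding x_def[abs_def] by measurable
  have x2: "L2 (x n)" for n unfolding x_def L2_def sq using int by simp
  have nx: "nsq (x n) = (LINT \<xi>|lborel. W \<xi> * (cmod (v n \<xi>))\<^sup>2)" for n unfolding nsq_def x_def sq ..
  then have nxT: "nsq (x n) \<le> T" for n using T by simp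
  \<comment> \<open>On a bounded frequency interval \<open>W\<close> is bounded, so both
    \<open>y R\<close> and its product with the root of \<open>W\<close> are
    square-integrable.\<close>
  define y where "y R \<xi> = indicator {- real R..real R} \<xi> *\<^sub>R x' \<xi>" for R :: nat and \<xi>
  have [measurable]: "y R \<in> borel_measurable borel" for R unfolding y_def[abs_def] by measurable
  have K0: "0 \<le> K R" for R using order_trans[OF W0 Wb[of 0 R]] by simp
  have y2: "L2 (y R)" for R
  proof (rule L2_dominated[OF v'])
    show "norm (y R \<xi>) \<le> sqrt (K R) * norm (v' \<xi>)" for \<xi>
    proof (cases "\<xi> \<in> {- real R..real R}")
      case True
      then have "sqrt (W \<xi>) \<le> sqrt (K R)" by (intro real_sqrt_le_mono Wb) auto
      then show ?thesis using True W0[of \<xi>] by (simp add: y_def x'_def w_def norm_mult mult_right_mono)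
    qed (use K0 in \<open>simp add: y_def\<close>)
  qed measurable
  have ylim: "(\<lambda>n. LINT \<xi>|lborel. x n \<xi> * cnj (y R \<xi>)) \<longlonglongrightarrow> complex_of_real (nsq (y R))" for R
  proof -
    define g where "g \<xi> = w \<xi> * cnj (y R \<xi>)" for \<xi>
    have g2: "L2 g"
    proof (rule L2_dominated[OF y2])
      show "norm (g \<xi>) \<le> sqrt (K R) * norm (y R \<xi>)" for \<xi>
      proof (cases "\<xi> \<in> {- real R..real R}")
        case True
        then have "sqrt (W \<xi>) \<le> sqrt (K R)" by (intro real_sqrt_le_mono Wb) auto
        then show ?thesis using W0[of \<xi>] by (simp add: g_def w_def norm_mult mult_right_mono)
      qed (simp add: g_def y_def)
      show "g \<in> borel_measurable borel" unfolding g_def[abs_def] by measurable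
    qed
    have "v n \<xi> * g \<xi> = x n \<xi> * cnj (y R \<xi>)" for n \<xi> by (simp add: g_def x_def mult_ac)
    moreover have "v' \<xi> * g \<xi> = complex_of_real ((cmod (y R \<xi>))\<^sup>2)" for \<xi>
    proof -
      have "v' \<xi> * g \<xi> = x' \<xi> * cnj (y R \<xi>)" by (simp add: g_def x'_def mult_ac)
      also have "\<dots> = y R \<xi> * cnj (y R \<xi>)" by (simp add: y_def indicator_def)
      finally show ?thesis by (simp only: complex_norm_square)
    qed
    ultimately show ?thesis using weak[OF g2] by (simp only: integral_complex_of_real nsq_def)
  qed
  \<comment> \<open>Testing with \<open>y R\<close> itself gives
    \<open>nsq (y R) \<le> sqrt T * sqrt (nsq (y R))\<close>; one factor cancels, and the bound is
    independent of \<open>R\<close>.\<close>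
  have nyT: "nsq (y R) \<le> T" for R
  proof -
    have "cmod (complex_of_real (nsq (y R))) \<le> sqrt T * sqrt (nsq (y R))"
    proof (rule LIMSEQ_le_const2[OF tendsto_norm[OF ylim]], intro exI allI impI)
      fix n
      have "norm (LINT \<xi>|lborel. x n \<xi> * cnj (y R \<xi>)) \<le> sqrt (nsq (x n)) * sqrt (nsq (\<lambda>\<xi>. cnj (y R \<xi>)))"
        by (rule Cauchy_Schwarz_integral[OF x2]) (simp add: y2)
      also have "nsq (\<lambda>\<xi>. cnj (y R \<xi>)) = nsq (y R)" by (simp add: nsq_def)
      also have "sqrt (nsq (x n)) * sqrt (nsq (y R)) \<le> sqrt T * sqrt (nsq (y R))"
        by (intro mult_right_mono real_sqrt_le_mono nxT) simp
      finally show "norm (LINT \<xi>|lborel. x n \<xi> * cnj (y R \<xi>)) \<le> sqrt T * sqrt (nsq (y R))" .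
    qed
    then have le: "sqrt (nsq (y R)) * sqrt (nsq (y R)) \<le> sqrt T * sqrt (nsq (y R))" by simp
    show ?thesis
    proof (cases "nsq (y R) = 0")
      case False
      with nsq_nonneg[of "y R"] have "0 < nsq (y R)" by linarith
      then have "0 < sqrt (nsq (y R))" by simp
      with le have "sqrt (nsq (y R)) \<le> sqrt T" by (simp only: mult_le_cancel_right_pos)
      then show ?thesis by simp
    qed (use T0 in simp)
  qed
  have ev: "\<forall>\<^sub>F R in sequentially. y R \<xi> = x' \<xi>" for \<xi>
  proof -
    obtain N :: nat where "\<bar>\<xi>\<bar> \<le> real N" using real_arch_simple by blast
    then have "y R \<xi> = x' \<xi>" if "R \<ge> N" for R using that by (auto simp: y_def indicator_def)
    then show ?thesis unfolding eventually_sequentially by blast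
  qed
  have "(\<integral>\<^sup>+\<xi>. ennreal ((norm (x' \<xi>))\<^sup>2) \<partial>lborel) \<le> ennreal T"
  proof (rule Fatou_bound)
    have "(\<lambda>R. ennreal ((norm (y R \<xi>))\<^sup>2)) \<longlonglongrightarrow> ennreal ((norm (x' \<xi>))\<^sup>2)" for \<xi>
      using ev[of \<xi>] by (intro tendsto_eventually) (auto elim!: eventually_mono)
    then show "AE \<xi> in lborel. (\<lambda>R. ennreal ((norm (y R \<xi>))\<^sup>2)) \<longlonglongrightarrow> ennreal ((norm (x' \<xi>))\<^sup>2)" by simp
    show "(\<integral>\<^sup>+\<xi>. ennreal ((norm (y R \<xi>))\<^sup>2) \<partial>lborel) \<le> ennreal T" for R
      unfolding nsq_nn_integral[OF y2] by (rule ennreal_leI[OF nyT])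
  qed measurable
  then have x'2: "L2 x'" using L2_bound(1)[of x' T] T0 by simp
  then show "integrable lborel (\<lambda>\<xi>. W \<xi> * (cmod (v' \<xi>))\<^sup>2)" unfolding x'_def L2_def sq by simp
  \<comment> \<open>The three thirds of \<open>e\<close> pay for replacing \<open>x'\<close> by
    \<open>y R\<close> in the pairing, for the weak limit with \<open>R\<close> fixed, and for
    returning to \<open>x'\<close> in the norm.\<close>
  have xlim: "(\<lambda>n. LINT \<xi>|lborel. x n \<xi> * cnj (x' \<xi>)) \<longlonglongrightarrow> complex_of_real (nsq x')"
  proof (rule LIMSEQ_I)
    fix e :: real assume e: "e > 0"
    have yx: "(\<lambda>R. nsq (\<lambda>\<xi>. y R \<xi> - x' \<xi>)) \<longlonglongrightarrow> 0"
    proof (rule nsq_dominated_convergence[OF x'2])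
      show "norm (y R \<xi> - x' \<xi>) \<le> norm (x' \<xi>)" for R \<xi> by (simp add: y_def indicator_def)
      show "(\<lambda>R. y R \<xi> - x' \<xi>) \<longlonglongrightarrow> 0" for \<xi>
        using ev[of \<xi>] by (intro tendsto_eventually) (auto elim!: eventually_mono)
    qed measurable
    have "(\<lambda>R. sqrt T * sqrt (nsq (\<lambda>\<xi>. y R \<xi> - x' \<xi>))) \<longlonglongrightarrow> sqrt T * sqrt 0" by (intro tendsto_intros yx)
    then have "\<forall>\<^sub>F R in sequentially. sqrt T * sqrt (nsq (\<lambda>\<xi>. y R \<xi> - x' \<xi>)) < e / 3"
      by (intro order_tendstoD(2)[where y="sqrt T * sqrt 0"]) (use e in auto)
    moreover have "\<forall>\<^sub>F R in sequentially. dist (nsq (y R)) (nsq x') < e / 3"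
      using nsq_tendsto[OF y2 x'2 yx] e by (intro tendstoD) auto
    ultimately have "\<forall>\<^sub>F R in sequentially. sqrt T * sqrt (nsq (\<lambda>\<xi>. y R \<xi> - x' \<xi>)) < e / 3 \<and> dist (nsq (y R)) (nsq x') < e / 3"
      by (rule eventually_conj)
    then obtain R where R: "sqrt T * sqrt (nsq (\<lambda>\<xi>. y R \<xi> - x' \<xi>)) < e / 3" "dist (nsq (y R)) (nsq x') < e / 3"
      using eventually_happens trivial_limit_sequentially by blast
    obtain N where N: "\<And>n. n \<ge> N \<Longrightarrow> norm ((LINT \<xi>|lborel. x n \<xi> * cnj (y R \<xi>)) - complex_of_real (nsq (y R))) < e / 3"
      using LIMSEQ_D[OF ylim[of R], of "e/3"] e by auto
    have "norm ((LINT \<xi>|lborel. x n \<xi> * cnj (x' \<xi>)) - complex_of_real (nsq x')) < e" if n: "n \<ge> N" for n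
    proof -
      let ?I = "LINT \<xi>|lborel. x n \<xi> * cnj (x' \<xi>)" and ?J = "LINT \<xi>|lborel. x n \<xi> * cnj (y R \<xi>)"
      have c2: "L2 (\<lambda>\<xi>. cnj (x' \<xi>))" "L2 (\<lambda>\<xi>. cnj (y R \<xi>))" using x'2 y2 by simp_all
      have "?J - ?I = (LINT \<xi>|lborel. x n \<xi> * (cnj (y R \<xi>) - cnj (x' \<xi>)))"
        using L2_mult_integrable[OF x2[of n] c2(1)] L2_mult_integrable[OF x2[of n] c2(2)]
        by (simp add: right_diff_distrib)
      also have "norm \<dots> \<le> sqrt (nsq (x n)) * sqrt (nsq (\<lambda>\<xi>. cnj (y R \<xi>) - cnj (x' \<xi>)))"
        by (rule Cauchy_Schwarz_integral[OF x2 L2_diff[OF c2(2,1)]])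
      also have "nsq (\<lambda>\<xi>. cnj (y R \<xi>) - cnj (x' \<xi>)) = nsq (\<lambda>\<xi>. y R \<xi> - x' \<xi>)"
        by (simp add: nsq_def flip: complex_cnj_diff)
      also have "sqrt (nsq (x n)) * sqrt (nsq (\<lambda>\<xi>. y R \<xi> - x' \<xi>)) \<le> sqrt T * sqrt (nsq (\<lambda>\<xi>. y R \<xi> - x' \<xi>))"
        by (intro mult_right_mono real_sqrt_le_mono nxT) simp
      finally have a: "norm (?J - ?I) < e / 3" using R(1) by simp
      have b: "norm (complex_of_real (nsq (y R)) - complex_of_real (nsq x')) < e / 3"
        using R(2) by (simp only: of_real_diff[symmetric] norm_of_real dist_real_def)
      have "norm (?I - complex_of_real (nsq x')) \<le> norm (?J - complex_of_real (nsq (y R))) + norm (?J - ?I)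
          + norm (complex_of_real (nsq (y R)) - complex_of_real (nsq x'))"
      proof -
        have "norm (i - c) \<le> norm (j - d) + norm (j - i) + norm (d - c)" for i j c d :: complex
          by norm
        then show ?thesis .
      qed
      with N[OF n] a b show ?thesis by linarith
    qed
    then show "\<exists>N. \<forall>n\<ge>N. norm ((LINT \<xi>|lborel. x n \<xi> * cnj (x' \<xi>)) - complex_of_real (nsq x')) < e" by blast
  qed
  have "nsq (\<lambda>\<xi>. x n \<xi> - x' \<xi>) - nsq (x n) = nsq x' - 2 * Re (LINT \<xi>|lborel. x n \<xi> * cnj (x' \<xi>))" for n
    using nsq_diff_expand[OF x2[of n] x'2] by simp
  moreover have "(\<lambda>n. nsq x' - 2 * Re (LINT \<xi>|lborel. x n \<xi> * cnj (x' \<xi>))) \<longlonglongrightarrow> nsq x' - 2 * Re (complex_of_real (nsq x'))"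
    by (intro tendsto_intros xlim)
  ultimately have "(\<lambda>n. nsq (\<lambda>\<xi>. x n \<xi> - x' \<xi>) - nsq (x n)) \<longlonglongrightarrow> - nsq x'" by simp
  moreover have "nsq (\<lambda>\<xi>. x n \<xi> - x' \<xi>) = (LINT \<xi>|lborel. W \<xi> * (cmod (v n \<xi> - v' \<xi>))\<^sup>2)" for n
    unfolding nsq_def x_def x'_def right_diff_distrib[symmetric] sq ..
  moreover have "nsq x' = (LINT \<xi>|lborel. W \<xi> * (cmod (v' \<xi>))\<^sup>2)" unfolding nsq_def x'_def sq ..
  ultimately show "(\<lambda>n. (LINT \<xi>|lborel. W \<xi> * (cmod (v n \<xi> - v' \<xi>))\<^sup>2) - (LINT \<xi>|lborel. W \<xi> * (cmod (v n \<xi>))\<^sup>2))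
      \<longlonglongrightarrow> - (LINT \<xi>|lborel. W \<xi> * (cmod (v' \<xi>))\<^sup>2)" by (simp only: nx)
qed

section \<open>From the dyadic estimate to the Sobolev inequality and non-vanishing\<close>

lemma ex_dyadic_ratio:
  fixes q :: real
  assumes q: "2 < q"
  obtains t where "0 < t" "t < 1" "(1 - t) powr (1 - q) = 3/2"
\<comment> \<open>Any ratio strictly between 1 and 2 would serve: above 1 so that \<open>t\<close>
  is positive, below 2 so that the decay of the mass wins.\<close>
proof (rule that[of "1 - (3/2) powr (1 / (1 - q))"])
  have "(3/2::real) powr (1 / (1 - q)) < (3/2) powr 0" using q by (intro powr_less_mono) (auto simp: divide_less_0_iff)
  then show "0 < 1 - (3/2::real) powr (1 / (1 - q))" by simp
  show "(1 - (1 - (3/2::real) powr (1 / (1 - q)))) powr (1 - q) = 3/2" using q by (simp add: powr_powr)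
qed simp

text \<open>All blocks receive the same bound \<open>sqrt T\<close>, which leaves a geometric series
  of ratio \<open>3/4\<close>; its sum is the 4 in the constant.\<close>

lemma Sobolev_inequality:
  fixes q :: real
  assumes q: "2 < q" and s: "1/2 \<le> s"
  obtains C where "0 < C" "\<And>u v T. is_fourier u v \<Longrightarrow> sob_finite s v \<Longrightarrow>
      (sob_nsq s v) \<le> T \<Longrightarrow>
      (\<integral>\<^sup>+x. ennreal (cmod (u x) powr q) \<partial>lborel) \<le> ennreal (C * T powr (q / 2))"
proof -
  obtain t where t: "0 < t" "t < 1" "(1 - t) powr (1 - q) = 3/2" using ex_dyadic_ratio[OF q] .
  define C where "C = t powr (1 - q) * 4"
  have "(\<integral>\<^sup>+x. ennreal (cmod (u x) powr q) \<partial>lborel) \<le> ennreal (C * T powr (q / 2))"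
    if F: "is_fourier u v" and int: "sob_finite s v"
      and T: "(sob_nsq s v) \<le> T" for u v T
  proof -
    have T0: "0 \<le> T" using order_trans[OF _ T] by (simp add: integral_nonneg_AE)
    have "(\<integral>\<^sup>+x. ennreal (cmod (u x) powr q) \<partial>lborel)
        \<le> ennreal (t powr (1 - q) * T * (\<Sum>j. (3/4) ^ j * sqrt T powr (q - 2)))"
      by (rule dyadic_Lq_bound[OF F s int T _ order_refl q t]) (rule band_dyadic_bound[OF is_fourierD(2)[OF F] s int T])
    also have "(\<Sum>j. (3/4::real) ^ j * sqrt T powr (q - 2)) = 4 * sqrt T powr (q - 2)"
      using suminf_geometric[of "3/4::real"] by (simp add: suminf_mult2[symmetric] summable_geometric)
    also have "t powr (1 - q) * T * (4 * sqrt T powr (q - 2)) = C * T powr (q / 2)"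
    proof (cases "T = 0")
      case False
      then have Tp: "0 < T" using T0 by simp
      have "sqrt T powr (q - 2) = T powr ((q - 2) / 2)"
        by (simp add: powr_half_sqrt[symmetric] powr_powr T0)
      then have "T * sqrt T powr (q - 2) = T powr (1 + (q - 2) / 2)" using Tp by (simp add: powr_add)
      also have "1 + (q - 2) / 2 = q / 2" by (simp add: field_simps)
      finally show ?thesis by (simp add: C_def)
    qed (use q in simp)
    finally show ?thesis .
  qed
  moreover have "0 < C" using t by (simp add: C_def)
  ultimately show thesis using that by blast
qed

text \<open>If all blocks below \<open>J\<close> were at most \<open>\<eta>\<close>, they would
  contribute at most \<open>1/4\<close> to the bound for the norm, and the remaining blocks less
  than \<open>1/2\<close>, so the integral could not be 1. Both \<open>J\<close> and
  \<open>\<eta>\<close> depend only on \<open>q\<close>, \<open>s\<close> and \<open>T\<close>,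
  hence serve a whole minimizing sequence.\<close>

lemma nonvanishing:
  fixes q :: real
  assumes q: "2 < q" and s: "1/2 \<le> s" and T0: "0 \<le> T"
  obtains J \<eta> where "0 < \<eta>" "\<And>u v. is_fourier u v \<Longrightarrow> sob_finite s v \<Longrightarrow>
      (sob_nsq s v) \<le> T \<Longrightarrow>
      (\<integral>\<^sup>+x. ennreal (cmod (u x) powr q) \<partial>lborel) = 1 \<Longrightarrow> \<exists>j<J. \<exists>x. \<eta> < cmod (band (dyadic j) v x)"
proof -
  obtain t where t: "0 < t" "t < 1" "(1 - t) powr (1 - q) = 3/2" using ex_dyadic_ratio[OF q] .
  define A where "A = t powr (1 - q) * T"
  have A0: "0 \<le> A" using T0 by (simp add: A_def)
  \<comment> \<open>Chosen so that \<open>A * 4 * \<eta> powr (q - 2)\<close> is at most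
    \<open>1/4\<close>, the 4 being the sum of the geometric series; \<open>A + 1\<close> allows for
    \<open>A = 0\<close>.\<close>
  define \<eta> where "\<eta> = (1 / (16 * (A + 1))) powr (1 / (q - 2))"
  have \<eta>: "0 < \<eta>" "\<eta> powr (q - 2) = 1 / (16 * (A + 1))"
    using A0 q by (simp_all add: \<eta>_def powr_powr add_nonneg_pos)
  have "(\<lambda>J. A * sqrt T powr (q - 2) * 4 * (3/4) ^ J) \<longlonglongrightarrow> A * sqrt T powr (q - 2) * 4 * 0"
    by (intro tendsto_intros LIMSEQ_realpow_zero) auto
  then have "\<forall>\<^sub>F J in sequentially. A * sqrt T powr (q - 2) * 4 * (3/4) ^ J < 1/2"
    by (intro order_tendstoD(2)[where y="A * sqrt T powr (q - 2) * 4 * 0"]) auto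
  then obtain J where J: "A * sqrt T powr (q - 2) * 4 * (3/4) ^ J < 1/2"
    using eventually_happens trivial_limit_sequentially by blast
  have "\<exists>j<J. \<exists>x. \<eta> < cmod (band (dyadic j) v x)"
    if F: "is_fourier u v" and int: "sob_finite s v"
      and T: "(sob_nsq s v) \<le> T"
      and one: "(\<integral>\<^sup>+x. ennreal (cmod (u x) powr q) \<partial>lborel) = 1" for u v
  proof (rule ccontr)
    assume "\<not> ?thesis"
    then have small: "cmod (band (dyadic j) v x) \<le> \<eta>" if "j < J" for j x using that by (metis not_less)
    define B where "B j = (if j < J then \<eta> else sqrt T)" for j
    have "(\<integral>\<^sup>+x. ennreal (cmod (u x) powr q) \<partial>lborel)
        \<le> ennreal (t powr (1 - q) * T * (\<Sum>j. (3/4) ^ j * B j powr (q - 2)))"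
    proof (rule dyadic_Lq_bound[OF F s int T _ _ q t])
      show "cmod (band (dyadic j) v x) \<le> B j" for j x
        using small[of j x] band_dyadic_bound[OF is_fourierD(2)[OF F] s int T] by (simp add: B_def)
      show "B j \<le> max \<eta> (sqrt T)" for j by (simp add: B_def)
    qed
    also have "t powr (1 - q) * T = A" by (simp add: A_def)
    finally have le: "1 \<le> A * (\<Sum>j. (3/4) ^ j * B j powr (q - 2))" using one by simp
    let ?f = "\<lambda>j. (3/4::real) ^ j * B j powr (q - 2)"
    have geo: "(\<Sum>j. (3/4::real) ^ j) = 4" "summable (\<lambda>j. (3/4::real) ^ j)"
      using suminf_geometric[of "3/4::real"] by (simp_all add: summable_geometric)
    have fJ: "?f (j + J) = (3/4) ^ J * sqrt T powr (q - 2) * (3/4) ^ j" for j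
      by (simp add: B_def power_add)
    have sm: "summable ?f"
    proof -
      have "summable (\<lambda>j. ?f (j + J))" unfolding fJ by (intro summable_mult geo)
      then show ?thesis by (rule iffD1[OF summable_iff_shift[of ?f J]])
    qed
    have "(\<Sum>j. ?f j) = (\<Sum>j. ?f (j + J)) + (\<Sum>j<J. ?f j)" by (rule suminf_split_initial_segment[OF sm])
    also have "(\<Sum>j. ?f (j + J)) = (3/4) ^ J * sqrt T powr (q - 2) * 4"
      unfolding fJ by (simp only: suminf_mult[OF geo(2)] geo(1))
    also have "(\<Sum>j<J. ?f j) = (\<Sum>j<J. (3/4) ^ j) * \<eta> powr (q - 2)"
      unfolding sum_distrib_right by (intro sum.cong) (auto simp: B_def)
    also have "\<dots> \<le> 4 * \<eta> powr (q - 2)"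
      using sum_le_suminf[OF geo(2), of "{..<J}"] geo(1) by (intro mult_right_mono) auto
    finally have "A * (\<Sum>j. ?f j) \<le> A * ((3/4) ^ J * sqrt T powr (q - 2) * 4 + 4 * \<eta> powr (q - 2))"
      using A0 by (intro mult_left_mono) auto
    also have "\<dots> = A * sqrt T powr (q - 2) * 4 * (3/4) ^ J + A * (4 * \<eta> powr (q - 2))"
      by (simp add: algebra_simps)
    also have "A * (4 * \<eta> powr (q - 2)) \<le> 1/4"
      unfolding \<eta>(2) using A0 by (simp add: field_simps)
    finally show False using le J by linarith
  qed
  with \<eta>(1) that show thesis by blast
qed

subsection \<open>Sobolev spaces and the Brezis--Lieb inequality\<close>

lemma integrable_fourier_cong:
  assumes "is_fourier u v" "is_fourier u v'" and [measurable]: "w \<in> borel_measurable borel"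
  shows "integrable lborel (\<lambda>\<xi>. w \<xi> * (cmod (v \<xi>))\<^sup>2) \<longleftrightarrow> integrable lborel (\<lambda>\<xi>. w \<xi> * (cmod (v' \<xi>))\<^sup>2)"
    and "(LINT \<xi>|lborel. w \<xi> * (cmod (v \<xi>))\<^sup>2) = (LINT \<xi>|lborel. w \<xi> * (cmod (v' \<xi>))\<^sup>2)"
proof -
  have [measurable]: "v \<in> borel_measurable borel" "v' \<in> borel_measurable borel"
    using is_fourierD(2)[OF assms(1)] is_fourierD(2)[OF assms(2)] by (simp_all add: L2_def)
  have ae: "AE \<xi> in lborel. w \<xi> * (cmod (v \<xi>))\<^sup>2 = w \<xi> * (cmod (v' \<xi>))\<^sup>2"
    using is_fourier_unique[OF assms(1,2)] by eventually_elim simp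
  show "integrable lborel (\<lambda>\<xi>. w \<xi> * (cmod (v \<xi>))\<^sup>2) \<longleftrightarrow> integrable lborel (\<lambda>\<xi>. w \<xi> * (cmod (v' \<xi>))\<^sup>2)"
    by (rule integrable_cong_AE[OF _ _ ae]) measurable
  show "(LINT \<xi>|lborel. w \<xi> * (cmod (v \<xi>))\<^sup>2) = (LINT \<xi>|lborel. w \<xi> * (cmod (v' \<xi>))\<^sup>2)"
    by (rule integral_cong_AE[OF _ _ ae]) measurable
qed

lemma sobolev_iff:
  assumes "is_fourier (\<lambda>x. complex_of_real (u x)) v"
  shows "u \<in> sobolev s \<longleftrightarrow> sob_finite s v"
proof
  assume "u \<in> sobolev s"
  then obtain v' where "is_fourier (\<lambda>x. complex_of_real (u x)) v'"
    "sob_finite s v'" by (auto simp: sobolev_def)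
  then show "sob_finite s v"
    using integrable_fourier_cong(1)[OF assms, of v' "\<lambda>\<xi>. (1 + \<xi>\<^sup>2) powr s"] by simp
next
  assume "sob_finite s v"
  then show "u \<in> sobolev s" using assms is_fourierD(1)[OF assms] by (auto simp: sobolev_def)
qed

lemma sobolevE:
  assumes "u \<in> sobolev s"
  obtains v where "is_fourier (\<lambda>x. complex_of_real (u x)) v"
    "sob_finite s v"
  using assms by (auto simp: sobolev_def)

lemma sobolev_norm_fourier:
  assumes "is_fourier (\<lambda>x. complex_of_real (u x)) v"
  shows "sobolev_norm s u = sqrt (sob_nsq s v)"
  unfolding sobolev_norm_def
  by (subst integrable_fourier_cong(2)[OF assms fourier_is_fourier[OF is_fourierD(1)[OF assms]]]) auto

lemma integrable_weight_diff:
  fixes f g :: "real \<Rightarrow> complex"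
  assumes [measurable]: "w \<in> borel_measurable borel" "f \<in> borel_measurable borel" "g \<in> borel_measurable borel"
    and w: "\<And>\<xi>. 0 \<le> w \<xi>"
    and f: "integrable lborel (\<lambda>\<xi>. w \<xi> * (cmod (f \<xi>))\<^sup>2)" and g: "integrable lborel (\<lambda>\<xi>. w \<xi> * (cmod (g \<xi>))\<^sup>2)"
  shows "integrable lborel (\<lambda>\<xi>. w \<xi> * (cmod (f \<xi> - g \<xi>))\<^sup>2)"
proof (rule Bochner_Integration.integrable_bound)
  show "integrable lborel (\<lambda>\<xi>. 2 * (w \<xi> * (cmod (f \<xi>))\<^sup>2) + 2 * (w \<xi> * (cmod (g \<xi>))\<^sup>2))" using f g by simp
  have "norm (w \<xi> * (cmod (f \<xi> - g \<xi>))\<^sup>2) \<le> norm (2 * (w \<xi> * (cmod (f \<xi>))\<^sup>2) + 2 * (w \<xi> * (cmod (g \<xi>))\<^sup>2))" for \<xi>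
  proof -
    have "(cmod (f \<xi> - g \<xi>))\<^sup>2 \<le> (cmod (f \<xi>) + cmod (g \<xi>))\<^sup>2" by (intro power_mono norm_triangle_ineq4) simp
    also have "\<dots> \<le> 2 * (cmod (f \<xi>))\<^sup>2 + 2 * (cmod (g \<xi>))\<^sup>2" by (rule sum_sq_bound)
    finally have "w \<xi> * (cmod (f \<xi> - g \<xi>))\<^sup>2 \<le> w \<xi> * (2 * (cmod (f \<xi>))\<^sup>2 + 2 * (cmod (g \<xi>))\<^sup>2)"
      by (rule mult_left_mono) (rule w)
    also have "\<dots> = 2 * (w \<xi> * (cmod (f \<xi>))\<^sup>2) + 2 * (w \<xi> * (cmod (g \<xi>))\<^sup>2)" by (simp add: algebra_simps)
    also have "\<dots> \<le> norm (2 * (w \<xi> * (cmod (f \<xi>))\<^sup>2) + 2 * (w \<xi> * (cmod (g \<xi>))\<^sup>2))"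
      by (simp only: real_norm_def abs_ge_self)
    finally show ?thesis using w[of \<xi>] by simp
  qed
  then show "AE \<xi> in lborel. norm (w \<xi> * (cmod (f \<xi> - g \<xi>))\<^sup>2) \<le> norm (2 * (w \<xi> * (cmod (f \<xi>))\<^sup>2) + 2 * (w \<xi> * (cmod (g \<xi>))\<^sup>2))"
    by simp
qed measurable

text \<open>Translating a function by \<open>y\<close> multiplies its transform by this phase, so a
  large value of a block at \<open>y\<close> becomes a large value at the origin.\<close>

lemma band_translate_zero: "band A (\<lambda>\<xi>. cis (y * \<xi>) * v \<xi>) 0 = band A v y"
  unfolding band_def fourier_L1_def by (simp add: mult_ac)

lemma integrable_powr_diff:
  fixes f g :: "real \<Rightarrow> real"
  assumes [measurable]: "f \<in> borel_measurable borel" "g \<in> borel_measurable borel" and q: "1 \<le> q"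
    and f: "integrable lborel (\<lambda>x. \<bar>f x\<bar> powr q)" and g: "integrable lborel (\<lambda>x. \<bar>g x\<bar> powr q)"
  shows "integrable lborel (\<lambda>x. \<bar>f x - g x\<bar> powr q)"
proof (rule Bochner_Integration.integrable_bound)
  let ?c = "(1/2::real) powr (1 - q)"
  show "integrable lborel (\<lambda>x. ?c * \<bar>f x\<bar> powr q + ?c * \<bar>g x\<bar> powr q)" using f g by simp
  have "norm (\<bar>f x - g x\<bar> powr q) \<le> norm (?c * \<bar>f x\<bar> powr q + ?c * \<bar>g x\<bar> powr q)" for x
  proof -
    have "\<bar>f x - g x\<bar> powr q \<le> (\<bar>f x\<bar> + \<bar>g x\<bar>) powr q" using q by (intro powr_mono2) auto
    also have "\<dots> \<le> ?c * \<bar>f x\<bar> powr q + ?c * \<bar>g x\<bar> powr q"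
      using powr_add_le_weighted[of "\<bar>f x\<bar>" "\<bar>g x\<bar>" "1/2" q] q by simp
    finally show ?thesis by simp
  qed
  then show "AE x in lborel. norm (\<bar>f x - g x\<bar> powr q) \<le> norm (?c * \<bar>f x\<bar> powr q + ?c * \<bar>g x\<bar> powr q)" by simp
qed measurable

text \<open>Only one half of the Brezis--Lieb lemma is needed, and it follows from convexity.\<close>
lemma Brezis_Lieb_le:
  fixes f :: "nat \<Rightarrow> real \<Rightarrow> real"
  assumes [measurable]: "\<And>n. f n \<in> borel_measurable borel" "g \<in> borel_measurable borel" and q: "1 < q"
    and lim: "AE x in lborel. (\<lambda>n. f n x) \<longlonglongrightarrow> g x"
    and f: "\<And>n. integrable lborel (\<lambda>x. \<bar>f n x\<bar> powr q)" and g: "integrable lborel (\<lambda>x. \<bar>g x\<bar> powr q)"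
    and one: "\<And>n. (LINT x|lborel. \<bar>f n x\<bar> powr q) = 1"
    and M: "\<And>n. (LINT x|lborel. \<bar>f n x - g x\<bar> powr q) \<le> M n" and Mlim: "M \<longlonglongrightarrow> \<mu>"
  shows "1 \<le> (LINT x|lborel. \<bar>g x\<bar> powr q) + \<mu>"
proof -
  have d: "integrable lborel (\<lambda>x. \<bar>f n x - g x\<bar> powr q)" for n
    by (rule integrable_powr_diff[OF _ _ _ f g]) (use q in auto)
  have t: "1 \<le> (LINT x|lborel. \<bar>g x\<bar> powr q) + (1 - t) powr (1 - q) * \<mu>" if t: "0 < t" "t < 1" for t
  proof -
    let ?a = "(1 - t) powr (1 - q)" and ?b = "t powr (1 - q)"
    \<comment> \<open>Subtracting a multiple slightly above 1 of the remainder's power leaves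
      something dominated by a multiple of the power of \<open>g\<close> alone, so dominated
      convergence applies even where the remainder carries mass.\<close>
    define h where "h n x = max 0 (\<bar>f n x\<bar> powr q - ?a * \<bar>f n x - g x\<bar> powr q)" for n x
    have [measurable]: "h n \<in> borel_measurable borel" for n unfolding h_def[abs_def] by measurable
    have fh: "\<bar>f n x\<bar> powr q - ?a * \<bar>f n x - g x\<bar> powr q \<le> ?b * \<bar>g x\<bar> powr q" for n x
    proof -
      have "\<bar>f n x\<bar> powr q \<le> (\<bar>f n x - g x\<bar> + \<bar>g x\<bar>) powr q" using q by (intro powr_mono2) auto
      also have "\<dots> \<le> ?a * \<bar>f n x - g x\<bar> powr q + ?b * \<bar>g x\<bar> powr q"
        using t q by (intro powr_add_le_weighted) auto
      finally show ?thesis by simp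
    qed
    have wb: "norm (h n x) \<le> ?b * \<bar>g x\<bar> powr q" for n x using fh[of n x] by (simp add: h_def)
    have w: "integrable lborel (\<lambda>x. ?b * \<bar>g x\<bar> powr q)" using g by simp
    have hi: "integrable lborel (h n)" for n
    proof (rule Bochner_Integration.integrable_bound[OF w])
      have "norm (h n x) \<le> norm (?b * \<bar>g x\<bar> powr q)" for x using wb[of n x] by simp
      then show "AE x in lborel. norm (h n x) \<le> norm (?b * \<bar>g x\<bar> powr q)" by simp
    qed measurable
    have "(\<lambda>n. LINT x|lborel. h n x) \<longlonglongrightarrow> (LINT x|lborel. \<bar>g x\<bar> powr q)"
    proof (rule Bochner_Integration.integral_dominated_convergence[OF _ _ w])
      show "AE x in lborel. (\<lambda>n. h n x) \<longlonglongrightarrow> \<bar>g x\<bar> powr q"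
        using lim
      proof eventually_elim
        case (elim x)
        have a: "(\<lambda>n. \<bar>f n x\<bar> powr q) \<longlonglongrightarrow> \<bar>g x\<bar> powr q"
          using q by (intro tendsto_powr2 tendsto_rabs elim tendsto_const) auto
        have b: "(\<lambda>n. \<bar>f n x - g x\<bar> powr q) \<longlonglongrightarrow> 0 powr q"
          using q elim by (intro tendsto_powr2 tendsto_rabs_zero LIM_zero tendsto_const) auto
        have "(\<lambda>n. max 0 (\<bar>f n x\<bar> powr q - ?a * \<bar>f n x - g x\<bar> powr q)) \<longlonglongrightarrow> max 0 (\<bar>g x\<bar> powr q - ?a * (0 powr q))"
          by (intro tendsto_max tendsto_const tendsto_diff tendsto_mult a b)
        then show ?case using q by (simp add: h_def)
      qed
      show "AE x in lborel. norm (h n x) \<le> ?b * \<bar>g x\<bar> powr q" for n using wb by simp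
    qed measurable
    then have "(\<lambda>n. (LINT x|lborel. h n x) + ?a * M n) \<longlonglongrightarrow> (LINT x|lborel. \<bar>g x\<bar> powr q) + ?a * \<mu>"
      by (intro tendsto_intros Mlim)
    moreover have "1 \<le> (LINT x|lborel. h n x) + ?a * M n" for n
    proof -
      have "1 = (LINT x|lborel. \<bar>f n x\<bar> powr q)" by (simp add: one)
      also have "\<dots> \<le> (LINT x|lborel. h n x + ?a * \<bar>f n x - g x\<bar> powr q)"
      proof (rule integral_mono[OF f])
        show "integrable lborel (\<lambda>x. h n x + ?a * \<bar>f n x - g x\<bar> powr q)" using hi d by simp
        show "\<bar>f n x\<bar> powr q \<le> h n x + ?a * \<bar>f n x - g x\<bar> powr q" for x by (simp add: h_def)
      qed
      also have "\<dots> = (LINT x|lborel. h n x) + ?a * (LINT x|lborel. \<bar>f n x - g x\<bar> powr q)"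
        using hi d by simp
      also have "\<dots> \<le> (LINT x|lborel. h n x) + ?a * M n" by (intro add_left_mono mult_left_mono M) simp
      finally show ?thesis .
    qed
    ultimately show ?thesis by (intro LIMSEQ_le_const) auto
  qed
  \<comment> \<open>Now \<open>t\<close> tends to 0 along \<open>1 / (n + 2)\<close>; the double
    successor keeps \<open>t\<close> strictly below 1 from the first index on.\<close>
  have tl: "(\<lambda>n. 1 - 1 / real (Suc (Suc n))) \<longlonglongrightarrow> 1 - 0"
    by (intro tendsto_intros LIMSEQ_Suc[OF LIMSEQ_Suc[OF lim_1_over_n]])
  have "(\<lambda>n. (LINT x|lborel. \<bar>g x\<bar> powr q) + (1 - 1 / real (Suc (Suc n))) powr (1 - q) * \<mu>) \<longlonglongrightarrow>
      (LINT x|lborel. \<bar>g x\<bar> powr q) + (1 - 0) powr (1 - q) * \<mu>"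
    by (intro tendsto_add tendsto_mult tendsto_powr tendsto_const tl) simp
  then have "1 \<le> (LINT x|lborel. \<bar>g x\<bar> powr q) + (1 - 0) powr (1 - q) * \<mu>"
    by (rule LIMSEQ_le_const) (auto intro!: t)
  then show ?thesis by simp
qed

text \<open>Here \<open>a\<close> is the mass captured by the limit and \<open>b\<close> the
  normalised energy of the remainder. Since \<open>b \<le> 1\<close>, its power is at most
  \<open>b\<close>, so \<open>1 \<le> a + b\<close>; if \<open>a < 1\<close>, then \<open>a\<close>
  lies strictly below \<open>a powr (2 / q)\<close>, against the second inequality. Mass cannot be
  shared.\<close>

lemma splitting_rigidity:
  fixes a b q :: real
  assumes a: "0 < a" and b: "0 \<le> b" and q: "2 < q"
    and 1: "1 \<le> a + b powr (q / 2)" and 2: "a powr (2 / q) + b \<le> 1"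
  shows "a = 1" "b = 0"
proof -
  have pos: "0 < a powr (2 / q)" using a by simp
  have b1: "b \<le> 1" using 2 pos by linarith
  have "b powr (q / 2) \<le> b powr 1" using q b b1 by (intro powr_mono') auto
  then have bq: "b powr (q / 2) \<le> b" using b by simp
  show "a = 1"
  proof (rule ccontr)
    assume "a \<noteq> 1"
    have "a \<le> 1"
    proof (rule ccontr)
      assume "\<not> a \<le> 1"
      then have "1 < a powr (2 / q)" using q by (intro gr_one_powr) auto
      with 2 b show False by linarith
    qed
    with \<open>a \<noteq> 1\<close> have "a < 1" by simp
    then have "a powr 1 < a powr (2 / q)" using a q by (intro powr_less_mono') auto
    with a 1 2 bq show False by simp
  qed
  with 2 b show "b = 0" by simp
qed

subsection \<open>Minimizing sequences\<close>

text \<open>\<open>E\<close> is left abstract, since \<^const>\<open>I_func\<close> involves choices that determine it only through its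
  values on the Sobolev space.\<close>
locale weighted_energy =
  fixes W :: "real \<Rightarrow> real" and E :: "(real \<Rightarrow> real) \<Rightarrow> real" and s p \<kappa> K :: real
  assumes W_measurable [measurable]: "W \<in> borel_measurable borel"
    and \<kappa>_pos: "0 < \<kappa>" and W_lower: "\<And>\<xi>. \<kappa> * (1 + \<xi>\<^sup>2) powr s \<le> W \<xi>"
    and W_upper: "\<And>\<xi>. W \<xi> \<le> K * (1 + \<xi>\<^sup>2) powr s"
    and s_ge: "1/2 \<le> s" and p_gt: "1 < p"
    and E_fourier: "\<And>u v. is_fourier (\<lambda>x. complex_of_real (u x)) v \<Longrightarrow>
      sob_finite s v \<Longrightarrow> E u = (LINT \<xi>|lborel. W \<xi> * (cmod (v \<xi>))\<^sup>2)"
begin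

definition ground :: real where
  "ground = Inf {E u | u. u \<in> sobolev s \<and> Q_func p u = 1}"

lemma W_nonneg: "0 \<le> W \<xi>"
  by (rule order_trans[OF _ W_lower]) (use \<kappa>_pos in simp)

lemma integrable_W:
  assumes [measurable]: "v \<in> borel_measurable borel"
    and int: "sob_finite s v"
  shows "integrable lborel (\<lambda>\<xi>. W \<xi> * (cmod (v \<xi>))\<^sup>2)"
proof (rule Bochner_Integration.integrable_bound)
  show "integrable lborel (\<lambda>\<xi>. K * ((1 + \<xi>\<^sup>2) powr s * (cmod (v \<xi>))\<^sup>2))" using int by simp
  have "norm (W \<xi> * (cmod (v \<xi>))\<^sup>2) \<le> norm (K * ((1 + \<xi>\<^sup>2) powr s * (cmod (v \<xi>))\<^sup>2))" for \<xi>
  proof -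
    have "W \<xi> * (cmod (v \<xi>))\<^sup>2 \<le> K * (1 + \<xi>\<^sup>2) powr s * (cmod (v \<xi>))\<^sup>2" by (rule mult_right_mono[OF W_upper]) simp
    also have "\<dots> \<le> norm (K * (1 + \<xi>\<^sup>2) powr s * (cmod (v \<xi>))\<^sup>2)" by (simp only: real_norm_def abs_ge_self)
    finally show ?thesis using W_nonneg[of \<xi>] by (simp add: mult.assoc)
  qed
  then show "AE \<xi> in lborel. norm (W \<xi> * (cmod (v \<xi>))\<^sup>2) \<le> norm (K * ((1 + \<xi>\<^sup>2) powr s * (cmod (v \<xi>))\<^sup>2))" by simp
qed measurable

lemma integrable_weight:
  assumes [measurable]: "v \<in> borel_measurable borel" and int: "integrable lborel (\<lambda>\<xi>. W \<xi> * (cmod (v \<xi>))\<^sup>2)"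
  shows "sob_finite s v"
    and "\<kappa> * (sob_nsq s v) \<le> (LINT \<xi>|lborel. W \<xi> * (cmod (v \<xi>))\<^sup>2)"
proof -
  have le: "\<kappa> * ((1 + \<xi>\<^sup>2) powr s * (cmod (v \<xi>))\<^sup>2) \<le> W \<xi> * (cmod (v \<xi>))\<^sup>2" for \<xi>
    using mult_right_mono[OF W_lower[of \<xi>], of "(cmod (v \<xi>))\<^sup>2"] by (simp add: mult.assoc)
  have "integrable lborel (\<lambda>\<xi>. \<kappa> * ((1 + \<xi>\<^sup>2) powr s * (cmod (v \<xi>))\<^sup>2))"
  proof (rule Bochner_Integration.integrable_bound[OF int])
    have "norm (\<kappa> * ((1 + \<xi>\<^sup>2) powr s * (cmod (v \<xi>))\<^sup>2)) \<le> norm (W \<xi> * (cmod (v \<xi>))\<^sup>2)" for \<xi>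
      using le[of \<xi>] \<kappa>_pos W_nonneg[of \<xi>] by (simp add: abs_mult)
    then show "AE \<xi> in lborel. norm (\<kappa> * ((1 + \<xi>\<^sup>2) powr s * (cmod (v \<xi>))\<^sup>2)) \<le> norm (W \<xi> * (cmod (v \<xi>))\<^sup>2)" by simp
  qed measurable
  then show i: "sob_finite s v"
    using \<kappa>_pos by simp
  have "\<kappa> * (sob_nsq s v) = (LINT \<xi>|lborel. \<kappa> * ((1 + \<xi>\<^sup>2) powr s * (cmod (v \<xi>))\<^sup>2))"
    by (rule integral_mult_right_zero[symmetric])
  also have "\<dots> \<le> (LINT \<xi>|lborel. W \<xi> * (cmod (v \<xi>))\<^sup>2)"
    using i by (intro integral_mono int le) simp
  finally show "\<kappa> * (sob_nsq s v) \<le> (LINT \<xi>|lborel. W \<xi> * (cmod (v \<xi>))\<^sup>2)" .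
qed

section \<open>Coercivity and the constrained infimum\<close>

lemma E_coercive:
  assumes F: "is_fourier (\<lambda>x. complex_of_real (u x)) v"
    and int: "sob_finite s v"
  shows "(sob_nsq s v) \<le> E u / \<kappa>"
proof -
  have "v \<in> borel_measurable borel" using is_fourierD(2)[OF F] by (simp add: L2_def)
  from integrable_weight(2)[OF this integrable_W[OF this int]] show ?thesis
    using \<kappa>_pos by (simp add: E_fourier[OF F int] field_simps)
qed

lemma E_nonneg:
  assumes "u \<in> sobolev s" shows "0 \<le> E u"
proof -
  obtain v where F: "is_fourier (\<lambda>x. complex_of_real (u x)) v"
    "sob_finite s v" using sobolevE[OF assms] .
  show ?thesis unfolding E_fourier[OF F] using W_nonneg by (simp add: integral_nonneg_AE)
qed

lemma ground_le:
  assumes "u \<in> sobolev s" "Q_func p u = 1"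
  shows "ground \<le> E u"
  unfolding ground_def
proof (rule cInf_lower)
  show "bdd_below {E u |u. u \<in> sobolev s \<and> Q_func p u = 1}"
    by (rule bdd_belowI[of _ 0]) (auto intro: E_nonneg)
qed (use assms in blast)

text \<open>The integral of a non-integrable function is 0 by default, so the value 1 certifies
  integrability.\<close>

lemma Q_one_nn_integral:
  assumes "Q_func p u = 1"
  shows "integrable lborel (\<lambda>x. \<bar>u x\<bar> powr (p + 1))"
    "(\<integral>\<^sup>+x. ennreal (cmod (complex_of_real (u x)) powr (p + 1)) \<partial>lborel) = 1"
proof -
  show i: "integrable lborel (\<lambda>x. \<bar>u x\<bar> powr (p + 1))"
    using assms not_integrable_integral_eq[of lborel "\<lambda>x. \<bar>u x\<bar> powr (p + 1)"] by (auto simp: Q_func_def)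
  show "(\<integral>\<^sup>+x. ennreal (cmod (complex_of_real (u x)) powr (p + 1)) \<partial>lborel) = 1"
    using nn_integral_eq_integral[OF i] assms by (simp add: Q_func_def)
qed

text \<open>The constraint and the Sobolev inequality bound the energy from below. The given
  \<open>u\<close> shows that the constraint set is nonempty, so that the infimum is
  meaningful.\<close>

lemma ground_pos:
  assumes "u \<in> sobolev s" "Q_func p u = 1"
  shows "0 < ground"
proof -
  have q: "2 < p + 1" using p_gt by simp
  obtain C where C: "0 < C" "\<And>u v T. is_fourier u v \<Longrightarrow> sob_finite s v \<Longrightarrow>
      (sob_nsq s v) \<le> T \<Longrightarrow>
      (\<integral>\<^sup>+x. ennreal (cmod (u x) powr (p + 1)) \<partial>lborel) \<le> ennreal (C * T powr ((p + 1) / 2))"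
    using Sobolev_inequality[OF q s_ge] by blast
  have "\<kappa> * (1 / C) powr (2 / (p + 1)) \<le> E w" if w: "w \<in> sobolev s" "Q_func p w = 1" for w
  proof -
    obtain v where F: "is_fourier (\<lambda>x. complex_of_real (w x)) v"
      "sob_finite s v" using sobolevE[OF w(1)] .
    have "ennreal 1 \<le> ennreal (C * (E w / \<kappa>) powr ((p + 1) / 2))"
      using C(2)[OF F E_coercive[OF F]] Q_one_nn_integral(2)[OF w(2)] by simp
    then have "1 \<le> C * (E w / \<kappa>) powr ((p + 1) / 2)" using C(1) by (subst (asm) ennreal_le_iff) auto
    then have "1 / C \<le> (E w / \<kappa>) powr ((p + 1) / 2)" using C(1) by (simp add: field_simps)
    then have "(1 / C) powr (2 / (p + 1)) \<le> ((E w / \<kappa>) powr ((p + 1) / 2)) powr (2 / (p + 1))"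
      using C(1) p_gt by (intro powr_mono2) auto
    also have "\<dots> = E w / \<kappa>"
    proof -
      have "x / 2 * (2 / x) = 1" if "x \<noteq> 0" for x :: real using that by simp
      then have "(p + 1) / 2 * (2 / (p + 1)) = 1" using p_gt by (metis add_pos_pos less_irrefl less_trans zero_less_one)
      then show ?thesis
        unfolding powr_powr using E_nonneg[OF w(1)] \<kappa>_pos by (simp only:) simp
    qed
    finally show ?thesis using \<kappa>_pos by (simp add: field_simps)
  qed
  then have "\<kappa> * (1 / C) powr (2 / (p + 1)) \<le> ground"
    unfolding ground_def by (intro cInf_greatest) (use assms in auto)
  moreover have "0 < \<kappa> * (1 / C) powr (2 / (p + 1))" using \<kappa>_pos C(1) by simp
  ultimately show ?thesis by linarith
qed

text \<open>\<open>E\<close> is homogeneous of degree 2 and \<open>Q_func p\<close> of degree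
  \<open>p + 1\<close>, so scaling by \<open>a\<close> reaches the constraint. If
  \<open>Q_func p u\<close> is 0, whether as a value or as the default of a divergent integral, the
  left side is 0 because \<open>0 powr x = 0\<close>.\<close>

lemma ground_scaled:
  assumes u: "u \<in> sobolev s"
  shows "ground * Q_func p u powr (2 / (p + 1)) \<le> E u"
proof (cases "Q_func p u = 0")
  case True
  then show ?thesis using E_nonneg[OF u] by simp
next
  case False
  have "0 \<le> Q_func p u" unfolding Q_func_def by (simp add: integral_nonneg_AE)
  with False have Q: "0 < Q_func p u" by simp
  define a where "a = Q_func p u powr (- 1 / (p + 1))"
  have a: "0 < a" using Q by (simp add: a_def)
  obtain v where F: "is_fourier (\<lambda>x. complex_of_real (u x)) v"
      "sob_finite s v" using sobolevE[OF u] .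
  have F': "is_fourier (\<lambda>x. complex_of_real (a * u x)) (\<lambda>\<xi>. complex_of_real a * v \<xi>)"
    using is_fourier_cmult[OF F(1), of "complex_of_real a"] by simp
  have eq: "w * (cmod (complex_of_real a * z))\<^sup>2 = a\<^sup>2 * (w * (cmod z)\<^sup>2)" for w z
    by (simp add: norm_mult power_mult_distrib)
  have int: "integrable lborel (\<lambda>\<xi>. (1 + \<xi>\<^sup>2) powr s * (cmod (complex_of_real a * v \<xi>))\<^sup>2)"
    unfolding eq using F(2) by simp
  have "E (\<lambda>x. a * u x) = a\<^sup>2 * E u"
    unfolding E_fourier[OF F' int] E_fourier[OF F] eq by (rule integral_mult_right_zero)
  moreover have "Q_func p (\<lambda>x. a * u x) = 1"
  proof -
    have "\<bar>a * u x\<bar> powr (p + 1) = a powr (p + 1) * \<bar>u x\<bar> powr (p + 1)" for x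
      using a by (simp add: abs_mult powr_mult)
    then have "Q_func p (\<lambda>x. a * u x) = a powr (p + 1) * Q_func p u" by (simp add: Q_func_def)
    also have "a powr (p + 1) = Q_func p u powr (- 1)" using p_gt by (simp add: a_def powr_powr)
    also have "\<dots> * Q_func p u = 1" using Q by (simp add: powr_minus_divide)
    finally show ?thesis .
  qed
  moreover have "(\<lambda>x. a * u x) \<in> sobolev s" using sobolev_iff[OF F'] int by simp
  ultimately have "ground \<le> a\<^sup>2 * E u" using ground_le[of "\<lambda>x. a * u x"] by simp
  then have "ground * Q_func p u powr (2 / (p + 1)) \<le> a\<^sup>2 * E u * Q_func p u powr (2 / (p + 1))"
    by (rule mult_right_mono) simp
  also have "\<dots> = (a\<^sup>2 * Q_func p u powr (2 / (p + 1))) * E u" by (simp only: mult_ac)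
  also have "a\<^sup>2 = Q_func p u powr (- 2 / (p + 1))"
    using Q by (simp add: a_def power2_eq_square powr_add[symmetric] field_simps)
  also have "Q_func p u powr (- 2 / (p + 1)) * Q_func p u powr (2 / (p + 1)) = 1"
    using Q by (simp add: powr_add[symmetric])
  finally show ?thesis by simp
qed

theorem minimizing_sequence_converges:
  assumes in_H: "\<And>n. \<psi>s n \<in> sobolev s" and Q1: "\<And>n. Q_func p (\<psi>s n) = 1"
    and min: "(\<lambda>n. E (\<psi>s n)) \<longlonglongrightarrow> ground"
  shows "\<exists>n :: nat \<Rightarrow> nat. \<exists>y :: nat \<Rightarrow> real. \<exists>\<psi>. strict_mono n \<and> \<psi> \<in> sobolev s \<and>
    (\<lambda>k. sobolev_norm s (\<lambda>x. \<psi>s (n k) (x + y (n k)) - \<psi> x)) \<longlonglongrightarrow> 0 \<and> Q_func p \<psi> = 1 \<and> E \<psi> = ground"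
proof -
  let ?q = "p + 1"
  have q: "2 < ?q" "1 < ?q" "1 \<le> ?q" using p_gt by simp_all
  have g0: "0 < ground" by (rule ground_pos[OF in_H Q1])
  have "\<forall>n. \<exists>v. is_fourier (\<lambda>x. complex_of_real (\<psi>s n x)) v \<and> sob_finite s v"
    using in_H by (auto simp: sobolev_def)
  then obtain v where F: "\<And>n. is_fourier (\<lambda>x. complex_of_real (\<psi>s n x)) (v n)"
    and int: "\<And>n. sob_finite s (v n)" by metis
  obtain T0 where T0: "\<And>n. E (\<psi>s n) \<le> T0"
    using convergent_imp_Bseq[OF convergentI[OF min]] unfolding Bseq_def by (metis abs_le_D1 real_norm_def)
  define T where "T = T0 / \<kappa>"
  have T: "(sob_nsq s (v n)) \<le> T" for n
    using order_trans[OF E_coercive[OF F int] divide_right_mono[OF T0]] \<kappa>_pos by (simp add: T_def)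
  have "0 \<le> T" using order_trans[OF _ T[of 0]] by (simp add: integral_nonneg_AE)
  then obtain J \<eta> where \<eta>: "0 < \<eta>" and nv: "\<And>u v. is_fourier u v \<Longrightarrow> sob_finite s v \<Longrightarrow>
      (sob_nsq s v) \<le> T \<Longrightarrow>
      (\<integral>\<^sup>+x. ennreal (cmod (u x) powr ?q) \<partial>lborel) = 1 \<Longrightarrow> \<exists>j<J. \<exists>x. \<eta> < cmod (band (dyadic j) v x)"
  proof (rule nonvanishing[OF q(1) s_ge])
    fix \<eta> J
    assume "0 < \<eta>" "\<And>u v. is_fourier u v \<Longrightarrow> sob_finite s v \<Longrightarrow>
      (sob_nsq s v) \<le> T \<Longrightarrow>
      (\<integral>\<^sup>+x. ennreal (cmod (u x) powr ?q) \<partial>lborel) = 1 \<Longrightarrow> \<exists>j<J. \<exists>x. \<eta> < cmod (band (dyadic j) v x)"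
    then show thesis by (rule that)
  qed
  have "\<exists>j<J. \<exists>x. \<eta> < cmod (band (dyadic j) (v n) x)" for n
    by (rule nv[OF F int T Q_one_nn_integral(2)[OF Q1]])
  then have "\<forall>n. \<exists>j x. j < J \<and> \<eta> < cmod (band (dyadic j) (v n) x)" by blast
  then obtain jj y where jj: "\<And>n. jj n < J" and y: "\<And>n. \<eta> < cmod (band (dyadic (jj n)) (v n) (y n))" by metis
  \<comment> \<open>Only the blocks below \<open>J\<close> can be large, so one index
    \<open>j\<close> occurs infinitely often; with \<open>j\<close> fixed, a single test function
    detects all these values.\<close>
  have "finite (range jj)" by (rule finite_subset[of _ "{..<J}"]) (use jj in auto)
  then obtain j where "infinite (jj -` {j})" using inf_img_fin_dom[of jj UNIV] by auto
  then obtain n1 where n1: "strict_mono (n1 :: nat \<Rightarrow> nat)" and n1j: "\<And>i. jj (n1 i) = j"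
    using infinite_enumerate by (metis vimage_singleton_eq)
  \<comment> \<open>The translation moves the large block value to the origin and changes neither
    \<open>E\<close> nor \<open>Q_func p\<close>.\<close>
  define \<phi> where "\<phi> i x = \<psi>s (n1 i) (x + y (n1 i))" for i x
  define w where "w i \<xi> = cis (y (n1 i) * \<xi>) * v (n1 i) \<xi>" for i \<xi>
  have cw: "cmod (w i \<xi>) = cmod (v (n1 i) \<xi>)" for i \<xi> by (simp add: w_def norm_mult)
  have wF: "is_fourier (\<lambda>x. complex_of_real (\<phi> i x)) (w i)" for i
    unfolding \<phi>_def w_def using is_fourier_translate[OF F] .
  have wint: "sob_finite s (w i)" for i unfolding cw by (rule int)
  have wT: "(sob_nsq s (w i)) \<le> T" for i unfolding cw by (rule T)
  have E\<phi>: "E (\<phi> i) = E (\<psi>s (n1 i))" for i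
    unfolding E_fourier[OF wF wint] E_fourier[OF F int] cw ..
  have Q\<phi>: "Q_func p (\<phi> i) = 1" for i
  proof -
    have "(LINT x|lborel. \<bar>\<psi>s (n1 i) x\<bar> powr ?q) = (LINT x|lborel. \<bar>\<psi>s (n1 i) (y (n1 i) + 1 * x)\<bar> powr ?q)"
      by (subst lborel_integral_real_affine[of 1 _ "y (n1 i)"]) auto
    then show ?thesis using Q1[of "n1 i"] by (simp add: Q_func_def \<phi>_def add.commute)
  qed
  obtain k u v' where k: "strict_mono (k::nat\<Rightarrow>nat)" and uF: "is_fourier (\<lambda>x. complex_of_real (u x)) v'"
    and ae: "AE x in lborel. (\<lambda>i. \<phi> (k i) x) \<longlonglongrightarrow> u x"
    and weak: "\<And>g. L2 g \<Longrightarrow> (\<lambda>i. LINT \<xi>|lborel. w (k i) \<xi> * g \<xi>) \<longlonglongrightarrow> (LINT \<xi>|lborel. v' \<xi> * g \<xi>)"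
  proof (rule Sobolev_local_compactness[OF wF s_ge wint wT])
    fix k u v'
    assume "strict_mono (k::nat\<Rightarrow>nat)" "is_fourier (\<lambda>x. complex_of_real (u x)) v'"
      "AE x in lborel. (\<lambda>i. \<phi> (k i) x) \<longlonglongrightarrow> u x"
      "\<And>g. L2 g \<Longrightarrow> (\<lambda>i. LINT \<xi>|lborel. w (k i) \<xi> * g \<xi>) \<longlonglongrightarrow> (LINT \<xi>|lborel. v' \<xi> * g \<xi>)"
    then show thesis by (rule that)
  qed
  have vm[measurable]: "v' \<in> borel_measurable borel" "w i \<in> borel_measurable borel" for i
    using is_fourierD(2)[OF uF] is_fourierD(2)[OF wF[of i]] by (simp_all add: L2_def)
  have um[measurable]: "u \<in> borel_measurable borel" "\<phi> i \<in> borel_measurable borel" for i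
    using is_fourierD(1)[OF uF] is_fourierD(1)[OF wF[of i]] by (simp_all add: L2_def)
  have wW: "integrable lborel (\<lambda>\<xi>. W \<xi> * (cmod (w i \<xi>))\<^sup>2)" for i by (rule integrable_W[OF vm(2) wint])
  have Wb: "W \<xi> \<le> \<bar>K\<bar> * (1 + (real R)\<^sup>2) powr s" if "\<bar>\<xi>\<bar> \<le> real R" for \<xi> and R :: nat
  proof -
    have "W \<xi> \<le> K * (1 + \<xi>\<^sup>2) powr s" by (rule W_upper)
    also have "\<dots> \<le> \<bar>K\<bar> * (1 + \<xi>\<^sup>2) powr s" by (intro mult_right_mono) auto
    also have "\<dots> \<le> \<bar>K\<bar> * (1 + (real R)\<^sup>2) powr s"
      using s_ge power_mono[OF that, of 2] by (intro mult_left_mono powr_mono2) auto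
    finally show ?thesis .
  qed
  have wE: "(LINT \<xi>|lborel. W \<xi> * (cmod (w (k i) \<xi>))\<^sup>2) \<le> T0" for i
    unfolding E_fourier[OF wF wint, symmetric] E\<phi> by (rule T0)
  note lim = weak_limit_weighted[OF W_measurable W_nonneg Wb is_fourierD(2)[OF wF] is_fourierD(2)[OF uF] weak wW wE]
  have vint: "sob_finite s v'"
    by (rule integrable_weight(1)[OF vm(1) lim(1)])
  have uH: "u \<in> sobolev s" using sobolev_iff[OF uF] vint by blast
  define d where "d i x = \<phi> (k i) x - u x" for i x
  have dF: "is_fourier (\<lambda>x. complex_of_real (d i x)) (\<lambda>\<xi>. w (k i) \<xi> - v' \<xi>)" for i
    unfolding d_def using is_fourier_diff[OF wF[of "k i"] uF] by simp
  have dint: "integrable lborel (\<lambda>\<xi>. (1 + \<xi>\<^sup>2) powr s * (cmod (w (k i) \<xi> - v' \<xi>))\<^sup>2)" for i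
    by (rule integrable_weight_diff[OF _ _ _ _ wint vint]) auto
  have dH: "d i \<in> sobolev s" for i using sobolev_iff[OF dF] dint by blast
  \<comment> \<open>This will be the limit of the energies of the remainders, as the energies along
    the sequence tend to \<open>ground\<close>.\<close>
  define a where "a = ground - E u"
  have "(\<lambda>i. E (\<phi> (k i))) \<longlonglongrightarrow> ground"
    using LIMSEQ_subseq_LIMSEQ[OF LIMSEQ_subseq_LIMSEQ[OF min n1] k] by (simp add: E\<phi> o_def)
  then have "(\<lambda>i. (E (d i) - E (\<phi> (k i))) + E (\<phi> (k i))) \<longlonglongrightarrow> - E u + ground"
    using lim(2) unfolding E_fourier[OF dF dint] E_fourier[OF wF wint] E_fourier[OF uF vint] by (rule tendsto_add[rotated])
  then have Ed: "(\<lambda>i. E (d i)) \<longlonglongrightarrow> a" by (simp add: a_def)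
  have a0: "0 \<le> a" by (rule LIMSEQ_le_const[OF Ed]) (use E_nonneg[OF dH] in auto)
  have \<phi>q: "integrable lborel (\<lambda>x. \<bar>\<phi> i x\<bar> powr ?q)" for i by (rule Q_one_nn_integral(1)[OF Q\<phi>])
  have "(\<integral>\<^sup>+x. ennreal (\<bar>u x\<bar> powr ?q) \<partial>lborel) \<le> 1"
  proof (rule Fatou_bound)
    show "AE x in lborel. (\<lambda>i. ennreal (\<bar>\<phi> (k i) x\<bar> powr ?q)) \<longlonglongrightarrow> ennreal (\<bar>u x\<bar> powr ?q)"
      using ae
    proof eventually_elim
      case (elim x)
      show ?case using q by (intro tendsto_ennrealI tendsto_powr2 tendsto_rabs elim tendsto_const) auto
    qed
    show "(\<integral>\<^sup>+x. ennreal (\<bar>\<phi> (k i) x\<bar> powr ?q) \<partial>lborel) \<le> 1" for i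
      using Q_one_nn_integral(2)[OF Q\<phi>[of "k i"]] by simp
  qed measurable
  then have uq: "integrable lborel (\<lambda>x. \<bar>u x\<bar> powr ?q)"
    by (intro integrableI_bounded) (auto intro: order_le_less_trans)
  \<comment> \<open>Pairing with the indicator of the ring gives \<open>2 * pi\<close> times the
    block value at the origin. Its modulus stays above \<open>\<eta>\<close> along the sequence, so
    the weak limit cannot vanish.\<close>
  have v'0: "nsq v' \<noteq> 0"
  proof
    assume "nsq v' = 0"
    then have "AE \<xi> in lborel. v' \<xi> = 0" by (rule nsq_zero_AE[OF is_fourierD(2)[OF uF]])
    then have zero: "(LINT \<xi>|lborel. v' \<xi> * complex_of_real (indicator (dyadic j) \<xi>)) = 0"
      by (intro integral_eq_zero_AE) (auto elim!: eventually_mono)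
    have "L2 (\<lambda>\<xi>. complex_of_real (indicator (dyadic j) \<xi>))"
    proof -
      have "(\<lambda>x. (norm (indicator (dyadic j) x :: real))\<^sup>2) = indicator (dyadic j)" by (auto simp: indicator_def)
      then show ?thesis using emeasure_dyadic[of j] by (simp add: L2_def integrable_indicator_iff)
    qed
    from weak[OF this] have "(\<lambda>i. LINT \<xi>|lborel. w (k i) \<xi> * complex_of_real (indicator (dyadic j) \<xi>)) \<longlonglongrightarrow> 0"
      by (simp only: zero)
    then have "(\<lambda>i. cmod (LINT \<xi>|lborel. w (k i) \<xi> * complex_of_real (indicator (dyadic j) \<xi>))) \<longlonglongrightarrow> 0"
      by (rule tendsto_norm_zero)
    moreover have "\<eta> \<le> cmod (LINT \<xi>|lborel. w (k i) \<xi> * complex_of_real (indicator (dyadic j) \<xi>))" for i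
    proof -
      have "band (dyadic j) (w (k i)) 0 = (LINT \<xi>|lborel. w (k i) \<xi> * complex_of_real (indicator (dyadic j) \<xi>)) / (2 * pi)"
        unfolding band_def fourier_L1_def by (simp add: scaleR_conv_of_real mult.commute)
      then have "cmod (LINT \<xi>|lborel. w (k i) \<xi> * complex_of_real (indicator (dyadic j) \<xi>)) = 2 * pi * cmod (band (dyadic j) (w (k i)) 0)"
        by (simp add: norm_divide norm_mult)
      also have "\<dots> \<ge> 1 * cmod (band (dyadic j) (w (k i)) 0)"
        using pi_ge_two by (intro mult_right_mono) auto
      finally show ?thesis
        using y[of "n1 (k i)"] band_translate_zero[of "dyadic j" "y (n1 (k i))" "v (n1 (k i))"] n1j[of "k i"]
        unfolding w_def by simp
    qed
    ultimately have "\<eta> \<le> 0" by (intro LIMSEQ_le_const) auto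
    with \<eta> show False by simp
  qed
  have Qu: "0 < Q_func p u"
  proof (rule ccontr)
    assume "\<not> 0 < Q_func p u"
    moreover have "0 \<le> Q_func p u" unfolding Q_func_def by (simp add: integral_nonneg_AE)
    ultimately have "Q_func p u = 0" by linarith
    then have "(LINT x|lborel. \<bar>u x\<bar> powr ?q) = 0" by (simp add: Q_func_def)
    then have "AE x in lborel. \<bar>u x\<bar> powr ?q = 0" by (subst (asm) integral_nonneg_eq_0_iff_AE[OF uq]) auto
    then have "AE x in lborel. (cmod (complex_of_real (u x)))\<^sup>2 = 0" by eventually_elim simp
    then have "nsq (\<lambda>x. complex_of_real (u x)) = 0" unfolding nsq_def by (intro integral_eq_zero_AE)
    with is_fourier_Plancherel[OF uF] v'0 show False by simp
  qed
  \<comment> \<open>The energy share of the remainder. By \<open>ground_scaled\<close> its power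
    bounds the mass of the remainder in the limit; the same scaling applied to \<open>u\<close>
    bounds the two energy shares together by 1.\<close>
  define b where "b = a / ground"
  have b0: "0 \<le> b" using a0 g0 by (simp add: b_def)
  have "1 \<le> (LINT x|lborel. \<bar>u x\<bar> powr ?q) + b powr (?q / 2)"
  proof (rule Brezis_Lieb_le[OF _ _ q(2) ae \<phi>q uq])
    show "(LINT x|lborel. \<bar>\<phi> (k i) x\<bar> powr ?q) = 1" for i using Q\<phi>[of "k i"] by (simp add: Q_func_def)
    show "(LINT x|lborel. \<bar>\<phi> (k i) x - u x\<bar> powr ?q) \<le> (E (d i) / ground) powr (?q / 2)" for i
    proof -
      have Q0: "0 \<le> Q_func p (d i)" unfolding Q_func_def by (simp add: integral_nonneg_AE)
      have "Q_func p (d i) powr (2 / ?q) \<le> E (d i) / ground"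
        using ground_scaled[OF dH[of i]] g0 by (simp add: field_simps)
      then have "(Q_func p (d i) powr (2 / ?q)) powr (?q / 2) \<le> (E (d i) / ground) powr (?q / 2)"
        using p_gt by (intro powr_mono2) auto
      moreover have "(Q_func p (d i) powr (2 / ?q)) powr (?q / 2) = Q_func p (d i)"
      proof -
        have "2 / x * (x / 2) = 1" if "x \<noteq> 0" for x :: real using that by simp
        then have "2 / ?q * (?q / 2) = 1" using p_gt by (metis add_pos_pos less_irrefl less_trans zero_less_one)
        then show ?thesis unfolding powr_powr using Q0 by (simp only:) simp
      qed
      ultimately show ?thesis by (simp add: Q_func_def d_def)
    qed
    have "(\<lambda>i. E (d i) / ground) \<longlonglongrightarrow> b" unfolding b_def using g0 by (intro tendsto_intros Ed) simp
    then show "(\<lambda>i. (E (d i) / ground) powr (?q / 2)) \<longlonglongrightarrow> b powr (?q / 2)"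
      using E_nonneg[OF dH] g0 p_gt by (intro tendsto_powr2 tendsto_const) auto
  qed auto
  then have 1: "1 \<le> Q_func p u + b powr (?q / 2)" by (simp add: Q_func_def)
  have "ground * Q_func p u powr (2 / ?q) \<le> ground - a" using ground_scaled[OF uH] by (simp add: a_def)
  then have "ground * (Q_func p u powr (2 / ?q) + b) \<le> ground * 1"
    using g0 by (simp add: b_def distrib_left)
  then have 2: "Q_func p u powr (2 / ?q) + b \<le> 1" using g0 by (simp only: mult_le_cancel_left_pos)
  have Qu1: "Q_func p u = 1" and "b = 0" using splitting_rigidity[OF Qu b0 q(1) 1 2] by auto
  then have az: "a = 0" using g0 by (simp add: b_def)
  then have Eu: "E u = ground" by (simp add: a_def)
  have norm0: "(\<lambda>i. sobolev_norm s (d i)) \<longlonglongrightarrow> 0"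
  proof (rule Lim_null_comparison)
    have "(\<lambda>i. sqrt (E (d i) / \<kappa>)) \<longlonglongrightarrow> sqrt (a / \<kappa>)" using \<kappa>_pos by (intro tendsto_intros Ed) simp
    then show "(\<lambda>i. sqrt (E (d i) / \<kappa>)) \<longlonglongrightarrow> 0" by (simp add: az)
    have "norm (sobolev_norm s (d i)) \<le> sqrt (E (d i) / \<kappa>)" for i
      unfolding sobolev_norm_fourier[OF dF] using E_coercive[OF dF dint, of i] by (simp add: integral_nonneg_AE)
    then show "\<forall>\<^sub>F i in sequentially. norm (sobolev_norm s (d i)) \<le> sqrt (E (d i) / \<kappa>)" by simp
  qed
  show ?thesis
  proof (intro exI conjI)
    show "strict_mono (n1 \<circ> k)" by (rule strict_mono_o[OF n1 k])
    \<comment> \<open>\<open>y\<close> is indexed by the original sequence, so the composed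
      subsequence selects both the function and its translation.\<close>
    show "(\<lambda>i. sobolev_norm s (\<lambda>x. \<psi>s ((n1 \<circ> k) i) (x + y ((n1 \<circ> k) i)) - u x)) \<longlonglongrightarrow> 0"
      using norm0 by (simp add: d_def[abs_def] \<phi>_def)
  qed (fact uH Qu1 Eu)+
qed

end

subsection \<open>The functional of the theorem\<close>

text \<open>\<open>multiplier\<close> is a choice, so a witness must exist before anything can be
  said about it; integrability and surjectivity of the transform provide one. The transform
  \<open>v'\<close> hidden in the choice may differ from \<open>v\<close> on a null set, which the
  integral ignores.\<close>

lemma multiplier_nsq:
  assumes F: "is_fourier (\<lambda>x. complex_of_real (u x)) v" and [measurable]: "m \<in> borel_measurable borel"
    and int: "integrable lborel (\<lambda>\<xi>. (m \<xi>)\<^sup>2 * (cmod (v \<xi>))\<^sup>2)"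
  shows "(LINT x|lborel. (cmod (multiplier m u x))\<^sup>2) = (LINT \<xi>|lborel. (m \<xi>)\<^sup>2 * (cmod (v \<xi>))\<^sup>2) / (2 * pi)"
proof -
  have sq: "(cmod (complex_of_real (m \<xi>) * z))\<^sup>2 = (m \<xi>)\<^sup>2 * (cmod z)\<^sup>2" for \<xi> z
    by (simp add: norm_mult power_mult_distrib)
  have [measurable]: "v \<in> borel_measurable borel" using is_fourierD(2)[OF F] by (simp add: L2_def)
  have "L2 (\<lambda>\<xi>. complex_of_real (m \<xi>) * v \<xi>)" unfolding L2_def sq using int by simp
  then obtain w where "is_fourier w (\<lambda>\<xi>. complex_of_real (m \<xi>) * v \<xi>)" using fourier_surj by blast
  with F have "\<exists>w v. is_fourier (\<lambda>x. complex_of_real (u x)) v \<and> is_fourier w (\<lambda>\<xi>. complex_of_real (m \<xi>) * v \<xi>)" by blast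
  then have "\<exists>v. is_fourier (\<lambda>x. complex_of_real (u x)) v \<and> is_fourier (multiplier m u) (\<lambda>\<xi>. complex_of_real (m \<xi>) * v \<xi>)"
    unfolding multiplier_def by (rule someI_ex)
  then obtain v' where v': "is_fourier (\<lambda>x. complex_of_real (u x)) v'"
    and w: "is_fourier (multiplier m u) (\<lambda>\<xi>. complex_of_real (m \<xi>) * v' \<xi>)" by blast
  have "2 * pi * nsq (multiplier m u) = (LINT \<xi>|lborel. (m \<xi>)\<^sup>2 * (cmod (v' \<xi>))\<^sup>2)"
    unfolding is_fourier_Plancherel[OF w, symmetric] by (simp only: nsq_def sq)
  also have "\<dots> = (LINT \<xi>|lborel. (m \<xi>)\<^sup>2 * (cmod (v \<xi>))\<^sup>2)"
    by (rule integrable_fourier_cong(2)[OF v' F]) measurable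
  finally show ?thesis by (simp add: nsq_def[of "multiplier m u"] field_simps)
qed

text \<open>The factor \<open>4 * pi\<close> combines the halves in the functional with the
  \<open>2 * pi\<close> of Plancherel. Both terms must be finite separately before their integrals
  may be subtracted under one sign.\<close>

lemma I_func_fourier:
  assumes F: "is_fourier (\<lambda>x. complex_of_real (u x)) v"
    and [measurable]: "l \<in> borel_measurable borel" "b \<in> borel_measurable borel"
    and l: "\<And>\<xi>. 0 \<le> l \<xi>" and b: "\<And>\<xi>. 0 < b \<xi>"
    and i1: "integrable lborel (\<lambda>\<xi>. l \<xi> / b \<xi> * (cmod (v \<xi>))\<^sup>2)"
    and i2: "integrable lborel (\<lambda>\<xi>. 1 / b \<xi> * (cmod (v \<xi>))\<^sup>2)"
  shows "I_func l b c u = (LINT \<xi>|lborel. (l \<xi> - c\<^sup>2) / b \<xi> / (4 * pi) * (cmod (v \<xi>))\<^sup>2)"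
proof -
  have m1: "(sqrt (l \<xi>) / sqrt (b \<xi>))\<^sup>2 = l \<xi> / b \<xi>" and m2: "(1 / sqrt (b \<xi>))\<^sup>2 = 1 / b \<xi>" for \<xi>
    using l[of \<xi>] b[of \<xi>] by (simp_all add: power_divide)
  have "I_func l b c u = 1/2 * ((LINT \<xi>|lborel. l \<xi> / b \<xi> * (cmod (v \<xi>))\<^sup>2) / (2 * pi))
      - c\<^sup>2 / 2 * ((LINT \<xi>|lborel. 1 / b \<xi> * (cmod (v \<xi>))\<^sup>2) / (2 * pi))"
    unfolding I_func_def
    by (subst multiplier_nsq[OF F], measurable, simp only: m1, rule i1,
        subst multiplier_nsq[OF F], measurable, simp only: m2, rule i2, simp only: m1 m2)
  also have "\<dots> = 1 / (4 * pi) * (LINT \<xi>|lborel. l \<xi> / b \<xi> * (cmod (v \<xi>))\<^sup>2)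
      - c\<^sup>2 / (4 * pi) * (LINT \<xi>|lborel. 1 / b \<xi> * (cmod (v \<xi>))\<^sup>2)" by simp
  also have "\<dots> = (LINT \<xi>|lborel. 1 / (4 * pi) * (l \<xi> / b \<xi> * (cmod (v \<xi>))\<^sup>2))
      - (LINT \<xi>|lborel. c\<^sup>2 / (4 * pi) * (1 / b \<xi> * (cmod (v \<xi>))\<^sup>2))"
    by (simp only: integral_mult_right_zero)
  also have "\<dots> = (LINT \<xi>|lborel. 1 / (4 * pi) * (l \<xi> / b \<xi> * (cmod (v \<xi>))\<^sup>2) - c\<^sup>2 / (4 * pi) * (1 / b \<xi> * (cmod (v \<xi>))\<^sup>2))"
    by (rule Bochner_Integration.integral_diff[OF integrable_mult_right[OF i1] integrable_mult_right[OF i2], symmetric])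
  also have "\<dots> = (LINT \<xi>|lborel. (l \<xi> - c\<^sup>2) / b \<xi> / (4 * pi) * (cmod (v \<xi>))\<^sup>2)"
  proof (rule Bochner_Integration.integral_cong[OF refl])
    fix \<xi>
    have "b \<xi> \<noteq> 0" using b[of \<xi>] by simp
    then show "1 / (4 * pi) * (l \<xi> / b \<xi> * (cmod (v \<xi>))\<^sup>2) - c\<^sup>2 / (4 * pi) * (1 / b \<xi> * (cmod (v \<xi>))\<^sup>2)
      = (l \<xi> - c\<^sup>2) / b \<xi> / (4 * pi) * (cmod (v \<xi>))\<^sup>2" by (simp add: field_simps)
  qed
  finally show ?thesis .
qed

lemma smooth_fun_measurable: "smooth_fun f \<Longrightarrow> f \<in> borel_measurable borel"
proof -
  assume "smooth_fun f"
  then have "f differentiable (at x)" for x unfolding smooth_fun_def by (metis funpow_0)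
  then have "continuous_on UNIV f"
    by (intro continuous_at_imp_continuous_on ballI differentiable_imp_continuous_within)
  then show ?thesis by (rule borel_measurable_continuous_onI)
qed

theorem theorem3p11:
  fixes l b :: "real \<Rightarrow> real" and \<rho> r p c :: real and \<psi>s :: "nat \<Rightarrow> real \<Rightarrow> real"
  assumes l_smooth: "smooth_fun l" and l_order: "symbol_order \<rho> l"
    and b_smooth: "smooth_fun b" and b_order: "symbol_order (- r) b"
    and r_nonneg: "r \<ge> 0"
    and l_bounds: "\<exists>c1 c2. c1 > 0 \<and> c2 > 0 \<and> (\<forall>\<xi>. c1\<^sup>2 * (1 + \<xi>\<^sup>2) powr (\<rho>/2) \<le> l \<xi>
                     \<and> l \<xi> \<le> c2\<^sup>2 * (1 + \<xi>\<^sup>2) powr (\<rho>/2))"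
    and b_bounds: "\<exists>c3 c4. c3 > 0 \<and> c4 > 0 \<and> (\<forall>\<xi>. c3\<^sup>2 * (1 + \<xi>\<^sup>2) powr (-r/2) \<le> b \<xi>
                     \<and> b \<xi> \<le> c4\<^sup>2 * (1 + \<xi>\<^sup>2) powr (-r/2))"
    and rho_nonneg: "\<rho> \<ge> 0" and r_rho: "r + \<rho>/2 \<ge> 1"
    and p_gt: "p > 1"
    and c_lt: "c\<^sup>2 < (INF \<xi>. l \<xi> / (1 + \<xi>\<^sup>2) powr (\<rho>/2))"
    and seq_in: "\<And>n. \<psi>s n \<in> sobolev (r/2 + \<rho>/2)"
    and seq_Q: "\<And>n. Q_func p (\<psi>s n) = 1"
    and seq_min: "(\<lambda>n. I_func l b c (\<psi>s n)) \<longlonglongrightarrow>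
        Inf {I_func l b c \<psi> | \<psi>. \<psi> \<in> sobolev (r/2 + \<rho>/2) \<and> Q_func p \<psi> = 1}"
  shows "\<exists>n :: nat \<Rightarrow> nat. \<exists>y :: nat \<Rightarrow> real. \<exists>\<psi>. strict_mono n \<and>
           \<psi> \<in> sobolev (r/2 + \<rho>/2) \<and>
           (\<lambda>k. sobolev_norm (r/2 + \<rho>/2) (\<lambda>x. \<psi>s (n k) (x + y (n k)) - \<psi> x)) \<longlonglongrightarrow> 0 \<and>
           Q_func p \<psi> = 1 \<and>
           I_func l b c \<psi> = Inf {I_func l b c \<phi> | \<phi>. \<phi> \<in> sobolev (r/2 + \<rho>/2) \<and> Q_func p \<phi> = 1}"
proof -
  define s where "s = r/2 + \<rho>/2"
  obtain c1 c2 where c12: "c1 > 0" "c2 > 0" and l1: "\<And>\<xi>. c1\<^sup>2 * (1 + \<xi>\<^sup>2) powr (\<rho>/2) \<le> l \<xi>"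
    and l2: "\<And>\<xi>. l \<xi> \<le> c2\<^sup>2 * (1 + \<xi>\<^sup>2) powr (\<rho>/2)" using l_bounds by blast
  obtain c3 c4 where c34: "c3 > 0" "c4 > 0" and b1: "\<And>\<xi>. c3\<^sup>2 * (1 + \<xi>\<^sup>2) powr (-r/2) \<le> b \<xi>"
    and b2: "\<And>\<xi>. b \<xi> \<le> c4\<^sup>2 * (1 + \<xi>\<^sup>2) powr (-r/2)" using b_bounds by blast
  have lm[measurable]: "l \<in> borel_measurable borel" and bm[measurable]: "b \<in> borel_measurable borel"
    using smooth_fun_measurable l_smooth b_smooth by blast+
  have pp: "0 < (1 + \<xi>\<^sup>2) powr a" for \<xi> a :: real
  proof -
    have "0 < 1 + \<xi>\<^sup>2" by (rule add_pos_nonneg) auto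
    then show ?thesis by simp
  qed
  have l0: "0 < l \<xi>" for \<xi> using order_less_le_trans[OF _ l1[of \<xi>], of 0] pp[of \<xi> "\<rho>/2"] c12 by simp
  have b0: "0 < b \<xi>" for \<xi> using order_less_le_trans[OF _ b1[of \<xi>], of 0] pp[of \<xi> "-r/2"] c34 by simp
  \<comment> \<open>This is the best possible lower constant. The \<open>c1\<close> obtained above
    is an arbitrary witness and may be too small to exceed \<open>c\<close> in modulus, so
    coercivity is derived from the infimum.\<close>
  define L where "L = (INF \<xi>. l \<xi> / (1 + \<xi>\<^sup>2) powr (\<rho>/2))"
  have lL: "L * (1 + \<xi>\<^sup>2) powr (\<rho>/2) \<le> l \<xi>" for \<xi>
  proof -
    have "bdd_below (range (\<lambda>\<xi>. l \<xi> / (1 + \<xi>\<^sup>2) powr (\<rho>/2)))"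
      by (rule bdd_belowI[of _ 0]) (use l0 pp in \<open>auto intro!: divide_nonneg_pos less_imp_le\<close>)
    then have "L \<le> l \<xi> / (1 + \<xi>\<^sup>2) powr (\<rho>/2)" unfolding L_def by (rule cINF_lower) simp
    then show ?thesis using pp[of \<xi> "\<rho>/2"] by (simp only: pos_le_divide_eq)
  qed
  have b_inv1: "(1 + \<xi>\<^sup>2) powr (r/2) / c4\<^sup>2 \<le> 1 / b \<xi>" for \<xi>
  proof -
    have "1 / (c4\<^sup>2 * (1 + \<xi>\<^sup>2) powr (-r/2)) \<le> 1 / b \<xi>"
      using b0[of \<xi>] b2[of \<xi>] by (intro divide_left_mono mult_pos_pos) (use pp c34 in auto)
    moreover have "1 / (c4\<^sup>2 * (1 + \<xi>\<^sup>2) powr (-r/2)) = (1 + \<xi>\<^sup>2) powr (r/2) / c4\<^sup>2"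
      using pp[of \<xi> "r/2"] by (simp add: powr_minus field_simps)
    ultimately show ?thesis by simp
  qed
  have b_inv2: "1 / b \<xi> \<le> (1 + \<xi>\<^sup>2) powr (r/2) / c3\<^sup>2" for \<xi>
  proof -
    have "1 / b \<xi> \<le> 1 / (c3\<^sup>2 * (1 + \<xi>\<^sup>2) powr (-r/2))"
      using b0[of \<xi>] b1[of \<xi>] by (intro divide_left_mono mult_pos_pos) (use pp c34 in auto)
    moreover have "1 / (c3\<^sup>2 * (1 + \<xi>\<^sup>2) powr (-r/2)) = (1 + \<xi>\<^sup>2) powr (r/2) / c3\<^sup>2"
      using pp[of \<xi> "r/2"] by (simp add: powr_minus field_simps)
    ultimately show ?thesis by simp
  qed
  have split: "(1 + \<xi>\<^sup>2) powr s = (1 + \<xi>\<^sup>2) powr (\<rho>/2) * (1 + \<xi>\<^sup>2) powr (r/2)" for \<xi> :: real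
    by (simp add: s_def powr_add mult.commute)
  have one: "1 \<le> (1 + \<xi>\<^sup>2) powr (\<rho>/2)" for \<xi> :: real
    using rho_nonneg by (intro ge_one_powr_ge_zero) auto
  have lb: "l \<xi> / b \<xi> \<le> c2\<^sup>2 / c3\<^sup>2 * (1 + \<xi>\<^sup>2) powr s" for \<xi>
  proof -
    have "l \<xi> * (1 / b \<xi>) \<le> (c2\<^sup>2 * (1 + \<xi>\<^sup>2) powr (\<rho>/2)) * ((1 + \<xi>\<^sup>2) powr (r/2) / c3\<^sup>2)"
      by (intro mult_mono l2 b_inv2) (use b0[of \<xi>] pp in \<open>auto intro: less_imp_le mult_nonneg_nonneg\<close>)
    then show ?thesis by (simp add: split)
  qed
  have ib: "1 / b \<xi> \<le> 1 / c3\<^sup>2 * (1 + \<xi>\<^sup>2) powr s" for \<xi>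
  proof -
    have "1 * ((1 + \<xi>\<^sup>2) powr (r/2) / c3\<^sup>2) \<le> (1 + \<xi>\<^sup>2) powr (\<rho>/2) * ((1 + \<xi>\<^sup>2) powr (r/2) / c3\<^sup>2)"
      by (intro mult_right_mono one) simp
    then show ?thesis using b_inv2[of \<xi>] by (simp add: split)
  qed
  define W where "W \<xi> = (l \<xi> - c\<^sup>2) / b \<xi> / (4 * pi)" for \<xi>
  define \<kappa> where "\<kappa> = (L - c\<^sup>2) / c4\<^sup>2 / (4 * pi)"
  have Lc: "0 < L - c\<^sup>2" using c_lt by (simp add: L_def)
  interpret weighted_energy W "I_func l b c" s p \<kappa> "c2\<^sup>2 / c3\<^sup>2 / (4 * pi)"
  proof
    show "W \<in> borel_measurable borel" unfolding W_def[abs_def] by measurable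
    show "0 < \<kappa>" unfolding \<kappa>_def using Lc c34 by simp
    \<comment> \<open>\<open>s\<close> equals half of \<open>r + \<rho>/2\<close> plus
      \<open>\<rho>/4\<close>.\<close>
    show "1/2 \<le> s" unfolding s_def using r_rho rho_nonneg r_nonneg by simp
    show "1 < p" by (rule p_gt)
    fix \<xi>
    \<comment> \<open>Because \<open>\<rho> \<ge> 0\<close> the power is at least 1, so
      \<open>c\<^sup>2\<close> can be replaced by its multiple with the power and absorbed into the
      leading term.\<close>
    have "(L - c\<^sup>2) * (1 + \<xi>\<^sup>2) powr (\<rho>/2) \<le> l \<xi> - c\<^sup>2"
      using lL[of \<xi>] mult_left_mono[OF one[of \<xi>], of "c\<^sup>2"] by (simp add: left_diff_distrib)
    moreover from this have "0 \<le> l \<xi> - c\<^sup>2" by (rule order_trans[rotated]) (use Lc in simp)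
    ultimately have "((L - c\<^sup>2) * (1 + \<xi>\<^sup>2) powr (\<rho>/2)) * ((1 + \<xi>\<^sup>2) powr (r/2) / c4\<^sup>2) \<le> (l \<xi> - c\<^sup>2) * (1 / b \<xi>)"
      by (intro mult_mono b_inv1) auto
    then have "(L - c\<^sup>2) / c4\<^sup>2 * (1 + \<xi>\<^sup>2) powr s \<le> (l \<xi> - c\<^sup>2) / b \<xi>" by (simp add: split)
    then have "(L - c\<^sup>2) / c4\<^sup>2 * (1 + \<xi>\<^sup>2) powr s / (4 * pi) \<le> (l \<xi> - c\<^sup>2) / b \<xi> / (4 * pi)"
      by (rule divide_right_mono) simp
    then show "\<kappa> * (1 + \<xi>\<^sup>2) powr s \<le> W \<xi>" by (simp add: \<kappa>_def W_def)
    have "(l \<xi> - c\<^sup>2) / b \<xi> \<le> l \<xi> / b \<xi>" using b0[of \<xi>] by (intro divide_right_mono) auto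
    also note lb
    finally have "(l \<xi> - c\<^sup>2) / b \<xi> / (4 * pi) \<le> c2\<^sup>2 / c3\<^sup>2 * (1 + \<xi>\<^sup>2) powr s / (4 * pi)"
      by (rule divide_right_mono) simp
    then show "W \<xi> \<le> c2\<^sup>2 / c3\<^sup>2 / (4 * pi) * (1 + \<xi>\<^sup>2) powr s" by (simp add: W_def)
  next
    fix u v
    assume F: "is_fourier (\<lambda>x. complex_of_real (u x)) v"
      and int: "sob_finite s v"
    have [measurable]: "v \<in> borel_measurable borel" using is_fourierD(2)[OF F] by (simp add: L2_def)
    have dom: "integrable lborel (\<lambda>\<xi>. f \<xi> * (cmod (v \<xi>))\<^sup>2)"
      if [measurable]: "f \<in> borel_measurable borel" and f: "\<And>\<xi>. 0 \<le> f \<xi>" "\<And>\<xi>. f \<xi> \<le> M * (1 + \<xi>\<^sup>2) powr s" for f M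
    proof (rule Bochner_Integration.integrable_bound)
      show "integrable lborel (\<lambda>\<xi>. M * ((1 + \<xi>\<^sup>2) powr s * (cmod (v \<xi>))\<^sup>2))" using int by simp
      have "norm (f \<xi> * (cmod (v \<xi>))\<^sup>2) \<le> norm (M * ((1 + \<xi>\<^sup>2) powr s * (cmod (v \<xi>))\<^sup>2))" for \<xi>
      proof -
        have "f \<xi> * (cmod (v \<xi>))\<^sup>2 \<le> M * (1 + \<xi>\<^sup>2) powr s * (cmod (v \<xi>))\<^sup>2" by (rule mult_right_mono[OF f(2)]) simp
        also have "\<dots> \<le> norm (M * (1 + \<xi>\<^sup>2) powr s * (cmod (v \<xi>))\<^sup>2)" by (simp only: real_norm_def abs_ge_self)
        finally show ?thesis using f(1)[of \<xi>] by (simp add: mult.assoc)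
      qed
      then show "AE \<xi> in lborel. norm (f \<xi> * (cmod (v \<xi>))\<^sup>2) \<le> norm (M * ((1 + \<xi>\<^sup>2) powr s * (cmod (v \<xi>))\<^sup>2))" by simp
    qed measurable
    show "I_func l b c u = (LINT \<xi>|lborel. W \<xi> * (cmod (v \<xi>))\<^sup>2)"
      unfolding W_def
    proof (rule I_func_fourier[OF F lm bm less_imp_le[OF l0] b0])
      show "integrable lborel (\<lambda>\<xi>. l \<xi> / b \<xi> * (cmod (v \<xi>))\<^sup>2)"
        by (rule dom[OF _ _ lb]) (use less_imp_le[OF l0] less_imp_le[OF b0] in auto)
      show "integrable lborel (\<lambda>\<xi>. 1 / b \<xi> * (cmod (v \<xi>))\<^sup>2)"
        by (rule dom[OF _ _ ib]) (use less_imp_le[OF b0] in auto)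
    qed
  qed
  show ?thesis
    using minimizing_sequence_converges[OF seq_in[folded s_def] seq_Q seq_min[folded s_def, folded ground_def]]
    unfolding ground_def unfolding s_def .
qed

end
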